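(* Let $G$ be a graph (parallel edges allowed, no loops), let $d,k\in\mathbb N_0$, and suppose that $\Gamma_f(G)\le k+\chi(d,k)$, where $$\chi(d,k)=\begin{cases}\frac{d}{d+k+1}, & \text{if } d\le k+1,\\[2pt] \frac{d+k}{d+3k+1}, & \text{if } k+1<d<3(k+1).\end{cases}$$ Then $E(G)$ can be partitioned into $k+1$ forests such that in one of these forests each connected component has at most $d$ edges.
   Context: For a graph $H$ write $e(H)=|E(H)|$ and $v(H)=|V(H)|$. The fractional arboricity of $G$ is $\Gamma_f(G)=\max\{\frac{e(H)}{v(H)-1} : H\subseteq G,\ v(H)\ge 2\}$. The hypothesis implicitly requires $d<3(k+1)$ so that $\chi(d,k)$ is defined. *)

theory Defs
  imports Complex_Main "HOL-Library.Disjoint_Sets"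
begin

text \<open>
  Undirected multigraphs: edges are abstract objects, so distinct edges may have the same set of
  ends (parallel edges); an edge with two distinct ends is not a loop.
\<close>

record ('v, 'e) mgraph =
  verts :: "'v set"
  edges :: "'e set"
  ends  :: "'e \<Rightarrow> 'v set"

locale multigraph =
  fixes G :: "('v, 'e) mgraph"
  assumes finite_verts: "finite (verts G)"
    and finite_edges: "finite (edges G)"
    and ends_in_verts: "e \<in> edges G \<Longrightarrow> ends G e \<subseteq> verts G"
    and no_loops: "e \<in> edges G \<Longrightarrow> card (ends G e) = 2"

definition subgraph :: "('v, 'e) mgraph \<Rightarrow> ('v, 'e) mgraph \<Rightarrow> bool" where
  "subgraph H G \<longleftrightarrow> multigraph H \<and> verts H \<subseteq> verts G \<and> edges H \<subseteq> edges G \<and> ends H = ends G"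

definition spanning_subgraph :: "('v, 'e) mgraph \<Rightarrow> 'e set \<Rightarrow> ('v, 'e) mgraph" where
  "spanning_subgraph G F = G\<lparr>edges := F\<rparr>"

definition adj :: "('v, 'e) mgraph \<Rightarrow> ('v \<times> 'v) set" where
  "adj G = {(u, v). \<exists>e\<in>edges G. ends G e = {u, v}}"

definition connected_graph :: "('v, 'e) mgraph \<Rightarrow> bool" where
  "connected_graph G \<longleftrightarrow> verts G \<noteq> {} \<and> (\<forall>u\<in>verts G. \<forall>v\<in>verts G. (u, v) \<in> (adj G)\<^sup>*)"

definition component :: "('v, 'e) mgraph \<Rightarrow> ('v, 'e) mgraph \<Rightarrow> bool" where
  "component C G \<longleftrightarrow> subgraph C G \<and> connected_graph C \<and>
     (\<forall>D. subgraph D G \<and> connected_graph D \<and> subgraph C D \<longrightarrow> D = C)"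

text \<open>
  The cycle visits the distinct vertices \<open>vs\<close> in order, the edge \<open>es ! i\<close> leading from the
  \<open>i\<close>-th vertex to its cyclic successor.  Two parallel edges form a cycle of length 2; this is why
  the edges, too, are required to be distinct.
\<close>

definition is_cycle :: "('v, 'e) mgraph \<Rightarrow> 'v list \<Rightarrow> 'e list \<Rightarrow> bool" where
  "is_cycle G vs es \<longleftrightarrow>
     length vs = length es \<and> length es \<ge> 2 \<and> distinct vs \<and> distinct es \<and>
     set vs \<subseteq> verts G \<and> set es \<subseteq> edges G \<and>
     (\<forall>i<length es. ends G (es ! i) = {vs ! i, vs ! (Suc i mod length vs)})"

definition forest :: "('v, 'e) mgraph \<Rightarrow> bool" where
  "forest G \<longleftrightarrow> multigraph G \<and> (\<nexists>vs es. is_cycle G vs es)"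

definition density_values :: "('v, 'e) mgraph \<Rightarrow> real set" where
  "density_values G = {real (card (edges H)) / (real (card (verts H)) - 1) | H.
     subgraph H G \<and> card (verts H) \<ge> 2}"

text \<open>
  A graph with at most one vertex has no subgraph to maximise over (and no edges); its fractional
  arboricity is taken to be 0.
\<close>

definition fractional_arboricity :: "('v, 'e) mgraph \<Rightarrow> real" where
  "fractional_arboricity G = (if density_values G = {} then 0 else Max (density_values G))"

lemma finite_density_values:
  assumes "multigraph G"
  shows "finite (density_values G)"
proof -
  interpret multigraph G by (rule assms)
  let ?q = "\<lambda>(V, F). real (card F) / (real (card V) - 1)"
  have "density_values G \<subseteq> ?q ` (Pow (verts G) \<times> Pow (edges G))"
    unfolding density_values_def subgraph_def by force
  moreover have "finite (?q ` (Pow (verts G) \<times> Pow (edges G)))"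
    using finite_verts finite_edges by simp
  ultimately show ?thesis by (rule finite_subset)
qed

text \<open>Only meaningful for \<open>d < 3 * (k + 1)\<close>.\<close>

definition chi :: "nat \<Rightarrow> nat \<Rightarrow> real" where
  "chi d k = (if d \<le> k + 1 then real d / (real d + real k + 1)
              else (real d + real k) / (real d + 3 * real k + 1))"

end

theory Submission
  imports Defs
begin

text \<open>
  Call an edge set \<open>A\<close> \<open>k\<close>-sparse if every nonempty vertex set \<open>S\<close> spans at most \<open>k (|S| - 1)\<close> edges of
  \<open>A\<close>; \<open>S\<close> is tight if equality holds, and tight sets that meet have a tight union and a tight
  intersection. Forests are the 1-sparse sets, and by Nash-Williams a \<open>k\<close>-sparse set is a union of
  \<open>k\<close> forests. So we look for a forest \<open>F\<close> with \<open>k\<close>-sparse complement \<open>B\<close> (the blue edges).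

  Choose \<open>F\<close> minimising first the number of edges, then the total excess of the components over \<open>d\<close>
  edges. If the excess is positive, start from a component with more than \<open>d\<close> edges and repeatedly
  add a component that meets the tight hull of those found so far, keeping the sequence of component
  sizes lexicographically least. The explored set \<open>H\<close> is tight for \<open>B\<close>, hence spanned by \<open>k\<close> blue
  trees, which we orient towards a root. A component with few edges is entered from another
  component \<open>K\<close> by an edge of some blue tree \<open>T\<close>. If \<open>K\<close> is too small, or if too many small components
  are entered from \<open>K\<close> through \<open>T\<close>, then several of these blue edges can be exchanged simultaneously
  against edges of \<open>K\<close> and at most one edge of an earlier component, contradicting minimality.

  Hence \<open>K\<close> can pay for its small components. For \<open>d \<le> k + 1\<close> only isolated vertices have density
  below \<open>\<chi>(d,k)\<close>, and each tree contributes at most one of them. For \<open>k + 1 < d < 3 (k + 1)\<close> components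
  with one edge are small as well, and each tree contributes at most two small components, not both
  isolated; the value of \<open>\<chi>(d,k)\<close> is exactly what this allows. So \<open>H\<close> is denser than assumed.
\<close>

section \<open>Sparse edge sets and tight vertex sets\<close>

text \<open>A single exchange only shows that the owner \<open>K\<close> of a small component is not
  too small; to limit the number of small components entered through one tree, their edges must be
  exchanged at once. Cutting the parent edges of a set \<open>X\<close> of tails leaves |X| + 1
  pieces of the blue tree. One needs red edges of \<open>K\<close> that separate the tails in the
  red forest and yet close no cycle among the blue pieces; \<open>tree_split\<close> finds them. If
  \<open>K\<close> contains no vertex known to lie in the root piece, it provides one edge too few,
  and the missing one must come from an earlier component.

  The constants come from discharging. Write \<chi> = N / (M + N) and give a component with c edges
  the weight M c - N. For d \<le> k + 1 take M = k + 1, N = d: an isolated vertex owes d, and its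
  owner has at least d edges, hence weight at least k d. Otherwise take M = 2 k + 1, N = d + k: an
  owner with d edges has weight k (2 d - 1), which is exactly the debt k ((d + k) + (d - k - 1)) of
  an isolated vertex and a single edge in each of k trees. A component with two edges has weight 3 k
  + 2 - d, and this is nonnegative just when d < 3 (k + 1).\<close>

context multigraph
begin

definition inside :: "'e set \<Rightarrow> 'v set \<Rightarrow> 'e set" where
  "inside A S = {e \<in> A. ends G e \<subseteq> S}"

definition sparse :: "nat \<Rightarrow> 'e set \<Rightarrow> bool" where
  "sparse k A \<longleftrightarrow> A \<subseteq> edges G \<and>
     (\<forall>S. S \<subseteq> verts G \<longrightarrow> S \<noteq> {} \<longrightarrow> card (inside A S) \<le> k * (card S - 1))"

definition tight :: "nat \<Rightarrow> 'e set \<Rightarrow> 'v set \<Rightarrow> bool" where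
  "tight k A S \<longleftrightarrow> S \<subseteq> verts G \<and> S \<noteq> {} \<and> card (inside A S) = k * (card S - 1)"

lemma finite_subset_verts: "S \<subseteq> verts G \<Longrightarrow> finite S"
  using finite_verts finite_subset by blast

lemma finite_subset_edges: "A \<subseteq> edges G \<Longrightarrow> finite A"
  using finite_edges finite_subset by blast

lemma ends_nonempty: "e \<in> edges G \<Longrightarrow> ends G e \<noteq> {}"
  using no_loops by fastforce

lemma finite_inside: "A \<subseteq> edges G \<Longrightarrow> finite (inside A S)"
  unfolding inside_def by (rule finite_subset[OF _ finite_edges]) auto

lemma inside_subset: "inside A S \<subseteq> A"
  by (auto simp: inside_def)

lemma inside_mono: "A \<subseteq> A' \<Longrightarrow> S \<subseteq> S' \<Longrightarrow> inside A S \<subseteq> inside A' S'"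
  by (auto simp: inside_def)

lemma inside_inside: "inside (inside A S) S' = inside A (S \<inter> S')"
  by (auto simp: inside_def)

lemma inside_Un: "inside (A \<union> A') S = inside A S \<union> inside A' S"
  by (auto simp: inside_def)

lemma sparse_edges: "sparse k A \<Longrightarrow> A \<subseteq> edges G"
  by (simp add: sparse_def)

lemma sparse_card: "sparse k A \<Longrightarrow> S \<subseteq> verts G \<Longrightarrow> S \<noteq> {} \<Longrightarrow> card (inside A S) \<le> k * (card S - 1)"
  by (simp add: sparse_def)

lemma sparse_subset:
  assumes "sparse k A" "A' \<subseteq> A"
  shows "sparse k A'"
proof -
  have "card (inside A' S) \<le> card (inside A S)" for S
    by (rule card_mono) (use assms in \<open>auto simp: sparse_def finite_inside inside_mono\<close>)
  with assms show ?thesis unfolding sparse_def by (meson order_trans)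
qed

lemma tightI:
  assumes "sparse k A" "S \<subseteq> verts G" "S \<noteq> {}" "k * (card S - 1) \<le> card (inside A S)"
  shows "tight k A S"
  using assms sparse_card[OF assms(1-3)] by (simp add: tight_def)

lemma tight_verts: "tight k A S \<Longrightarrow> S \<subseteq> verts G"
  by (simp add: tight_def)

lemma tight_nonempty: "tight k A S \<Longrightarrow> S \<noteq> {}"
  by (simp add: tight_def)

lemma tight_finite: "tight k A S \<Longrightarrow> finite S"
  by (simp add: tight_def finite_subset_verts)

lemma tight_card: "tight k A S \<Longrightarrow> card (inside A S) = k * (card S - 1)"
  by (simp add: tight_def)

lemma tight_card_pos: "tight k A S \<Longrightarrow> 0 < card S"
  by (simp add: card_gt_0_iff tight_finite tight_nonempty)

lemma inside_singleton:
  assumes "A \<subseteq> edges G" shows "inside A {v} = {}"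
proof -
  have False if "e \<in> A" "ends G e \<subseteq> {v}" for e
    using card_mono[OF _ that(2)] no_loops[of e] that assms by auto
  then show ?thesis by (auto simp: inside_def)
qed

lemma tight_singleton: "A \<subseteq> edges G \<Longrightarrow> v \<in> verts G \<Longrightarrow> tight k A {v}"
  by (simp add: tight_def inside_singleton)

lemma inside_supermodular:
  assumes "A \<subseteq> edges G"
  shows "card (inside A S) + card (inside A S') \<le> card (inside A (S \<union> S')) + card (inside A (S \<inter> S'))"
proof -
  have "card (inside A S) + card (inside A S')
      = card (inside A S \<union> inside A S') + card (inside A S \<inter> inside A S')"
    using card_Un_Int[OF finite_inside[OF assms, of S] finite_inside[OF assms, of S']] .
  moreover have "card (inside A S \<union> inside A S') \<le> card (inside A (S \<union> S'))"
    by (rule card_mono) (use finite_inside assms in \<open>auto simp: inside_def\<close>)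
  moreover have "inside A S \<inter> inside A S' = inside A (S \<inter> S')"
    by (auto simp: inside_def)
  ultimately show ?thesis by simp
qed

lemma card_Un_Int_minus_1:
  assumes "finite S" "finite S'" "S \<inter> S' \<noteq> {}"
  shows "(card S - 1) + (card S' - 1) = (card (S \<union> S') - 1) + (card (S \<inter> S') - 1)"
proof -
  have "card (S \<inter> S') > 0" using assms by (simp add: card_gt_0_iff)
  moreover have "card (S \<inter> S') \<le> card S" "card (S \<inter> S') \<le> card S'" "card S \<le> card (S \<union> S')"
    using assms by (auto intro: card_mono)
  ultimately show ?thesis using card_Un_Int[OF assms(1,2)] by linarith
qed

text \<open>On sets that meet, the edge count is supermodular and the bound
  \<open>k * (card S - 1)\<close> is modular; two equalities therefore leave no slack in the union
  or in the intersection.\<close>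

lemma
  assumes "sparse k A" "tight k A S" "tight k A S'" "S \<inter> S' \<noteq> {}"
  shows tight_Un: "tight k A (S \<union> S')" and tight_Int: "tight k A (S \<inter> S')"
proof -
  have sub: "S \<union> S' \<subseteq> verts G" "S \<inter> S' \<subseteq> verts G" "S \<union> S' \<noteq> {}"
    using assms tight_verts[OF assms(2)] tight_verts[OF assms(3)] by auto
  have "k * (card S - 1) + k * (card S' - 1) = k * (card (S \<union> S') - 1) + k * (card (S \<inter> S') - 1)"
    using card_Un_Int_minus_1[OF tight_finite[OF assms(2)] tight_finite[OF assms(3)] assms(4)]
    by (metis add_mult_distrib2)
  moreover note inside_supermodular[OF sparse_edges[OF assms(1)], of S S']
    sparse_card[OF assms(1) sub(1,3)] sparse_card[OF assms(1) sub(2) assms(4)]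
    tight_card[OF assms(2)] tight_card[OF assms(3)]
  ultimately have "card (inside A (S \<union> S')) = k * (card (S \<union> S') - 1)"
    "card (inside A (S \<inter> S')) = k * (card (S \<inter> S') - 1)" by linarith+
  then show "tight k A (S \<union> S')" "tight k A (S \<inter> S')" using sub assms(4) by (auto simp: tight_def)
qed

lemma sparse_insert:
  assumes "sparse k A" "e \<in> edges G" "\<And>S. tight k A S \<Longrightarrow> \<not> ends G e \<subseteq> S"
  shows "sparse k (insert e A)"
  unfolding sparse_def
proof (intro conjI allI impI)
  show "insert e A \<subseteq> edges G" using assms sparse_edges by blast
  fix S assume S: "S \<subseteq> verts G" "S \<noteq> {}"
  show "card (inside (insert e A) S) \<le> k * (card S - 1)"
  proof (cases "ends G e \<subseteq> S")
    case True
    then have "card (inside A S) \<noteq> k * (card S - 1)"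
      using assms(3)[of S] S by (auto simp: tight_def)
    with sparse_card[OF assms(1) S] have "card (inside A S) < k * (card S - 1)" by simp
    moreover have "inside (insert e A) S \<subseteq> insert e (inside A S)" by (auto simp: inside_def)
    then have "card (inside (insert e A) S) \<le> card (insert e (inside A S))"
      by (rule card_mono[rotated]) (simp add: finite_inside sparse_edges[OF assms(1)])
    moreover have "card (insert e (inside A S)) \<le> Suc (card (inside A S))" by (rule card_insert_le_m1) auto
    ultimately show ?thesis by linarith
  next
    case False
    then have "inside (insert e A) S = inside A S" by (auto simp: inside_def)
    then show ?thesis using sparse_card[OF assms(1) S] by simp
  qed
qed

lemma not_sparse_insertE:
  assumes "sparse k A" "e \<in> edges G" "\<not> sparse k (insert e A)"
  obtains S where "tight k A S" "ends G e \<subseteq> S"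
  using sparse_insert[OF assms(1,2)] assms(3) by blast

lemma sparse_insert_not_tight:
  assumes "sparse k (insert e A)" "e \<notin> A" "ends G e \<subseteq> S"
  shows "\<not> tight k A S"
proof
  assume t: "tight k A S"
  have "inside (insert e A) S = insert e (inside A S)" "e \<notin> inside A S"
    using assms by (auto simp: inside_def)
  moreover have "finite (inside A S)" using sparse_edges[OF assms(1)] by (auto intro: finite_inside)
  ultimately have "card (inside (insert e A) S) = Suc (card (inside A S))" by simp
  with sparse_card[OF assms(1) tight_verts[OF t] tight_nonempty[OF t]] tight_card[OF t]
  show False by simp
qed

lemma card_inside_disjoint_union:
  assumes "finite I" "disjoint_family_on T I" "\<And>i. i \<in> I \<Longrightarrow> T i \<subseteq> edges G"
  shows "card (inside (\<Union>i\<in>I. T i) S) = (\<Sum>i\<in>I. card (inside (T i) S))"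
proof -
  have "inside (\<Union>i\<in>I. T i) S = (\<Union>i\<in>I. inside (T i) S)" by (auto simp: inside_def)
  moreover have "card (\<Union>i\<in>I. inside (T i) S) = (\<Sum>i\<in>I. card (inside (T i) S))"
    by (rule card_UN_disjoint) (use assms in \<open>auto simp: finite_inside disjoint_family_on_def dest!: subsetD[OF inside_subset]\<close>)
  ultimately show ?thesis by simp
qed

lemma sparse_UN:
  assumes "disjoint_family_on T {..<k}" "\<And>i. i < k \<Longrightarrow> sparse 1 (T i)"
  shows "sparse k (\<Union>i<k. T i)"
  unfolding sparse_def
proof (intro conjI allI impI)
  show "(\<Union>i<k. T i) \<subseteq> edges G" using assms(2) sparse_edges by fastforce
  fix S assume S: "S \<subseteq> verts G" "S \<noteq> {}"
  have "card (inside (\<Union>i<k. T i) S) = (\<Sum>i<k. card (inside (T i) S))"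
    by (rule card_inside_disjoint_union) (use assms sparse_edges in auto)
  also have "\<dots> \<le> (\<Sum>i<k. card S - 1)"
    by (rule sum_mono) (use sparse_card[OF assms(2) S] in auto)
  finally show "card (inside (\<Union>i<k. T i) S) \<le> k * (card S - 1)" by simp
qed

text \<open>Each of the \<open>k\<close> forests contributes at most \<open>card S - 1\<close>
  edges, so the total forces equality in every summand: a tight set is spanned by a tree of each
  forest.\<close>

lemma tight_UN_D:
  assumes "disjoint_family_on T {..<k}" "\<And>i. i < k \<Longrightarrow> sparse 1 (T i)"
    and t: "tight k (\<Union>i<k. T i) S" and "j < k"
  shows "tight 1 (T j) S"
proof -
  note S = tight_verts[OF t] tight_nonempty[OF t]
  have le: "card (inside (T i) S) \<le> card S - 1" if "i < k" for i
    using sparse_card[OF assms(2)[OF that] S] by simp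
  have "card (inside (\<Union>i<k. T i) S) = (\<Sum>i<k. card (inside (T i) S))"
    by (rule card_inside_disjoint_union) (use assms sparse_edges in auto)
  with tight_card[OF t] have "(\<Sum>i<k. card (inside (T i) S)) = (\<Sum>i<k. card S - 1)" by simp
  then have "card (inside (T j) S) = card S - 1"
    by (rule sum_mono_inv) (use le \<open>j < k\<close> in auto)
  with S show ?thesis by (simp add: tight_def)
qed

section \<open>Trees: leaves, induction from a root, labels of pieces\<close>

lemma tree_leaf:
  assumes F: "sparse 1 F" and W: "tight 1 F W" and r: "r \<in> W" and two: "card W \<ge> 2"
  obtains u v e where "v \<in> W" "v \<noteq> r" "u \<in> W" "u \<noteq> v" "e \<in> F" "ends G e = {u, v}"
    "inside F W = insert e (inside F (W - {v}))" "tight 1 F (W - {v})"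
proof -
  let ?I = "inside F W"
  have fI: "finite ?I" using F by (simp add: sparse_edges finite_inside)
  have fW: "finite W" using W by (rule tight_finite)
  define deg where "deg v = card {e \<in> ?I. v \<in> ends G e}" for v
  have cI: "card ?I = card W - 1" using tight_card[OF W] by simp
  have sumdeg: "(\<Sum>v\<in>W. deg v) = 2 * (card W - 1)"
  proof -
    have "(\<Sum>v\<in>W. deg v) = (\<Sum>v\<in>W. \<Sum>e\<in>?I. if v \<in> ends G e then 1 else 0)"
      unfolding deg_def using fI by (simp add: sum.If_cases Int_def)
    also have "\<dots> = (\<Sum>e\<in>?I. \<Sum>v\<in>W. if v \<in> ends G e then 1 else 0)" by (rule sum.swap)
    also have "\<dots> = (\<Sum>e\<in>?I. 2)"
    proof (rule sum.cong[OF refl])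
      fix e assume e: "e \<in> ?I"
      then have "{v \<in> W. v \<in> ends G e} = ends G e" by (auto simp: inside_def)
      moreover have "e \<in> edges G" using e sparse_edges[OF F] by (auto simp: inside_def)
      ultimately show "(\<Sum>v\<in>W. if v \<in> ends G e then 1 else 0) = (2::nat)"
        using fW no_loops[of e] by (simp add: sum.If_cases Int_def)
    qed
    finally show ?thesis using cI by simp
  qed
  have split: "?I = {e \<in> ?I. v \<in> ends G e} \<union> inside F (W - {v})" for v
    by (auto simp: inside_def)
  have rem: "W - {v} \<subseteq> verts G" "W - {v} \<noteq> {}" if "v \<in> W" for v
  proof -
    show "W - {v} \<subseteq> verts G" using tight_verts[OF W] by blast
    have "card (W - {v}) \<ge> 1" using two that fW by simp
    then show "W - {v} \<noteq> {}" by (metis card.empty not_one_le_zero)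
  qed
  have cI_split: "card ?I = deg v + card (inside F (W - {v}))" if "v \<in> W" for v
    unfolding deg_def
  proof (subst split[of v], rule card_Un_disjoint)
    show "finite {e \<in> ?I. v \<in> ends G e}" using fI by simp
    show "finite (inside F (W - {v}))" by (rule finite_inside[OF sparse_edges[OF F]])
  qed (auto simp: inside_def)
  \<comment> \<open>A vertex of degree 0 would leave all \<open>card W - 1\<close> edges on
    \<open>W - {v}\<close>, one more than sparsity allows.\<close>
  have deg1: "deg v \<ge> 1" if "v \<in> W" for v
    using cI_split[OF that] sparse_card[OF F rem[OF that]] cI that fW two by simp
  \<comment> \<open>With degree at least 1 at \<open>r\<close> and at least 2 elsewhere, the degree
    sum would exceed \<open>2 * (card W - 1)\<close>.\<close>
  have "\<exists>v\<in>W - {r}. deg v < 2"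
  proof (rule ccontr)
    assume "\<not> ?thesis"
    then have "(\<Sum>v\<in>W - {r}. 2) \<le> (\<Sum>v\<in>W - {r}. deg v)" by (intro sum_mono) (auto simp: not_less)
    moreover have "(\<Sum>v\<in>W. deg v) = deg r + (\<Sum>v\<in>W - {r}. deg v)"
      by (rule sum.remove) (use fW r in auto)
    ultimately show False using sumdeg deg1[OF r] fW r by simp
  qed
  then obtain v where v: "v \<in> W" "v \<noteq> r" "deg v = 1" using deg1 by force
  then obtain e where e: "{e \<in> ?I. v \<in> ends G e} = {e}"
    unfolding deg_def by (auto simp: card_1_singleton_iff)
  then have eI: "e \<in> ?I" "v \<in> ends G e" by auto
  have eF: "e \<in> F" using eI by (auto simp: inside_def)
  have "card (ends G e) = 2" using eF sparse_edges[OF F] no_loops by auto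
  then obtain a b where ab: "ends G e = {a, b}" "a \<noteq> b" by (auto simp: card_2_iff)
  have "v = a \<or> v = b" using ab eI(2) by auto
  then obtain u where u: "u \<noteq> v" "ends G e = {u, v}"
    using ab by (metis insert_commute)
  show ?thesis
  proof (rule that[of v u e])
    show "u \<in> W" using u eI by (auto simp: inside_def)
    show "inside F W = insert e (inside F (W - {v}))" using split[of v] e by simp
    show "tight 1 F (W - {v})"
      unfolding tight_def using rem[OF v(1)] cI_split[OF v(1)] v cI fW by simp
  qed (use v u eF in auto)
qed

text \<open>The root can be prescribed because \<open>tree_leaf\<close> finds a leaf different from
  it. All intermediate trees are induced by their vertex sets, so each step brings exactly one new
  edge.\<close>

lemma tree_induct [consumes 3, case_names root leaf]:
  assumes F: "sparse 1 F" and "tight 1 F W" and "r \<in> W"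
    and base: "Q {r}"
    and step: "\<And>W u v e. tight 1 F W \<Longrightarrow> r \<in> W \<Longrightarrow> u \<in> W \<Longrightarrow> v \<notin> W \<Longrightarrow> v \<in> verts G \<Longrightarrow> e \<in> F \<Longrightarrow>
      ends G e = {u, v} \<Longrightarrow> inside F (insert v W) = insert e (inside F W) \<Longrightarrow> Q W \<Longrightarrow> Q (insert v W)"
  shows "Q W"
  using assms(2,3)
proof (induction "card W" arbitrary: W rule: less_induct)
  case (less W)
  have fW: "finite W" using less.prems tight_finite by blast
  show ?case
  proof (cases "card W \<ge> 2")
    case False
    then have "card W = 1" using tight_card_pos[OF less.prems(1)] by simp
    then have "W = {r}" using less.prems(2) by (auto simp: card_1_singleton_iff)
    then show ?thesis using base by simp
  next
    case True
    from tree_leaf[OF F less.prems True] obtain u v e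
      where *: "v \<in> W" "v \<noteq> r" "u \<in> W" "u \<noteq> v" "e \<in> F" "ends G e = {u, v}"
        "inside F W = insert e (inside F (W - {v}))" "tight 1 F (W - {v})" .
    have "Q (W - {v})"
      by (rule less.hyps) (use * less.prems fW in \<open>auto simp: card_Diff1_less simp del: card_Diff_insert card_Diff_singleton\<close>)
    moreover have "insert v (W - {v}) = W" using * by auto
    moreover have "v \<in> verts G" using * tight_verts[OF less.prems(1)] by auto
    ultimately show ?thesis
      using step[of "W - {v}" u v e] * less.prems by auto
  qed
qed

text \<open>Tight sets around consecutive edges of a tree share a vertex, so their union stays tight
  and grows along the tree.\<close>

lemma tree_in_tight:
  assumes F: "sparse 1 F" and W: "tight 1 F W" and B: "sparse k B"
    and cover: "\<And>e. e \<in> inside F W \<Longrightarrow> \<exists>S. tight k B S \<and> ends G e \<subseteq> S"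
  shows "\<exists>S. tight k B S \<and> W \<subseteq> S"
proof -
  obtain r where r: "r \<in> W" using tight_nonempty[OF W] by blast
  have "(\<forall>e\<in>inside F W. \<exists>S. tight k B S \<and> ends G e \<subseteq> S) \<longrightarrow> (\<exists>S. tight k B S \<and> W \<subseteq> S)"
    using F W r
  proof (induction rule: tree_induct)
    case root
    then show ?case
      using tight_singleton[OF sparse_edges[OF B], of r k] r tight_verts[OF W] by blast
  next
    case (leaf W u v e)
    show ?case
    proof
      assume *: "\<forall>e\<in>inside F (insert v W). \<exists>S. tight k B S \<and> ends G e \<subseteq> S"
      then obtain S where S: "tight k B S" "W \<subseteq> S" using leaf by auto
      obtain S' where S': "tight k B S'" "{u, v} \<subseteq> S'" using * leaf by (metis insertI1)
      have "tight k B (S \<union> S')" by (rule tight_Un[OF B S(1) S'(1)]) (use leaf S S' in auto)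
      moreover have "insert v W \<subseteq> S \<union> S'" using S S' by auto
      ultimately show "\<exists>S. tight k B S \<and> insert v W \<subseteq> S" by blast
    qed
  qed
  then show ?thesis using cover by blast
qed

text \<open>The map \<open>\<pi>\<close> sends a vertex to the first member of
  \<open>insert r X\<close> on its way to the root; it names the pieces that remain when the parent
  edges of \<open>X\<close> are cut. Its recursion along \<open>par\<close> replaces a theory of
  paths and ancestors.\<close>

lemma rooted_tree:
  assumes "sparse 1 T" "tight 1 T W" "r \<in> W"
  obtains par pe where
    "\<forall>v\<in>W - {r}. par v \<in> W \<and> ends G (pe v) = {v, par v}"
    "inside T W = pe ` (W - {r})"
    "\<forall>X. \<exists>\<pi>. (\<forall>x\<in>insert r X. \<pi> x = x) \<and> (\<forall>v\<in>W. \<pi> v \<in> insert r X) \<and>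
       (\<forall>v\<in>W - insert r X. \<pi> v = \<pi> (par v))"
proof -
  have "\<exists>par pe. (\<forall>v\<in>W - {r}. par v \<in> W \<and> ends G (pe v) = {v, par v}) \<and> inside T W = pe ` (W - {r}) \<and>
    (\<forall>X. \<exists>\<pi>. (\<forall>x\<in>insert r X. \<pi> x = x) \<and> (\<forall>v\<in>W. \<pi> v \<in> insert r X) \<and>
       (\<forall>v\<in>W - insert r X. \<pi> v = \<pi> (par v)))"
    using assms
  proof (induction rule: tree_induct)
    case root
    show ?case
      by (intro exI[of _ undefined] conjI allI exI[of _ "\<lambda>x. x"])
        (auto simp: inside_singleton sparse_edges[OF assms(1)])
  next
    case (leaf W u v e)
    from leaf(9) obtain par pe where
      1: "\<forall>v\<in>W - {r}. par v \<in> W \<and> ends G (pe v) = {v, par v}" and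
      2: "inside T W = pe ` (W - {r})" and
      3: "\<forall>X. \<exists>\<pi>. (\<forall>x\<in>insert r X. \<pi> x = x) \<and> (\<forall>v\<in>W. \<pi> v \<in> insert r X) \<and>
       (\<forall>v\<in>W - insert r X. \<pi> v = \<pi> (par v))" by (elim exE conjE)
    let ?par = "par(v := u)" and ?pe = "pe(v := e)"
    have "\<exists>\<pi>. (\<forall>x\<in>insert r X. \<pi> x = x) \<and> (\<forall>w\<in>insert v W. \<pi> w \<in> insert r X) \<and>
       (\<forall>w\<in>insert v W - insert r X. \<pi> w = \<pi> (?par w))" for X
    proof -
      from 3[rule_format, of X] obtain \<pi> where \<pi>: "\<forall>x\<in>insert r X. \<pi> x = x" "\<forall>v\<in>W. \<pi> v \<in> insert r X"
        "\<forall>v\<in>W - insert r X. \<pi> v = \<pi> (par v)" by blast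
      \<comment> \<open>The new leaf is the parent of no old vertex, so old labels survive; the leaf
        labels itself or inherits from \<open>u\<close>.\<close>
      let ?\<pi> = "\<pi>(v := if v \<in> X then v else \<pi> u)"
      have "par w \<noteq> v" if "w \<in> W" "w \<noteq> r" for w using 1 that leaf by blast
      then have "(\<forall>x\<in>insert r X. ?\<pi> x = x) \<and> (\<forall>w\<in>insert v W. ?\<pi> w \<in> insert r X) \<and>
         (\<forall>w\<in>insert v W - insert r X. ?\<pi> w = ?\<pi> (?par w))"
        using \<pi> leaf(2-4) by auto
      then show ?thesis by - (rule exI[of _ ?\<pi>])
    qed
    moreover have "\<forall>w\<in>insert v W - {r}. ?par w \<in> insert v W \<and> ends G (?pe w) = {w, ?par w}"
      using 1 leaf by auto
    moreover have "inside T (insert v W) = ?pe ` (insert v W - {r})"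
    proof -
      have "?pe ` (insert v W - {r}) = insert e (pe ` (W - {r}))" using leaf by auto
      then show ?thesis using 2 leaf by simp
    qed
    ultimately show ?case by - (rule exI[of _ ?par], rule exI[of _ ?pe], blast)
  qed
  then show ?thesis by (elim exE conjE) (rule that)
qed

section \<open>The Nash-Williams decomposition\<close>

text \<open>For \<open>k = 1\<close> the tight sets are the vertex sets of subtrees, so on vertices
  of the graph this is connectedness by edges of \<open>A\<close>, expressed without walks.\<close>

definition joined :: "'e set \<Rightarrow> 'v \<Rightarrow> 'v \<Rightarrow> bool" where
  "joined A u v \<longleftrightarrow> (\<exists>S. tight 1 A S \<and> u \<in> S \<and> v \<in> S)"

lemma joined_trans:
  assumes "sparse 1 A" "joined A u v" "joined A v w" shows "joined A u w"
  using assms tight_Un[OF assms(1)] unfolding joined_def by (metis IntI UnI1 UnI2 empty_iff)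

lemma joined_sym: "joined A u v \<Longrightarrow> joined A v u"
  by (auto simp: joined_def)

lemma tight_ends:
  assumes "sparse 1 A" "e \<in> A" shows "tight 1 A (ends G e)"
proof (rule tightI[OF assms(1)])
  have e: "e \<in> edges G" using assms sparse_edges by blast
  then show "ends G e \<subseteq> verts G" "ends G e \<noteq> {}" using ends_in_verts ends_nonempty by auto
  have "{e} \<subseteq> inside A (ends G e)" using assms by (auto simp: inside_def)
  then have "card {e} \<le> card (inside A (ends G e))"
    by (rule card_mono[OF finite_inside[OF sparse_edges[OF assms(1)]]])
  then show "1 * (card (ends G e) - 1) \<le> card (inside A (ends G e))" using no_loops[OF e] by simp
qed

lemma joined_edge: "sparse 1 A \<Longrightarrow> e \<in> A \<Longrightarrow> ends G e = {u, v} \<Longrightarrow> joined A u v"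
  using tight_ends[of A e] by (auto simp: joined_def)

lemma joined_mono:
  assumes "sparse 1 A" "sparse 1 A'"
    and edges: "\<And>e u v. e \<in> A \<Longrightarrow> ends G e = {u, v} \<Longrightarrow> joined A' u v"
    and "joined A a b"
  shows "joined A' a b"
proof -
  obtain S where S: "tight 1 A S" "a \<in> S" "b \<in> S" using assms by (auto simp: joined_def)
  have "\<forall>w\<in>S. joined A' a w"
    using assms(1) S(1,2)
  proof (induction rule: tree_induct)
    case root
    have "tight 1 A' {a}"
      using tight_singleton[OF sparse_edges[OF assms(2)]] tight_verts[OF S(1)] S(2) by blast
    then show ?case by (auto simp: joined_def)
  next
    case (leaf W u v e)
    then have "joined A' a u" "joined A' u v" using edges by auto
    with leaf show ?case using joined_trans[OF assms(2)] by blast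
  qed
  then show ?thesis using S by blast
qed

text \<open>By \<open>tight_Un\<close>, a largest tight set through \<open>u\<close> contains every
  other one.\<close>

lemma tight_joined_class:
  assumes "sparse 1 A" "u \<in> verts G" shows "tight 1 A {v. joined A u v}"
proof -
  let ?Q = "\<lambda>S. tight 1 A S \<and> u \<in> S"
  have "?Q {u}" using tight_singleton[OF sparse_edges[OF assms(1)] assms(2)] by simp
  moreover have "\<forall>S. ?Q S \<longrightarrow> card S < Suc (card (verts G))"
    using tight_verts by (meson card_mono finite_verts le_imp_less_Suc)
  ultimately obtain S where S: "?Q S" "\<And>S'. ?Q S' \<Longrightarrow> card S' \<le> card S"
    using ex_has_greatest_nat[of ?Q "{u}" card "Suc (card (verts G))"] by (metis le_simps(2))
  have "S' \<subseteq> S" if S': "?Q S'" for S'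
  proof -
    have "?Q (S \<union> S')" using tight_Un[OF assms(1)] S(1) S' by blast
    then have "card (S \<union> S') \<le> card S" by (rule S(2))
    moreover have "finite (S \<union> S')" using S S' tight_finite by blast
    ultimately have "S = S \<union> S'" by (intro card_seteq) auto
    then show ?thesis by blast
  qed
  then have "{v. joined A u v} = S" using S(1) by (auto simp: joined_def)
  then show ?thesis using S by simp
qed

definition forest_decomposition :: "nat \<Rightarrow> 'e set \<Rightarrow> (nat \<Rightarrow> 'e set) \<Rightarrow> bool" where
  "forest_decomposition k A T \<longleftrightarrow>
     (\<forall>i<k. sparse 1 (T i)) \<and> disjoint_family_on T {..<k} \<and> (\<Union>i<k. T i) = A"

lemma tight_superset:
  assumes "tight k A S" "sparse k A'" "inside A S \<subseteq> A'"
  shows "tight k A' S"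
proof (rule tightI[OF assms(2) tight_verts[OF assms(1)] tight_nonempty[OF assms(1)]])
  have "inside A S \<subseteq> inside A' S" using assms(3) by (auto simp: inside_def)
  then have "card (inside A S) \<le> card (inside A' S)"
    by (rule card_mono[OF finite_inside[OF sparse_edges[OF assms(2)]]])
  then show "k * (card S - 1) \<le> card (inside A' S)" using tight_card[OF assms(1)] by simp
qed

text \<open>The smallest tight set around the ends of \<open>e\<close> carries the path of
  \<open>T\<close> between them, so each of its edges lies on the cycle that \<open>e\<close>
  closes.\<close>

lemma fundamental_exchange:
  assumes T: "sparse 1 T" and e: "e \<in> edges G" and dep: "\<not> sparse 1 (insert e T)"
  obtains S where "tight 1 T S" "ends G e \<subseteq> S" "\<And>g. g \<in> inside T S \<Longrightarrow> sparse 1 (insert e (T - {g}))"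
proof -
  let ?Q = "\<lambda>S. tight 1 T S \<and> ends G e \<subseteq> S"
  obtain S0 where "?Q S0" using not_sparse_insertE[OF T e dep] by blast
  then obtain S where S: "?Q S" "\<And>S'. ?Q S' \<Longrightarrow> card S \<le> card S'"
    using ex_has_least_nat[of ?Q S0 card] by blast
  show ?thesis
  proof (rule that[of S])
    fix g assume g: "g \<in> inside T S"
    have T': "sparse 1 (T - {g})" using sparse_subset[OF T] by blast
    show "sparse 1 (insert e (T - {g}))"
    proof (rule sparse_insert[OF T' e])
      fix S' assume S': "tight 1 (T - {g}) S'"
      show "\<not> ends G e \<subseteq> S'"
      proof
        assume eS': "ends G e \<subseteq> S'"
        have t: "tight 1 T S'" by (rule tight_superset[OF S' T]) (auto simp: inside_def)
        have "\<not> ends G g \<subseteq> S'"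
        proof
          assume "ends G g \<subseteq> S'"
          moreover have "insert g (T - {g}) = T" using g inside_subset by blast
          ultimately show False
            using sparse_insert_not_tight[of 1 g "T - {g}" S'] T S' by simp
        qed
        then have less: "S \<inter> S' \<subset> S" using g by (auto simp: inside_def)
        have "S \<inter> S' \<noteq> {}" using S(1) eS' ends_nonempty[OF e] by blast
        then have "?Q (S \<inter> S')" using tight_Int[OF T _ t] S(1) eS' by simp
        then have "card S \<le> card (S \<inter> S')" by (rule S(2))
        then show False using psubset_card_mono[OF _ less] S(1) tight_finite[of 1 T S] by simp
      qed
    qed
  qed (use S in auto)
qed

text \<open>Augmentation as in matroid union. A state consists of \<open>k\<close> forests and one
  leftover edge; a move swaps the leftover edge into a forest. If no reachable leftover edge ever
  fits, then the edges \<open>E0\<close> that can become leftover connect the same vertices in every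
  forest. The class of the ends of \<open>e0\<close> is then tight for \<open>A\<close>, so
  \<open>e0\<close> violates sparsity.\<close>

lemma forest_decomposition_insert:
  assumes T0: "forest_decomposition k A T0" and e0: "e0 \<notin> A" and sp: "sparse k (insert e0 A)"
  shows "\<exists>T. forest_decomposition k (insert e0 A) T"
proof (rule ccontr)
  let ?A = "insert e0 A"
  assume none: "\<not> ?thesis"
  define R where "R = {((T, e), (T', g)) | T e T' g. \<exists>i<k. g \<in> T i \<and>
      T' = T(i := insert e (T i - {g})) \<and> sparse 1 (insert e (T i - {g}))}"
  define reach where "reach T e \<longleftrightarrow> ((T0, e0), (T, e)) \<in> R\<^sup>*" for T :: "nat \<Rightarrow> 'e set" and e
  have AE: "?A \<subseteq> edges G" by (rule sparse_edges[OF sp])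
  have reach_induct: "Q T e" if "reach T e" "Q T0 e0"
    "\<And>T e i g. reach T e \<Longrightarrow> Q T e \<Longrightarrow> i < k \<Longrightarrow> g \<in> T i \<Longrightarrow> sparse 1 (insert e (T i - {g})) \<Longrightarrow>
       reach (T(i := insert e (T i - {g}))) g \<Longrightarrow> Q (T(i := insert e (T i - {g}))) g" for Q T e
    using that(1) unfolding reach_def
  proof (induction rule: rtrancl_induct2)
    case refl
    show ?case by (rule that(2))
  next
    case (step T e T' g)
    from step(2) obtain i where "i < k" "g \<in> T i" "T' = T(i := insert e (T i - {g}))"
      "sparse 1 (insert e (T i - {g}))" by (auto simp: R_def)
    moreover have "((T0, e0), (T', g)) \<in> R\<^sup>*" using step by (meson rtrancl.rtrancl_into_rtrancl)
    ultimately show ?case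
      using that(3)[unfolded reach_def, of T e i g] step(1,3) by blast
  qed
  have reach_step: "reach (T(i := insert e (T i - {g}))) g"
    if "reach T e" "i < k" "g \<in> T i" "sparse 1 (insert e (T i - {g}))" for T e i g
    using that unfolding reach_def R_def by (blast intro: rtrancl.rtrancl_into_rtrancl)
  have dec: "e \<in> ?A \<and> forest_decomposition k (?A - {e}) T" if "reach T e" for T e
    using that
  proof (rule reach_induct)
    have "?A - {e0} = A" using e0 by auto
    then show "e0 \<in> ?A \<and> forest_decomposition k (?A - {e0}) T0" using T0 by simp
  next
    fix T e i g
    assume *: "e \<in> ?A \<and> forest_decomposition k (?A - {e}) T" "i < k" "g \<in> T i"
      "sparse 1 (insert e (T i - {g}))"
    let ?T = "T(i := insert e (T i - {g}))"
    have un: "(\<Union>j<k. T j) = ?A - {e}" and dj: "disjoint_family_on T {..<k}" and e: "e \<in> ?A"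
      using * by (auto simp: forest_decomposition_def)
    have g: "g \<in> ?A" "g \<noteq> e" using un *(2,3) by auto
    have gT: "g \<notin> T j" if "j < k" "j \<noteq> i" for j
      using dj that *(2,3) by (auto simp: disjoint_family_on_def)
    have eT: "e \<notin> T j" if "j < k" for j using un that by auto
    have "(\<Union>j<k. ?T j) = ?A - {g}"
    proof -
      have "(\<Union>j<k. ?T j) = insert e ((\<Union>j<k. T j) - {g})"
        using *(2) gT by (auto split: if_splits)
      then show ?thesis using un e g by auto
    qed
    moreover have "disjoint_family_on ?T {..<k}"
    proof -
      have "?T a \<inter> ?T b = {}" if "a < k" "b < k" "a \<noteq> b" for a b
      proof -
        have "T a \<inter> T b = {}" using dj that by (auto simp: disjoint_family_on_def)
        then show ?thesis using eT[OF that(1)] eT[OF that(2)] that(3) by auto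
      qed
      then show ?thesis by (auto simp: disjoint_family_on_def)
    qed
    ultimately show "g \<in> ?A \<and> forest_decomposition k (?A - {g}) ?T"
      using * g by (simp add: forest_decomposition_def)
  qed
  define E0 where "E0 = {e. \<exists>T. reach T e}"
  have sT: "sparse 1 (T i \<inter> E0)" "sparse 1 (T i)" if "reach T e" "i < k" for T e i
    using dec[OF that(1)] that(2) sparse_subset[of 1 "T i" "T i \<inter> E0"]
    by (auto simp: forest_decomposition_def)
  \<comment> \<open>As \<open>e\<close> fits into no forest, it closes a cycle with
    \<open>T i\<close>; each edge of that cycle can be swapped out against \<open>e\<close> and so
    belongs to \<open>E0\<close>.\<close>
  have J1: "joined (T i \<inter> E0) u v" if T: "reach T e" "i < k" and uv: "ends G e = {u, v}" for T e i u v
  proof -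
    note d = dec[OF T(1)]
    have eA: "e \<in> ?A" "e \<in> edges G" using d AE by auto
    have "\<not> sparse 1 (insert e (T i))"
    proof
      assume "sparse 1 (insert e (T i))"
      moreover have "e \<notin> T j" if "j < k" for j using d that by (auto simp: forest_decomposition_def)
      moreover have "(\<Union>j<k. (T(i := insert e (T i))) j) = insert e (\<Union>j<k. T j)"
        using T(2) by (auto split: if_splits)
      ultimately have "forest_decomposition k ?A (T(i := insert e (T i)))"
        using d T(2) by (simp add: forest_decomposition_def disjoint_family_on_def insert_absorb) 
      then show False using none by blast
    qed
    then obtain S where S: "tight 1 (T i) S" "ends G e \<subseteq> S"
      "\<And>g. g \<in> inside (T i) S \<Longrightarrow> sparse 1 (insert e (T i - {g}))"
      using fundamental_exchange[OF sT(2)[OF T] eA(2)] by blast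
    have "inside (T i) S \<subseteq> T i \<inter> E0"
      using reach_step[OF T] S(3) unfolding E0_def by (auto simp: inside_def)
    then have "tight 1 (T i \<inter> E0) S" using tight_superset[OF S(1) sT(1)[OF T]] by blast
    then show ?thesis using S(2) uv by (auto simp: joined_def)
  qed
  \<comment> \<open>A move trades \<open>g\<close> for \<open>e\<close> in \<open>T i\<close>. By
    \<open>J1\<close> before and after the move, the ends of each are joined by the other set, so
    the classes remain those of \<open>T0\<close>.\<close>
  have J3: "\<forall>i<k. \<forall>u v. joined (T i \<inter> E0) u v \<longleftrightarrow> joined (T0 i \<inter> E0) u v" if "reach T e" for T e
    using that
  proof (rule reach_induct)
    fix T e i g
    assume *: "reach T e" "\<forall>i<k. \<forall>u v. joined (T i \<inter> E0) u v \<longleftrightarrow> joined (T0 i \<inter> E0) u v"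
      "i < k" "g \<in> T i" "sparse 1 (insert e (T i - {g}))" "reach (T(i := insert e (T i - {g}))) g"
    let ?T = "T(i := insert e (T i - {g}))"
    have "joined (?T i \<inter> E0) u v \<longleftrightarrow> joined (T i \<inter> E0) u v" for u v
    proof
      assume "joined (?T i \<inter> E0) u v"
      then show "joined (T i \<inter> E0) u v"
      proof (rule joined_mono[rotated 3, OF _ sT(1)[OF *(6,3)] sT(1)[OF *(1,3)]])
        fix h a b assume h: "h \<in> ?T i \<inter> E0" "ends G h = {a, b}"
        show "joined (T i \<inter> E0) a b"
          using J1[OF *(1,3)] joined_edge[OF sT(1)[OF *(1,3)]] h by auto
      qed
    next
      assume "joined (T i \<inter> E0) u v"
      then show "joined (?T i \<inter> E0) u v"
      proof (rule joined_mono[rotated 3, OF _ sT(1)[OF *(1,3)] sT(1)[OF *(6,3)]])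
        fix h a b assume h: "h \<in> T i \<inter> E0" "ends G h = {a, b}"
        show "joined (?T i \<inter> E0) a b"
          using J1[OF *(6,3)] joined_edge[OF sT(1)[OF *(6,3)], of h] h by (cases "h = g") auto
      qed
    qed
    then show "\<forall>j<k. \<forall>u v. joined (?T j \<inter> E0) u v \<longleftrightarrow> joined (T0 j \<inter> E0) u v"
      using *(2) by (metis fun_upd_apply)
  qed simp
  have r0: "reach T0 e0" by (simp add: reach_def)
  have J4: "joined (T0 i \<inter> E0) u v" if "h \<in> E0" "ends G h = {u, v}" "i < k" for h u v i
    using J1 J3 that unfolding E0_def by blast
  have e0E: "e0 \<in> edges G" using AE by simp
  obtain u0 v0 where uv: "ends G e0 = {u0, v0}" using no_loops[OF e0E] by (auto simp: card_2_iff)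
  have u0: "u0 \<in> verts G" using ends_in_verts[OF e0E] uv by auto
  define W where "W i = {v. joined (T0 i \<inter> E0) u0 v}" for i
  have W: "tight 1 (T0 i) (W i)" if "i < k" for i
    using tight_superset[OF tight_joined_class[OF sT(1)[OF r0 that] u0] sT(2)[OF r0 that]]
    by (auto simp: W_def inside_def)
  \<comment> \<open>Every edge that builds the class for \<open>i\<close> belongs to
    \<open>E0\<close> and hence, by \<open>J4\<close>, has joined ends for \<open>j\<close>.\<close>
  have eq: "W i = W j" if "i < k" "j < k" for i j
  proof -
    have *: "joined (T0 j' \<inter> E0) u0 v" if "i' < k" "j' < k" "joined (T0 i' \<inter> E0) u0 v" for i' j' v
    proof (rule joined_mono[OF sT(1)[OF r0 that(1)] sT(1)[OF r0 that(2)] _ that(3)])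
      fix h a b assume "h \<in> T0 i' \<inter> E0" and ab: "ends G h = {a, b}"
      then have "h \<in> E0" by blast
      then show "joined (T0 j' \<inter> E0) a b" using ab that(2) by (rule J4)
    qed
    show ?thesis unfolding W_def using *[OF that] *[OF that(2,1)] by (intro Collect_cong iffI)
  qed
  have "e0 \<in> inside ?A (ends G e0)" by (auto simp: inside_def)
  then have "card (inside ?A (ends G e0)) > 0" using finite_inside[OF AE] by (auto simp: card_gt_0_iff)
  then have k: "k > 0"
    using sparse_card[OF sp ends_in_verts[OF e0E] ends_nonempty[OF e0E]] by (cases k) auto
  have "e0 \<in> E0" using r0 by (auto simp: E0_def)
  then have j0: "joined (T0 0 \<inter> E0) u0 v0" using J4 uv k by blast
  have v0: "v0 \<in> W 0" using j0 by (simp add: W_def)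
  have u0W: "u0 \<in> W 0"
    using joined_trans[OF sT(1)[OF r0 k] j0 joined_sym[OF j0]] by (simp add: W_def)
  have A: "A = (\<Union>i<k. T0 i)" using T0 by (auto simp: forest_decomposition_def)
  have "card (inside A (W 0)) = (\<Sum>i<k. card (inside (T0 i) (W 0)))"
    unfolding A
  proof (rule card_inside_disjoint_union)
    show "disjoint_family_on T0 {..<k}" using T0 by (simp add: forest_decomposition_def)
    show "T0 i \<subseteq> edges G" if "i \<in> {..<k}" for i
      using sparse_edges[OF sT(2)[OF r0]] that by blast
  qed simp
  also have "\<dots> = (\<Sum>i<k. card (W 0) - 1)"
    by (rule sum.cong) (simp_all add: tight_card[OF W] eq[OF _ k, symmetric])
  finally have "card (inside A (W 0)) = k * (card (W 0) - 1)" by simp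
  then have "tight k A (W 0)" using tight_verts[OF W[OF k]] tight_nonempty[OF W[OF k]] by (simp add: tight_def)
  then show False using sparse_insert_not_tight[OF sp e0, of "W 0"] uv u0W v0 by auto
qed

theorem nash_williams:
  assumes "sparse k A" obtains T where "forest_decomposition k A T"
proof -
  have "finite A" using assms sparse_edges finite_subset_edges by blast
  then have "sparse k A \<longrightarrow> (\<exists>T. forest_decomposition k A T)"
  proof (induction A)
    case empty
    have "sparse 1 {}" by (simp add: sparse_def inside_def)
    then have "forest_decomposition k {} (\<lambda>_. {})"
      by (simp add: forest_decomposition_def disjoint_family_on_def)
    then show ?case by blast
  next
    case (insert e A)
    then show ?case
      using forest_decomposition_insert[of k A] sparse_subset[of k "insert e A" A] by blast
  qed
  then show ?thesis using assms that by blast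
qed

section \<open>Splitting and merging components\<close>

lemma inside_insert: "inside (insert e A) S = (if ends G e \<subseteq> S then insert e (inside A S) else inside A S)"
  by (auto simp: inside_def)

text \<open>\<open>E'\<close> has two tasks: removing it from the tree separates the members of
  \<open>Y\<close>, with \<open>\<kappa>\<close> naming the parts, and read as a graph on the labels
  \<open>\<mu>\<close> it is acyclic, which is the inequality over all \<open>S\<close>. In the
  applications \<open>\<mu>\<close> names the pieces of a cut blue tree, so that \<open>E'\<close>
  can be added to them without closing a cycle.\<close>

lemma tree_split:
  fixes \<mu> :: "'v \<Rightarrow> 'v"
  assumes F: "sparse 1 F" and W: "tight 1 F W" and Y: "Y \<subseteq> W" "Y \<noteq> {}" and inj: "inj_on \<mu> Y"
  obtains E' \<kappa> where "E' \<subseteq> inside F W" "card E' + 1 = card Y"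
    "\<And>S. finite S \<Longrightarrow> S \<noteq> {} \<Longrightarrow> card (inside E' S) + 1 \<le> card (\<mu> ` S)"
    "\<kappa> ` W = Y" "\<And>y. y \<in> Y \<Longrightarrow> \<kappa> y = y"
    "\<And>e a b. e \<in> inside F W - E' \<Longrightarrow> a \<in> ends G e \<Longrightarrow> b \<in> ends G e \<Longrightarrow> \<kappa> a = \<kappa> b"
proof -
  define good where "good W Y \<mu> E' \<kappa> \<longleftrightarrow> E' \<subseteq> inside F W \<and> card E' + 1 = card Y \<and>
    (\<forall>S. finite S \<longrightarrow> S \<noteq> {} \<longrightarrow> card (inside E' S) + 1 \<le> card (\<mu> ` S)) \<and> \<kappa> ` W \<subseteq> Y \<and> (\<forall>y\<in>Y. \<kappa> y = y) \<and>
    (\<forall>e\<in>inside F W - E'. \<forall>a\<in>ends G e. \<forall>b\<in>ends G e. \<kappa> a = \<kappa> b)"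
    for W Y E' and \<mu> \<kappa> :: "'v \<Rightarrow> 'v"
  have goodI: "good W Y \<mu> E' \<kappa>"
    if "E' \<subseteq> inside F W" "card E' + 1 = card Y"
      "\<And>S. finite S \<Longrightarrow> S \<noteq> {} \<Longrightarrow> card (inside E' S) + 1 \<le> card (\<mu> ` S)"
      "\<kappa> ` W \<subseteq> Y" "\<And>y. y \<in> Y \<Longrightarrow> \<kappa> y = y"
      "\<And>h a b. h \<in> inside F W - E' \<Longrightarrow> a \<in> ends G h \<Longrightarrow> b \<in> ends G h \<Longrightarrow> \<kappa> a = \<kappa> b"
    for W Y E' and \<mu> \<kappa> :: "'v \<Rightarrow> 'v"
    unfolding good_def using that by (intro conjI allI impI ballI)
  have goodD: "E' \<subseteq> inside F W" "card E' + 1 = card Y"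
      "\<And>S. finite S \<Longrightarrow> S \<noteq> {} \<Longrightarrow> card (inside E' S) + 1 \<le> card (\<mu> ` S)"
      "\<kappa> ` W \<subseteq> Y" "\<And>y. y \<in> Y \<Longrightarrow> \<kappa> y = y"
      "\<And>h a b. h \<in> inside F W - E' \<Longrightarrow> a \<in> ends G h \<Longrightarrow> b \<in> ends G h \<Longrightarrow> \<kappa> a = \<kappa> b"
    if "good W Y \<mu> E' \<kappa>" for W Y E' and \<mu> \<kappa> :: "'v \<Rightarrow> 'v"
  proof -
    note g = that[unfolded good_def]
    note g1 = g[THEN conjunct2] note g2 = g1[THEN conjunct2] note g3 = g2[THEN conjunct2]
    note g4 = g3[THEN conjunct2]
    note h = g[THEN conjunct1] g1[THEN conjunct1] g2[THEN conjunct1, rule_format] g3[THEN conjunct1]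
      g4[THEN conjunct1, rule_format] g4[THEN conjunct2, rule_format]
    show "E' \<subseteq> inside F W" "card E' + 1 = card Y" "\<kappa> ` W \<subseteq> Y" by (fact h)+
    show "card (inside E' S) + 1 \<le> card (\<mu> ` S)" if "finite S" "S \<noteq> {}" for S using that by (rule h(3))
    show "\<kappa> y = y" if "y \<in> Y" for y using that by (rule h(5))
    show "\<kappa> a = \<kappa> b" if "h \<in> inside F W - E'" "a \<in> ends G h" "b \<in> ends G h" for h a b
      using that by (rule h(6))
  qed
  have card1: "1 \<le> card (\<mu> ` S)" if "finite S" "S \<noteq> {}" for S :: "'v set" and \<mu> :: "'v \<Rightarrow> 'v"
    using that by (simp add: Suc_le_eq card_gt_0_iff)
  obtain r where r: "r \<in> W" using Y by blast
  \<comment> \<open>Both \<open>Y\<close> and \<open>\<mu>\<close> must vary: cutting a leaf edge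
    identifies two labels, and a leaf that is not cut off hands its place in \<open>Y\<close> to its
    neighbour.\<close>
  have "\<forall>Y (\<mu> :: 'v \<Rightarrow> 'v). Y \<subseteq> W \<longrightarrow> Y \<noteq> {} \<longrightarrow> inj_on \<mu> Y \<longrightarrow> (\<exists>E' \<kappa>. good W Y \<mu> E' \<kappa>)"
    using F W r
  proof (induction rule: tree_induct)
    case root
    show ?case
    proof (intro allI impI)
      fix Y and \<mu> :: "'v \<Rightarrow> 'v"
      assume "Y \<subseteq> {r}" "Y \<noteq> {}"
      then have Y: "Y = {r}" by blast
      have ie: "inside {} S = {}" for S by (simp add: inside_def)
      have "good {r} Y \<mu> {} (\<lambda>_. r)"
        using card1 inside_singleton[OF sparse_edges[OF F]] unfolding good_def Y ie by auto
      then show "\<exists>E' \<kappa>. good {r} Y \<mu> E' \<kappa>" by blast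
    qed
  next
    case (leaf W u v e)
    have v: "v \<notin> ends G g" if "g \<in> inside F W" for g using that leaf(4) by (auto simp: inside_def)
    have eW: "e \<notin> inside F W" using v leaf(7) by blast
    have uv: "u \<noteq> v" using leaf by blast
    have fin: "finite (inside F W)" using sparse_edges[OF F] finite_inside by blast
    show ?case
    proof (intro allI impI)
      fix Y and \<mu> :: "'v \<Rightarrow> 'v"
      assume Y: "Y \<subseteq> insert v W" "Y \<noteq> {}" "inj_on \<mu> Y"
      have fY: "finite Y" using Y leaf(1) tight_finite finite_subset by (metis finite_insert)
      consider "v \<notin> Y" | "v \<in> Y" "\<mu> u \<noteq> \<mu> v" "Y = {v}" | "v \<in> Y" "\<mu> u \<noteq> \<mu> v" "Y \<noteq> {v}"
        | "v \<in> Y" "\<mu> u = \<mu> v" by blast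
      then show "\<exists>E' \<kappa>. good (insert v W) Y \<mu> E' \<kappa>"
      proof cases
        case 1
        then have "Y \<subseteq> W" using Y by blast
        with leaf(9) Y obtain E' \<kappa> where "good W Y \<mu> E' \<kappa>" by blast
        note g = goodD[OF this]
        let ?\<kappa> = "\<kappa>(v := \<kappa> u)"
        have E: "E' \<subseteq> insert e (inside F W)" using g(1) by blast
        have im: "?\<kappa> ` insert v W \<subseteq> Y" using g(4) leaf(3) by auto
        have id: "?\<kappa> y = y" if "y \<in> Y" for y using g(5) 1 that by auto
        have resp: "?\<kappa> a = ?\<kappa> b" if "h \<in> insert e (inside F W) - E'" "a \<in> ends G h" "b \<in> ends G h" for h a b
        proof (cases "h = e")
          case True
          then show ?thesis using that leaf(7) by auto
        next
          case False
          then have "h \<in> inside F W - E'" using that by blast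
          moreover from this have "a \<noteq> v" "b \<noteq> v" using v that by auto
          ultimately show ?thesis using g(6)[of h a b] that by simp
        qed
        have "good (insert v W) Y \<mu> E' ?\<kappa>"
          by (rule goodI; (unfold leaf(8))?; fact E g(2) g(3) im id resp)
        then show ?thesis by blast
      next
        case 2
        have ie: "inside {} S = {}" for S by (simp add: inside_def)
        have "good (insert v W) Y \<mu> {} (\<lambda>_. v)"
          unfolding good_def ie
        proof (intro conjI allI impI)
          show "card {} + 1 \<le> card (\<mu> ` S)" if "finite S" "S \<noteq> {}" for S
            using card1[OF that, of \<mu>] by simp
        qed (use 2(3) in auto)
        then show ?thesis by blast
      next
        case 3
        \<comment> \<open>The edge \<open>e\<close> is cut, and \<open>\<nu>\<close> contracts it
          among the labels. Injectivity of \<open>\<mu>\<close> shows that no other member of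
          \<open>Y\<close> is affected.\<close>
        define \<nu> where "\<nu> z = (if \<mu> z = \<mu> v then \<mu> u else \<mu> z)" for z
        have "\<nu> y = \<mu> y" if "y \<in> Y - {v}" for y
          using that Y(3) 3(1) by (auto simp: \<nu>_def inj_on_def)
        then have "inj_on \<nu> (Y - {v})" using Y(3) by (auto simp: inj_on_def)
        moreover have "Y - {v} \<subseteq> W" "Y - {v} \<noteq> {}" using Y 3 by auto
        ultimately obtain E' \<kappa> where "good W (Y - {v}) \<nu> E' \<kappa>" using leaf(9) by blast
        note g = goodD[OF this]
        have eE': "e \<notin> E'" using g(1) eW by blast
        have fE': "finite E'" using g(1) fin finite_subset by blast
        have cY: "card (insert e E') + 1 = card Y"
          using g(2) eE' fE' fY 3(1) by (simp add: card_Suc_Diff1)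
        have cS: "card (inside (insert e E') S) + 1 \<le> card (\<mu> ` S)" if S: "finite S" "S \<noteq> {}" for S
        proof -
          have g': "card (inside E' S) + 1 \<le> card (\<nu> ` S)" using g(3) S by blast
          show ?thesis
          proof (cases "u \<in> S \<and> v \<in> S")
            case True
            \<comment> \<open>The label lost by the contraction pays for the additional edge
              \<open>e\<close>.\<close>
            then have "\<nu> ` S \<subseteq> \<mu> ` S - {\<mu> v}" using 3(2) by (auto simp: \<nu>_def)
            then have "card (\<nu> ` S) \<le> card (\<mu> ` S - {\<mu> v})" using S by (intro card_mono) auto
            moreover have "card (\<mu> ` S - {\<mu> v}) < card (\<mu> ` S)" using S True by (intro card_Diff1_less) auto
            moreover have "card (inside (insert e E') S) \<le> card (inside E' S) + 1"
              unfolding inside_insert by (simp add: card_insert_if fE' inside_def)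
            ultimately show ?thesis using g' by linarith
          next
            case False
            have "\<nu> ` S \<subseteq> (\<lambda>l. if l = \<mu> v then \<mu> u else l) ` \<mu> ` S" by (auto simp: \<nu>_def)
            then have "card (\<nu> ` S) \<le> card (\<mu> ` S)"
              using S by (meson card_image_le card_mono finite_imageI order_trans)
            moreover have "inside (insert e E') S = inside E' S"
              unfolding inside_insert leaf(7) using False by auto
            ultimately show ?thesis using g' by simp
          qed
        qed
        have E: "insert e E' \<subseteq> insert e (inside F W)" using g(1) by blast
        have im: "(\<kappa>(v := v)) ` insert v W \<subseteq> Y" using g(4) 3(1) by auto
        have id: "(\<kappa>(v := v)) y = y" if "y \<in> Y" for y using g(5) that by simp
        have resp: "(\<kappa>(v := v)) a = (\<kappa>(v := v)) b"
          if "h \<in> insert e (inside F W) - insert e E'" "a \<in> ends G h" "b \<in> ends G h" for h a b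
        proof -
          have h: "h \<in> inside F W - E'" using that by blast
          then have "a \<noteq> v" "b \<noteq> v" using v that by auto
          then show ?thesis using g(6)[OF h that(2,3)] by simp
        qed
        have "good (insert v W) Y \<mu> (insert e E') (\<kappa>(v := v))"
          by (rule goodI; (unfold leaf(8))?; fact E cY cS im id resp)
        then show ?thesis by blast
      next
        case 4
        have uY: "u \<notin> Y" using 4 Y(3) uv by (auto simp: inj_on_def)
        \<comment> \<open>On the labels \<open>e\<close> is a loop and may not be chosen. So
          \<open>v\<close> stays attached to \<open>u\<close>, and \<open>u\<close>, which is
          outside \<open>Y\<close> by injectivity, represents it.\<close>
        define Y' where "Y' = insert u (Y - {v})"
        have cY: "card Y' = card Y"
          unfolding Y'_def card_Suc_Diff1[OF fY 4(1), symmetric]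
          by (rule card_insert_disjoint) (use fY uY in auto)
        have "inj_on \<mu> Y'" using Y(3) 4 unfolding Y'_def inj_on_def by auto
        moreover have "Y' \<subseteq> W" "Y' \<noteq> {}" using Y leaf(3) by (auto simp: Y'_def)
        ultimately obtain E' \<kappa> where "good W Y' \<mu> E' \<kappa>" using leaf(9) by blast
        note g = goodD[OF this]
        \<comment> \<open>The part that the smaller tree calls \<open>u\<close> now contains
          \<open>v\<close> and takes its name.\<close>
        define \<kappa>' where "\<kappa>' z = (if z = v \<or> \<kappa> z = u then v else \<kappa> z)" for z
        have im: "\<kappa>' ` insert v W \<subseteq> Y" using g(4) 4(1) by (auto simp: \<kappa>'_def Y'_def)
        have id: "\<kappa>' y = y" if "y \<in> Y" for y
        proof (cases "y = v")
          case False
          then have "\<kappa> y = y" "y \<noteq> u" using g(5)[of y] uY that by (auto simp: Y'_def)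
          then show ?thesis by (simp add: \<kappa>'_def)
        qed (simp add: \<kappa>'_def)
        have \<kappa>u: "\<kappa> u = u" by (rule g(5)) (simp add: Y'_def)
        have resp: "\<kappa>' a = \<kappa>' b"
          if "h \<in> insert e (inside F W) - E'" "a \<in> ends G h" "b \<in> ends G h" for h a b
        proof (cases "h = e")
          case True
          then show ?thesis using that leaf(7) \<kappa>u by (auto simp: \<kappa>'_def)
        next
          case False
          then have h: "h \<in> inside F W - E'" using that by blast
          then have "a \<noteq> v" "b \<noteq> v" using v that by auto
          then show ?thesis using g(6)[OF h that(2,3)] by (simp add: \<kappa>'_def)
        qed
        have E: "E' \<subseteq> insert e (inside F W)" using g(1) by blast
        have cE: "card E' + 1 = card Y" using g(2) cY by simp
        have "good (insert v W) Y \<mu> E' \<kappa>'"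
          by (rule goodI; (unfold leaf(8))?; fact E cE g(3) im id resp)
        then show ?thesis by blast
      qed
    qed
  qed
  then obtain E' \<kappa> where "good W Y \<mu> E' \<kappa>" using Y inj by blast
  note g = goodD[OF this]
  have "y \<in> \<kappa> ` W" if "y \<in> Y" for y using g(5)[OF that] Y(1) that by (metis image_eqI subsetD)
  then have im: "\<kappa> ` W = Y" using g(4) by blast
  show ?thesis by (rule that[of E' \<kappa>]; fact g(1) g(2) g(3) im g(5) g(6))
qed

lemma edge_split:
  assumes F: "sparse 1 F" and W: "tight 1 F W" and e: "e \<in> inside F W"
  obtains M where "M \<subseteq> W" "M \<noteq> {}" "W - M \<noteq> {}"
    "\<And>g. g \<in> inside F W - {e} \<Longrightarrow> ends G g \<subseteq> M \<or> ends G g \<subseteq> W - M"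
proof -
  define good where "good W e M \<longleftrightarrow> M \<subseteq> W \<and> M \<noteq> {} \<and> W - M \<noteq> {} \<and>
    (\<forall>g\<in>inside F W - {e}. ends G g \<subseteq> M \<or> ends G g \<subseteq> W - M)" for W e M
  obtain r where r: "r \<in> W" using tight_nonempty[OF W] by blast
  have "\<forall>e\<in>inside F W. \<exists>M. good W e M"
    using F W r
  proof (induction rule: tree_induct)
    case root
    then show ?case using inside_singleton[OF sparse_edges[OF F]] by simp
  next
    case (leaf W u v e)
    show ?case
    proof
      fix f assume f: "f \<in> inside F (insert v W)"
      have sub: "ends G g \<subseteq> W" if "g \<in> inside F W" for g using that by (auto simp: inside_def)
      show "\<exists>M. good (insert v W) f M"
      proof (cases "f = e")
        case True
        have "good (insert v W) e {v}" unfolding good_def leaf(8) using sub leaf(3,4) by auto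
        then show ?thesis using True by blast
      next
        case False
        then have "f \<in> inside F W" using f leaf(8) by blast
        then obtain M where M: "good W f M" using leaf(9) by blast
        show ?thesis
        proof (cases "u \<in> M")
          case True
          have "good (insert v W) f (insert v M)" unfolding good_def leaf(8) using M[unfolded good_def] True leaf(3,4,7) by fastforce
          then show ?thesis by blast
        next
          case uM: False
          have "good (insert v W) f M" unfolding good_def leaf(8) using M[unfolded good_def] uM leaf(3,4,7) by fastforce
          then show ?thesis by blast
        qed
      qed
    qed
  qed
  with e obtain M where "good W e M" by blast
  then show ?thesis unfolding good_def by (intro that[of M]) blast+
qed

text \<open>No edge joins different labels, and the vertices of one label span at least one edge
  fewer than there are vertices; summing counts the labels. Equality in the sum forces it for every
  label, so each class is a tree.\<close>

lemma
  assumes A: "sparse 1 A" and W: "W \<subseteq> verts G"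
    and resp: "\<And>e a b. e \<in> inside A W \<Longrightarrow> a \<in> ends G e \<Longrightarrow> b \<in> ends G e \<Longrightarrow> \<kappa> a = \<kappa> b"
  shows card_labels: "card (inside A W) + card (\<kappa> ` W) \<le> card W"
    and tight_labels: "card (inside A W) + card (\<kappa> ` W) = card W \<Longrightarrow> y \<in> \<kappa> ` W \<Longrightarrow> tight 1 A {z \<in> W. \<kappa> z = y}"
proof -
  let ?c = "\<lambda>y. {z \<in> W. \<kappa> z = y}"
  have fW: "finite W" using W by (rule finite_subset_verts)
  have ne: "ends G e \<noteq> {}" if "e \<in> A" for e using that sparse_edges[OF A] ends_nonempty by blast
  have "inside A W = (\<Union>y\<in>\<kappa> ` W. inside A (?c y))"
  proof
    show "inside A W \<subseteq> (\<Union>y\<in>\<kappa> ` W. inside A (?c y))"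
    proof
      fix e assume e: "e \<in> inside A W"
      then obtain a where a: "a \<in> ends G e" using ne inside_subset by blast
      have "ends G e \<subseteq> W" using e by (auto simp: inside_def)
      then have "ends G e \<subseteq> ?c (\<kappa> a)" "a \<in> W" using resp[OF e _ a] a by blast+
      then show "e \<in> (\<Union>y\<in>\<kappa> ` W. inside A (?c y))" using e by (auto simp: inside_def)
    qed
  qed (auto simp: inside_def)
  moreover have "card (\<Union>y\<in>\<kappa> ` W. inside A (?c y)) = (\<Sum>y\<in>\<kappa> ` W. card (inside A (?c y)))"
  proof (rule card_UN_disjoint)
    show "\<forall>i\<in>\<kappa> ` W. finite (inside A (?c i))" using finite_inside[OF sparse_edges[OF A]] by blast
    show "\<forall>i\<in>\<kappa> ` W. \<forall>j\<in>\<kappa> ` W. i \<noteq> j \<longrightarrow> inside A (?c i) \<inter> inside A (?c j) = {}"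
      using ne by (fastforce simp: inside_def)
  qed (use fW in simp)
  moreover have "card W = (\<Sum>y\<in>\<kappa> ` W. card (?c y))"
  proof -
    have "W = (\<Union>y\<in>\<kappa> ` W. ?c y)" by auto
    moreover have "card (\<Union>y\<in>\<kappa> ` W. ?c y) = (\<Sum>y\<in>\<kappa> ` W. card (?c y))"
      by (rule card_UN_disjoint) (use fW in auto)
    ultimately show ?thesis by simp
  qed
  moreover have "(\<Sum>y\<in>\<kappa> ` W. card (inside A (?c y)) + 1) = (\<Sum>y\<in>\<kappa> ` W. card (inside A (?c y))) + card (\<kappa> ` W)"
    by (subst sum.distrib) simp
  ultimately have cA: "card (inside A W) + card (\<kappa> ` W) = (\<Sum>y\<in>\<kappa> ` W. card (inside A (?c y)) + 1)"
    and cW: "card W = (\<Sum>y\<in>\<kappa> ` W. card (?c y))" by simp_all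
  have le: "card (inside A (?c y)) + 1 \<le> card (?c y)" if "y \<in> \<kappa> ` W" for y
  proof -
    have *: "?c y \<subseteq> verts G" "?c y \<noteq> {}" using W that by auto
    have "card (?c y) > 0" using *(2) finite_subset_verts[OF *(1)] by (simp only: card_gt_0_iff simp_thms)
    then show ?thesis using sparse_card[OF A *] by linarith
  qed
  show "card (inside A W) + card (\<kappa> ` W) \<le> card W" unfolding cA cW by (rule sum_mono) (rule le)
  assume "card (inside A W) + card (\<kappa> ` W) = card W" and y: "y \<in> \<kappa> ` W"
  then have "(\<Sum>y\<in>\<kappa> ` W. card (inside A (?c y)) + 1) = (\<Sum>y\<in>\<kappa> ` W. card (?c y))"
    unfolding cA[symmetric] cW[symmetric] by simp
  then have "card (inside A (?c y)) + 1 = card (?c y)"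
    by (rule sum_mono_inv) (rule le, assumption, rule y, simp add: fW)
  moreover have "?c y \<subseteq> verts G" "?c y \<noteq> {}" using W y by auto
  ultimately show "tight 1 A (?c y)" by (simp add: tight_def)
qed

text \<open>The blocks of \<open>P\<close> are the vertex sets of the components of the forest \<open>F\<close>.\<close>

definition fpart :: "'e set \<Rightarrow> 'v set set \<Rightarrow> bool" where
  "fpart F P \<longleftrightarrow> sparse 1 F \<and> partition_on (verts G) P \<and> (\<forall>W\<in>P. tight 1 F W) \<and>
     (\<forall>e\<in>F. \<exists>W\<in>P. ends G e \<subseteq> W)"

lemma fpart_sparse: "fpart F P \<Longrightarrow> sparse 1 F"
  and fpart_partition: "fpart F P \<Longrightarrow> partition_on (verts G) P"
  and fpart_tight: "fpart F P \<Longrightarrow> W \<in> P \<Longrightarrow> tight 1 F W"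
  and fpart_edge: "fpart F P \<Longrightarrow> e \<in> F \<Longrightarrow> \<exists>W\<in>P. ends G e \<subseteq> W"
  by (auto simp: fpart_def)

lemma fpart_finite: "fpart F P \<Longrightarrow> finite P"
  using finite_elements[OF finite_verts] fpart_partition by blast

lemma fpart_disjoint: "fpart F P \<Longrightarrow> W \<in> P \<Longrightarrow> W' \<in> P \<Longrightarrow> W \<noteq> W' \<Longrightarrow> W \<inter> W' = {}"
  using fpart_partition by (auto simp: partition_on_def disjoint_def)

lemma fpart_cover: "fpart F P \<Longrightarrow> v \<in> verts G \<Longrightarrow> \<exists>W\<in>P. v \<in> W"
  by (metis UnionE fpart_partition partition_onD1)

lemma tight_in_block:
  assumes P: "fpart F P" and S: "tight 1 F S" and W: "W \<in> P" "S \<inter> W \<noteq> {}"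
  shows "S \<subseteq> W"
proof -
  obtain r where r: "r \<in> S" "r \<in> W" using W by blast
  show ?thesis
    using fpart_sparse[OF P] S r(1)
  proof (induction rule: tree_induct)
    case root
    show ?case using r by simp
  next
    case (leaf S u v e)
    obtain W' where "W' \<in> P" "{u, v} \<subseteq> W'" using fpart_edge[OF P leaf(6)] leaf(7) by auto
    then have "v \<in> W" using fpart_disjoint[OF P _ W(1)] leaf by blast
    then show ?case using leaf by blast
  qed
qed

section \<open>Merging and cutting components\<close>

lemma fpart_merge:
  assumes P: "fpart F P" and W: "W1 \<in> P" "W2 \<in> P" "W1 \<noteq> W2"
    and f: "f \<in> edges G" "ends G f = {x, y}" "x \<in> W1" "y \<in> W2"
  shows "fpart (insert f F) (insert (W1 \<union> W2) (P - {W1, W2}))"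
proof -
  let ?F = "insert f F"
  have F: "sparse 1 F" by (rule fpart_sparse[OF P])
  have dj: "W1 \<inter> W2 = {}" by (rule fpart_disjoint[OF P W])
  have s: "sparse 1 ?F"
  proof (rule sparse_insert[OF F f(1)])
    fix S assume S: "tight 1 F S"
    show "\<not> ends G f \<subseteq> S" using tight_in_block[OF P S W(1)] f dj by auto
  qed
  have fF: "f \<notin> F"
  proof
    assume "f \<in> F"
    from fpart_edge[OF P this] obtain W where "W \<in> P" "{x, y} \<subseteq> W" unfolding f(2) by blast
    then show False using fpart_disjoint[OF P] W f dj by blast
  qed
  have t: "tight 1 ?F W" if "W \<in> P" for W
    by (rule tight_superset[OF fpart_tight[OF P that] s]) (auto simp: inside_def)
  have "tight 1 ?F (W1 \<union> W2)"
  proof (rule tightI[OF s])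
    note t1 = fpart_tight[OF P W(1)] and t2 = fpart_tight[OF P W(2)]
    show "W1 \<union> W2 \<subseteq> verts G" "W1 \<union> W2 \<noteq> {}" using tight_verts t1 t2 f by blast+
    have fin: "finite (inside F S)" for S by (rule finite_inside[OF sparse_edges[OF F]])
    have "inside F W1 \<inter> inside F W2 = {}"
      using dj ends_nonempty sparse_edges[OF F] by (fastforce simp: inside_def)
    then have "card (insert f (inside F W1 \<union> inside F W2)) = card W1 - 1 + (card W2 - 1) + 1"
      using fin fF tight_card[OF t1] tight_card[OF t2]
      by (subst card_insert_disjoint) (auto simp: card_Un_disjoint inside_def)
    moreover have "insert f (inside F W1 \<union> inside F W2) \<subseteq> inside ?F (W1 \<union> W2)"
      using f by (auto simp: inside_def)
    then have "card (insert f (inside F W1 \<union> inside F W2)) \<le> card (inside ?F (W1 \<union> W2))"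
      by (rule card_mono[OF finite_inside[OF sparse_edges[OF s]]])
    moreover have "card (W1 \<union> W2) = card W1 + card W2"
      using dj tight_finite[OF t1] tight_finite[OF t2] by (rule card_Un_disjoint[rotated 2])
    ultimately show "1 * (card (W1 \<union> W2) - 1) \<le> card (inside ?F (W1 \<union> W2))"
      using tight_card_pos[OF t1] tight_card_pos[OF t2] by simp
  qed
  moreover have "partition_on (verts G) (insert (W1 \<union> W2) (P - {W1, W2}))"
  proof (rule partition_onI)
    have "\<Union>P = verts G" using fpart_partition[OF P] by (simp add: partition_on_def)
    then show "\<Union>(insert (W1 \<union> W2) (P - {W1, W2})) = verts G" using W by blast
    show "{} \<notin> insert (W1 \<union> W2) (P - {W1, W2})"
      using fpart_tight[OF P] tight_nonempty f(3) by blast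
    show "disjnt p q" if "p \<in> insert (W1 \<union> W2) (P - {W1, W2})"
      "q \<in> insert (W1 \<union> W2) (P - {W1, W2})" "p \<noteq> q" for p q
      using that fpart_disjoint[OF P] W unfolding disjnt_def by blast
  qed
  moreover have "\<exists>W\<in>insert (W1 \<union> W2) (P - {W1, W2}). ends G e \<subseteq> W" if e: "e \<in> ?F" for e
  proof (cases "e = f")
    case False
    then obtain W where "W \<in> P" "ends G e \<subseteq> W" using e fpart_edge[OF P] by blast
    then show ?thesis by (cases "W = W1 \<or> W = W2") auto
  qed (use f in auto)
  ultimately show ?thesis using s t by (simp add: fpart_def)
qed

lemma fpart_exists: assumes "sparse 1 F" shows "\<exists>P. fpart F P"
proof -
  have "finite F" using assms sparse_edges finite_subset_edges by blast
  then have "sparse 1 F \<longrightarrow> (\<exists>P. fpart F P)"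
  proof (induction F)
    case empty
    have "sparse 1 {}" by (simp add: sparse_def inside_def)
    moreover have "partition_on (verts G) ((\<lambda>v. {v}) ` verts G)"
      by (rule partition_onI) (auto simp: disjnt_def)
    ultimately have "fpart {} ((\<lambda>v. {v}) ` verts G)"
      using tight_singleton[of "{}"] by (auto simp: fpart_def)
    then show ?case by blast
  next
    case (insert f F)
    show ?case
    proof
      assume s: "sparse 1 (insert f F)"
      then obtain P where P: "fpart F P" using insert sparse_subset by blast
      have f: "f \<in> edges G" using sparse_edges[OF s] by blast
      then obtain x y where xy: "ends G f = {x, y}" using no_loops by (metis card_2_iff)
      then obtain W1 W2 where W: "W1 \<in> P" "x \<in> W1" "W2 \<in> P" "y \<in> W2"
        using fpart_cover[OF P] ends_in_verts[OF f] by (metis insert_subset)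
      have "W1 \<noteq> W2"
        using sparse_insert_not_tight[OF s insert(2), of W1] fpart_tight[OF P W(1)] W xy by auto
      then show "\<exists>P. fpart (insert f F) P" using fpart_merge[OF P W(1,3) _ f xy W(2,4)] by blast
    qed
  qed
  then show ?thesis using assms by blast
qed

text \<open>The merged pairs of blocks form a matching, so one merge leaves the blocks of the others
  untouched.\<close>

lemma fpart_merges:
  assumes P: "fpart F P" and "finite X"
    and Wf: "\<And>x. x \<in> X \<Longrightarrow> Wf x \<in> P" "inj_on Wf X"
    and Cf: "\<And>x. x \<in> X \<Longrightarrow> Cf x \<in> P" "inj_on Cf X" and dj: "Wf ` X \<inter> Cf ` X = {}"
    and f: "\<And>x. x \<in> X \<Longrightarrow> f x \<in> edges G \<and> (\<exists>a\<in>Wf x. \<exists>b\<in>Cf x. ends G (f x) = {a, b})"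
  shows "fpart (F \<union> f ` X) (P - Wf ` X - Cf ` X \<union> (\<lambda>x. Wf x \<union> Cf x) ` X)"
  using assms(2-)
proof (induction X)
  case empty
  then show ?case using P by simp
next
  case (insert x X)
  let ?P = "P - Wf ` X - Cf ` X \<union> (\<lambda>x. Wf x \<union> Cf x) ` X"
  have IH: "fpart (F \<union> f ` X) ?P" by (rule insert.IH) (use insert.prems in auto)
  obtain a b where ab: "a \<in> Wf x" "b \<in> Cf x" "ends G (f x) = {a, b}" using insert.prems(6)[of x] by auto
  have notin: "Wf x \<notin> Wf ` X" "Cf x \<notin> Cf ` X" "Wf x \<notin> Cf ` X" "Cf x \<notin> Wf ` X" "Wf x \<noteq> Cf x"
    using insert.prems insert.hyps by (auto simp: inj_on_def)
  have blk: "Wf x \<in> P" "Cf x \<in> P" using insert.prems by auto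
  have no: "Wf z \<union> Cf z \<noteq> W" if "W \<in> {Wf x, Cf x}" "z \<in> X" for z W
  proof
    assume eq: "Wf z \<union> Cf z = W"
    have z: "Wf z \<in> P" using insert.prems that by auto
    moreover have "Wf z \<noteq> {}" using z fpart_tight[OF P] tight_nonempty by blast
    ultimately have "Wf z = W" using fpart_disjoint[OF P z] eq that blk by blast
    then show False using notin that by auto
  qed
  have "fpart (insert (f x) (F \<union> f ` X)) (insert (Wf x \<union> Cf x) (?P - {Wf x, Cf x}))"
    by (rule fpart_merge[OF IH]) (use blk notin ab insert.prems in auto)
  moreover have "insert (Wf x \<union> Cf x) (?P - {Wf x, Cf x}) =
      P - Wf ` insert x X - Cf ` insert x X \<union> (\<lambda>x. Wf x \<union> Cf x) ` insert x X"
    using no by auto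
  ultimately show ?case by simp
qed

text \<open>Deleting \<open>card E'\<close> edges of a tree leaves \<open>card E' + 1\<close>
  components; as there are as many labels, the label classes are these components, by
  \<open>tight_labels\<close>.\<close>

lemma fpart_refine:
  assumes P: "fpart F P" and K: "K \<in> P" and E': "E' \<subseteq> inside F K"
    and resp: "\<And>e a b. e \<in> inside F K - E' \<Longrightarrow> a \<in> ends G e \<Longrightarrow> b \<in> ends G e \<Longrightarrow> \<kappa> a = \<kappa> b"
    and card: "card E' + 1 = card (\<kappa> ` K)"
  shows "fpart (F - E') (P - {K} \<union> (\<lambda>y. {z \<in> K. \<kappa> z = y}) ` \<kappa> ` K)"
proof -
  let ?c = "\<lambda>y. {z \<in> K. \<kappa> z = y}" let ?P = "P - {K} \<union> ?c ` \<kappa> ` K"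
  have F: "sparse 1 F" by (rule fpart_sparse[OF P])
  have s: "sparse 1 (F - E')" using sparse_subset[OF F] by blast
  have tK: "tight 1 F K" by (rule fpart_tight[OF P K])
  have fin: "finite (inside F K)" by (rule finite_inside[OF sparse_edges[OF F]])
  have ins: "inside (F - E') K = inside F K - E'" by (auto simp: inside_def)
  have cK: "card (inside (F - E') K) + card (\<kappa> ` K) = card K"
    unfolding ins using card card_mono[OF fin E'] tight_card[OF tK] tight_card_pos[OF tK]
    by (simp add: card_Diff_subset[OF finite_subset[OF E' fin] E'])
  have c: "tight 1 (F - E') (?c y)" if "y \<in> \<kappa> ` K" for y
    by (rule tight_labels[OF s tight_verts[OF tK] _ cK that], rule resp) (simp_all add: ins)
  have ne: "ends G e \<noteq> {}" if "e \<in> F" for e using that sparse_edges[OF F] ends_nonempty by blast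
  have "tight 1 (F - E') W" if W: "W \<in> P - {K}" for W
  proof (rule tight_superset[OF fpart_tight[OF P] s])
    have "W \<inter> K = {}" using fpart_disjoint[OF P _ K] W by blast
    then show "inside F W \<subseteq> F - E'" using E' ne by (fastforce simp: inside_def)
  qed (use W in blast)
  moreover have "partition_on (verts G) ?P"
  proof (rule partition_onI)
    have "\<Union>P = verts G" using fpart_partition[OF P] by (simp add: partition_on_def)
    moreover have "\<Union>(?c ` \<kappa> ` K) = K" by auto
    then have "\<Union>?P = \<Union>(P - {K}) \<union> K" by (simp only: Union_Un_distrib)
    moreover have "\<Union>P = K \<union> \<Union>(P - {K})" using K by (metis insert_Diff Union_insert)
    ultimately show "\<Union>?P = verts G" by (simp only: Un_commute)
    have old: "p \<inter> K = {}" if "p \<in> P - {K}" for p using that fpart_disjoint[OF P _ K] by blast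
    show "{} \<notin> ?P" using fpart_tight[OF P] tight_nonempty by blast
    show "disjnt p q" if "p \<in> ?P" "q \<in> ?P" "p \<noteq> q" for p q
      using that(1,2)
    proof (elim UnE imageE)
      assume "p \<in> P - {K}" "q \<in> P - {K}"
      then show ?thesis using fpart_disjoint[OF P] that(3) unfolding disjnt_def by blast
    next
      fix y' y assume "p \<in> P - {K}" "q = ?c y"
      then show ?thesis using old[of p] unfolding disjnt_def by blast
    next
      fix y' y assume "p = ?c y" "q \<in> P - {K}"
      then show ?thesis using old[of q] unfolding disjnt_def by blast
    next
      fix y y' assume "p = ?c y" "q = ?c y'"
      then show ?thesis using that(3) unfolding disjnt_def by auto
    qed
  qed
  moreover have "\<exists>W\<in>?P. ends G e \<subseteq> W" if e: "e \<in> F - E'" for e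
  proof -
    obtain W where W: "W \<in> P" "ends G e \<subseteq> W" using e fpart_edge[OF P] by blast
    show ?thesis
    proof (cases "W = K")
      case True
      obtain a where a: "a \<in> ends G e" using ne e by blast
      have "e \<in> inside F K - E'" using e W True by (auto simp: inside_def)
      then have "ends G e \<subseteq> ?c (\<kappa> a)" using resp a W True by blast
      then show ?thesis using a W True by blast
    qed (use W in blast)
  qed
  ultimately show ?thesis using s c by (auto simp: fpart_def)
qed

section \<open>Minimal configurations\<close>

text \<open>Truncated subtraction is intended: components with at most \<open>d\<close> edges count
  0.\<close>

definition excess :: "nat \<Rightarrow> 'v set set \<Rightarrow> nat" where
  "excess d P = (\<Sum>W\<in>P. card W - 1 - d)"

text \<open>The red side of an exchange: \<open>K\<close> falls into the classes of
  \<open>\<kappa>\<close>, and the class of each \<open>x \<in> X\<close> absorbs the component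
  \<open>Cf x\<close> through the new edge \<open>f x\<close>. The balance of excesses is written
  with sums on both sides, so that no truncated difference of excesses occurs.\<close>

lemma exchange_partition:
  assumes P: "fpart F P" and K: "K \<in> P" and E': "E' \<subseteq> inside F K"
    and resp: "\<And>e a b. e \<in> inside F K - E' \<Longrightarrow> a \<in> ends G e \<Longrightarrow> b \<in> ends G e \<Longrightarrow> \<kappa> a = \<kappa> b"
    and card: "card E' + 1 = card Y" and Y: "\<kappa> ` K = Y" and X: "X \<subseteq> Y"
    and Cf: "\<And>x. x \<in> X \<Longrightarrow> Cf x \<in> P - {K}" "inj_on Cf X"
    and f: "\<And>x. x \<in> X \<Longrightarrow> f x \<in> edges G \<and> (\<exists>a\<in>{z \<in> K. \<kappa> z = x}. \<exists>b\<in>Cf x. ends G (f x) = {a, b})"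
  obtains P1 where "fpart (F - E' \<union> f ` X) P1"
    "\<And>W. W \<in> P \<Longrightarrow> W \<noteq> K \<Longrightarrow> W \<notin> Cf ` X \<Longrightarrow> W \<in> P1"
    "\<And>y. y \<in> Y - X \<Longrightarrow> {z \<in> K. \<kappa> z = y} \<in> P1"
    "excess d P1 + (card K - 1 - d) + (\<Sum>x\<in>X. card (Cf x) - 1 - d) =
     excess d P + (\<Sum>y\<in>Y. card {z \<in> K. \<kappa> z = y} + (if y \<in> X then card (Cf y) else 0) - 1 - d)"
proof -
  let ?c = "\<lambda>y. {z \<in> K. \<kappa> z = y}"
  define D where "D y = ?c y \<union> (if y \<in> X then Cf y else {})" for y
  have fK: "finite K" using fpart_tight[OF P K] by (rule tight_finite)
  have fY: "finite Y" using Y fK by blast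
  have fX: "finite X" using X fY finite_subset by blast
  have cne: "?c y \<noteq> {}" if "y \<in> Y" for y using that Y by blast
  have CK: "Cf x \<inter> K = {}" if "x \<in> X" for x using Cf(1)[OF that] fpart_disjoint[OF P _ K] by blast
  have cP: "?c y \<notin> P - {K}" if "y \<in> Y" for y
    using fpart_disjoint[OF P _ K, of "?c y"] cne[OF that] by blast
  have inj_c: "inj_on ?c Y"
  proof (rule inj_onI)
    fix y y' assume "y \<in> Y" "?c y = ?c y'"
    then show "y = y'" using cne[of y] by blast
  qed
  have P0: "fpart (F - E') (P - {K} \<union> ?c ` Y)"
    unfolding Y[symmetric]
  proof (rule fpart_refine[OF P K E'])
    show "\<kappa> a = \<kappa> b" if "e \<in> inside F K - E'" "a \<in> ends G e" "b \<in> ends G e" for e a b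
      using that by (rule resp)
    show "card E' + 1 = card (\<kappa> ` K)" using card by (simp only: Y)
  qed
  let ?P0 = "P - {K} \<union> ?c ` Y"
  have cC: "?c y \<noteq> Cf x" if "y \<in> Y" "x \<in> X" for x y using CK[OF that(2)] cne[OF that(1)] by blast
  have dj: "?c ` X \<inter> Cf ` X = {}" using cC X by blast
  have P1: "fpart (F - E' \<union> f ` X) (?P0 - ?c ` X - Cf ` X \<union> (\<lambda>x. ?c x \<union> Cf x) ` X)"
  proof (rule fpart_merges[OF P0 fX])
    show "inj_on ?c X" using inj_c X inj_on_subset by blast
    show "?c x \<in> ?P0" "Cf x \<in> ?P0" if "x \<in> X" for x using that X Cf(1) by blast+
  qed (fact Cf(2) dj f)+
  have e1: "(\<lambda>x. ?c x \<union> Cf x) ` X = D ` X" by (rule image_cong) (auto simp: D_def)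
  have e2: "?c ` (Y - X) = D ` (Y - X)" by (rule image_cong) (auto simp: D_def)
  have e3: "?c ` Y - ?c ` X = ?c ` (Y - X)" using inj_on_image_set_diff[OF inj_c, of Y X] X by simp
  have e4: "?c ` (Y - X) \<inter> Cf ` X = {}" using cC by blast
  have e5: "(P - {K}) \<inter> ?c ` X = {}" using cP X by blast
  have "?P0 - ?c ` X - Cf ` X \<union> (\<lambda>x. ?c x \<union> Cf x) ` X = (P - {K} - Cf ` X) \<union> D ` Y"
  proof -
    have "?P0 - ?c ` X - Cf ` X = (P - {K} - Cf ` X) \<union> D ` (Y - X)"
    proof -
      have "?P0 - ?c ` X - Cf ` X = (P - {K} - ?c ` X - Cf ` X) \<union> (?c ` Y - ?c ` X - Cf ` X)"
        by (simp only: Un_Diff)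
      also have "P - {K} - ?c ` X = P - {K}" using e5 by (simp only: Diff_triv)
      also have "?c ` Y - ?c ` X - Cf ` X = D ` (Y - X)" using e4 by (simp only: e3 Diff_triv e2)
      finally show ?thesis .
    qed
    moreover have "D ` (Y - X) \<union> D ` X = D ` Y" using X by blast
    ultimately show ?thesis unfolding e1 by (simp only: Un_assoc)
  qed
  note P1 = P1[unfolded this]
  let ?R = "P - {K} - Cf ` X"
  have fP: "finite P" by (rule fpart_finite[OF P])
  have DK: "D y \<inter> K = ?c y" if "y \<in> Y" for y using CK[of y] by (auto simp: D_def)
  have inj_D: "inj_on D Y"
  proof (rule inj_onI)
    fix y y' assume "y \<in> Y" "y' \<in> Y" "D y = D y'"
    then have "?c y = ?c y'" using DK by metis
    then show "y = y'" using inj_c \<open>y \<in> Y\<close> \<open>y' \<in> Y\<close> by (metis (no_types, lifting) inj_onD)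
  qed
  have RD: "?R \<inter> D ` Y = {}"
  proof -
    have "D y \<notin> P - {K}" if "y \<in> Y" for y
      using fpart_disjoint[OF P _ K, of "D y"] DK[OF that] cne[OF that] by blast
    then show ?thesis by blast
  qed
  have cD: "card (D y) = card (?c y) + (if y \<in> X then card (Cf y) else 0)" if "y \<in> Y" for y
  proof (cases "y \<in> X")
    case True
    have "finite (Cf y)" using Cf(1)[OF True] fpart_tight[OF P] tight_finite by blast
    then have "card (?c y \<union> Cf y) = card (?c y) + card (Cf y)"
      using CK[OF True] fK by (intro card_Un_disjoint) auto
    then show ?thesis using True by (simp only: D_def if_True)
  qed (simp add: D_def)
  have "excess d (?R \<union> D ` Y) = (\<Sum>W\<in>?R. card W - 1 - d) + (\<Sum>W\<in>D ` Y. card W - 1 - d)"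
    unfolding excess_def by (rule sum.union_disjoint) (use fP fY RD in auto)
  moreover have "(\<Sum>W\<in>D ` Y. card W - 1 - d) = (\<Sum>y\<in>Y. card (?c y) + (if y \<in> X then card (Cf y) else 0) - 1 - d)"
    unfolding sum.reindex[OF inj_D] o_def by (rule sum.cong) (simp_all only: cD)
  moreover have "excess d P = (\<Sum>W\<in>?R. card W - 1 - d) + (card K - 1 - d) + (\<Sum>x\<in>X. card (Cf x) - 1 - d)"
  proof -
    have "P = insert K (?R \<union> Cf ` X)" using K Cf by blast
    moreover have "K \<notin> ?R \<union> Cf ` X" using Cf(1) by blast
    ultimately have "excess d P = (card K - 1 - d) + (\<Sum>W\<in>?R \<union> Cf ` X. card W - 1 - d)"
      unfolding excess_def using fP fX by (metis (no_types, lifting) finite_insert sum.insert)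
    also have "(\<Sum>W\<in>?R \<union> Cf ` X. card W - 1 - d) = (\<Sum>W\<in>?R. card W - 1 - d) + (\<Sum>W\<in>Cf ` X. card W - 1 - d)"
      by (rule sum.union_disjoint) (use fP fX in auto)
    finally show ?thesis unfolding sum.reindex[OF Cf(2)] o_def by linarith
  qed
  ultimately have ex: "excess d (?R \<union> D ` Y) + (card K - 1 - d) + (\<Sum>x\<in>X. card (Cf x) - 1 - d) =
     excess d P + (\<Sum>y\<in>Y. card (?c y) + (if y \<in> X then card (Cf y) else 0) - 1 - d)" by linarith
  show ?thesis
  proof (rule that[OF P1 _ _ ex])
    fix y assume "y \<in> Y - X"
    then have "?c y \<in> D ` (Y - X)" unfolding e2[symmetric] by (rule imageI)
    then show "?c y \<in> ?R \<union> D ` Y" by blast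
  qed blast
qed

text \<open>Cutting an edge loses that edge and gives the second half an allowance of its own, so
  positive excess of \<open>K\<close> strictly falls. The vertex \<open>w\<close> selects the half
  that will take the place of \<open>K\<close> in an exploration.\<close>

lemma split_partition:
  assumes P: "fpart F P" and K: "K \<in> P" and e: "e \<in> inside F K" and w: "w \<in> K"
  obtains P1 K' where "fpart (F - {e}) P1" "\<And>W. W \<in> P \<Longrightarrow> W \<noteq> K \<Longrightarrow> W \<in> P1"
    "K' \<in> P1" "w \<in> K'" "card K' < card K" "excess d P1 \<le> excess d P"
    "d + 1 < card K \<Longrightarrow> excess d P1 < excess d P"
proof -
  have tK: "tight 1 F K" by (rule fpart_tight[OF P K])
  have fK: "finite K" by (rule tight_finite[OF tK])
  obtain M where M: "M \<subseteq> K" "M \<noteq> {}" "K - M \<noteq> {}"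
    "\<And>g. g \<in> inside F K - {e} \<Longrightarrow> ends G g \<subseteq> M \<or> ends G g \<subseteq> K - M"
    using edge_split[OF fpart_sparse[OF P] tK e] by blast
  define \<kappa> where "\<kappa> z = (z \<in> M)" for z
  have im: "\<kappa> ` K = {True, False}" using M(1-3) by (auto simp: \<kappa>_def)
  have cl: "{z \<in> K. \<kappa> z = True} = M" "{z \<in> K. \<kappa> z = False} = K - M" using M(1) by (auto simp: \<kappa>_def)
  have resp: "\<kappa> a = \<kappa> b" if "g \<in> inside F K - {e}" "a \<in> ends G g" "b \<in> ends G g" for g a b
    using M(4)[OF that(1)] that(2,3) by (auto simp: \<kappa>_def)
  have P1: "fpart (F - {e}) (P - {K} \<union> {M, K - M})"
  proof -
    have "fpart (F - {e}) (P - {K} \<union> (\<lambda>y. {z \<in> K. \<kappa> z = y}) ` \<kappa> ` K)"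
    proof (rule fpart_refine[OF P K])
      show "\<kappa> a = \<kappa> b" if "g \<in> inside F K - {e}" "a \<in> ends G g" "b \<in> ends G g" for g a b
        using that by (rule resp)
    qed (use e im in auto)
    then show ?thesis unfolding im image_insert image_empty cl .
  qed
  have ne: "M \<notin> P - {K}" "K - M \<notin> P - {K}" "M \<noteq> K - M"
    using fpart_disjoint[OF P _ K] M by blast+
  have fP: "finite P" by (rule fpart_finite[OF P])
  have ex1: "excess d (P - {K} \<union> {M, K - M}) = excess d (P - {K}) + (card M - 1 - d) + (card (K - M) - 1 - d)"
    unfolding excess_def using fP ne by (simp add: sum.union_disjoint)
  have ex2: "excess d P = excess d (P - {K}) + (card K - 1 - d)"
    unfolding excess_def using fP K by (simp add: sum.remove)
  have fM: "finite M" using M(1) fK finite_subset by blast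
  have c: "card M + card (K - M) = card K" using M(1) fK by (metis card_Un_disjoint Diff_disjoint Diff_partition finite_Diff fM)
  have c0: "card M > 0" "card (K - M) > 0" using M fM fK by (auto simp: card_gt_0_iff)
  obtain K' where K': "K' \<in> {M, K - M}" "w \<in> K'" using w by blast
  show ?thesis
  proof (rule that[OF P1])
    show "K' \<in> P - {K} \<union> {M, K - M}" "w \<in> K'" using K' by auto
    show "card K' < card K" using K'(1) c c0 by auto
    show "excess d (P - {K} \<union> {M, K - M}) \<le> excess d P" unfolding ex1 ex2 using c c0 by linarith
    show "excess d (P - {K} \<union> {M, K - M}) < excess d P" if "d + 1 < card K"
      unfolding ex1 ex2 using c c0 that by linarith
  qed blast
qed

section \<open>Changing blue edges inside a tight set\<close>

lemma sparse_local:
  assumes "A \<subseteq> inside (edges G) H" "\<And>S. S \<subseteq> H \<Longrightarrow> S \<noteq> {} \<Longrightarrow> card (inside A S) \<le> k * (card S - 1)"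
  shows "sparse k A"
  unfolding sparse_def
proof (intro conjI allI impI)
  show "A \<subseteq> edges G" using assms inside_subset by blast
  fix S assume S: "S \<subseteq> verts G" "S \<noteq> {}"
  have eq: "inside A S = inside A (S \<inter> H)" using assms(1) by (auto simp: inside_def)
  show "card (inside A S) \<le> k * (card S - 1)"
  proof (cases "S \<inter> H = {}")
    case True
    then have "inside A S = {}" unfolding eq using assms(1) ends_nonempty by (auto simp: inside_def)
    then show ?thesis by simp
  next
    case False
    have "card (S \<inter> H) \<le> card S" using S finite_subset_verts by (simp add: card_mono)
    then have "k * (card (S \<inter> H) - 1) \<le> k * (card S - 1)" by (intro mult_le_mono2 diff_le_mono)
    then show ?thesis unfolding eq using assms(2)[OF Int_lower2 False] by linarith
  qed
qed

text \<open>This is why exchanges may be designed inside \<open>H\<close> alone. If \<open>S\<close>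
  meets \<open>H\<close>, supermodularity against the tight set \<open>H\<close> allows at most
  \<open>k * (card S - card (S \<inter> H))\<close> edges of \<open>B\<close> inside
  \<open>S\<close> but not inside \<open>S \<inter> H\<close>; \<open>B'\<close> adds at most
  \<open>k * (card (S \<inter> H) - 1)\<close>.\<close>

lemma sparse_replace:
  assumes B: "sparse k B" and H: "tight k B H" and B': "B' \<subseteq> inside (edges G) H" "sparse k B'"
  shows "sparse k (B - inside B H \<union> B')"
  unfolding sparse_def
proof (intro conjI allI impI)
  show "B - inside B H \<union> B' \<subseteq> edges G" using sparse_edges[OF B] sparse_edges[OF B'(2)] by blast
  fix S assume S: "S \<subseteq> verts G" "S \<noteq> {}"
  have fin: "finite (inside B S)" for S by (rule finite_inside[OF sparse_edges[OF B]])
  show "card (inside (B - inside B H \<union> B') S) \<le> k * (card S - 1)"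
  proof (cases "S \<inter> H = {}")
    case True
    then have "inside (B - inside B H \<union> B') S \<subseteq> inside B S"
      using B'(1) ends_nonempty by (fastforce simp: inside_def)
    then have "card (inside (B - inside B H \<union> B') S) \<le> card (inside B S)" by (rule card_mono[OF fin])
    then show ?thesis using sparse_card[OF B S] by simp
  next
    case False
    have "inside (B - inside B H \<union> B') S = (inside B S - inside B (S \<inter> H)) \<union> inside B' (S \<inter> H)"
      using B'(1) by (auto simp: inside_def)
    then have "card (inside (B - inside B H \<union> B') S)
        \<le> card (inside B S - inside B (S \<inter> H)) + card (inside B' (S \<inter> H))"
      by (simp add: card_Un_le)
    moreover have "card (inside B S - inside B (S \<inter> H)) = card (inside B S) - card (inside B (S \<inter> H))"
      by (rule card_Diff_subset[OF fin]) (simp add: inside_mono)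
    moreover have "card (inside B (S \<inter> H)) \<le> card (inside B S)"
      by (rule card_mono[OF fin]) (simp add: inside_mono)
    moreover have "card (inside B' (S \<inter> H)) \<le> k * (card (S \<inter> H) - 1)"
      by (rule sparse_card[OF B'(2)]) (use S False in auto)
    moreover have "card (inside B (S \<union> H)) \<le> k * (card (S \<union> H) - 1)"
      by (rule sparse_card[OF B]) (use S tight_verts[OF H] in auto)
    moreover note inside_supermodular[OF sparse_edges[OF B], of S H] tight_card[OF H]
    moreover have "k * (card S - 1) + k * (card H - 1) = k * (card (S \<union> H) - 1) + k * (card (S \<inter> H) - 1)"
      using card_Un_Int_minus_1[OF finite_subset_verts[OF S(1)] tight_finite[OF H] False]
      by (metis add_mult_distrib2)
    ultimately show ?thesis by linarith
  qed
qed

lemma tight_closure: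
  assumes B: "sparse k B" and "X \<noteq> {}" and S: "tight k B S" "X \<subseteq> S"
  shows "tight k B (\<Inter>{S. tight k B S \<and> X \<subseteq> S})"
proof -
  let ?Q = "\<lambda>S. tight k B S \<and> X \<subseteq> S"
  obtain S0 where S0: "?Q S0" "\<And>S'. ?Q S' \<Longrightarrow> card S0 \<le> card S'"
    using ex_has_least_nat[of ?Q S card] S by blast
  have "S0 \<subseteq> S'" if S': "?Q S'" for S'
  proof -
    have "S0 \<inter> S' \<noteq> {}" using S0 S' assms(2) by blast
    then have "?Q (S0 \<inter> S')" using tight_Int[OF B] S0(1) S' by blast
    then have "card S0 \<le> card (S0 \<inter> S')" by (rule S0(2))
    moreover have "finite S0" using S0 tight_finite by blast
    ultimately have "S0 \<inter> S' = S0" by (intro card_seteq) auto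
    then show ?thesis by blast
  qed
  then have "\<Inter>{S. ?Q S} = S0" using S0(1) by blast
  then show ?thesis using S0(1) by simp
qed

section \<open>Optimal forests and their explorations\<close>

definition config :: "nat \<Rightarrow> 'e set \<Rightarrow> 'v set set \<Rightarrow> bool" where
  "config k F P \<longleftrightarrow> fpart F P \<and> sparse k (edges G - F)"

definition optimal :: "nat \<Rightarrow> nat \<Rightarrow> 'e set \<Rightarrow> 'v set set \<Rightarrow> bool" where
  "optimal k d F P \<longleftrightarrow> config k F P \<and> (\<forall>F' P'. config k F' P' \<longrightarrow>
     card F \<le> card F' \<and> (card F' = card F \<longrightarrow> excess d P \<le> excess d P'))"

text \<open>
  That \<open>Ks ! i\<close> meets every tight superset of its predecessors means that it meets their tight hull.
\<close>

definition legal :: "nat \<Rightarrow> nat \<Rightarrow> 'e set \<Rightarrow> 'v set set \<Rightarrow> 'v set list \<Rightarrow> bool" where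
  "legal k d F P Ks \<longleftrightarrow> distinct Ks \<and> set Ks \<subseteq> P \<and> (Ks \<noteq> [] \<longrightarrow> d + 1 < card (hd Ks)) \<and>
     (\<forall>i<length Ks. 0 < i \<longrightarrow> (\<forall>S. tight k (edges G - F) S \<and> \<Union>(set (take i Ks)) \<subseteq> S \<longrightarrow> S \<inter> Ks ! i \<noteq> {}))"

lemma optimal_exists:
  assumes "sparse (k + 1) (edges G)" shows "\<exists>F P. optimal k d F P"
proof -
  obtain T where T: "forest_decomposition (k + 1) (edges G) T" using nash_williams[OF assms] .
  have dj: "disjoint_family_on T {..<k + 1}" and T1: "\<And>i. i < k + 1 \<Longrightarrow> sparse 1 (T i)"
    and un: "(\<Union>i<k + 1. T i) = edges G"
    using T by (auto simp: forest_decomposition_def)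
  have "T i \<inter> T k = {}" if "i < k" for i using dj that by (auto simp: disjoint_family_on_def)
  then have "edges G - T k = (\<Union>i<k. T i)" unfolding un[symmetric] by (auto simp: lessThan_Suc)
  moreover have "sparse k (\<Union>i<k. T i)"
    by (rule sparse_UN) (use dj T1 in \<open>auto simp: disjoint_family_on_def\<close>)
  ultimately have "\<exists>F P. config k F P" using fpart_exists[OF T1, of k] by (auto simp: config_def)
  then obtain FP where "case FP of (F, P) \<Rightarrow> config k F P" by blast
  then obtain FP1 where 1: "case FP1 of (F, P) \<Rightarrow> config k F P"
    "\<And>FP. case FP of (F, P) \<Rightarrow> config k F P \<Longrightarrow> card (fst FP1) \<le> card (fst FP)"
    using ex_has_least_nat[of "\<lambda>FP. case FP of (F, P) \<Rightarrow> config k F P" FP "\<lambda>FP. card (fst FP)"] by blast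
  let ?Q = "\<lambda>FP. (case FP of (F, P) \<Rightarrow> config k F P) \<and> card (fst FP) = card (fst FP1)"
  obtain FP2 where 2: "?Q FP2" "\<And>FP. ?Q FP \<Longrightarrow> excess d (snd FP2) \<le> excess d (snd FP)"
    using ex_has_least_nat[of ?Q FP1 "\<lambda>FP. excess d (snd FP)"] 1 by blast
  obtain F P where FP: "FP2 = (F, P)" by fastforce
  have "optimal k d F P"
    unfolding optimal_def
  proof (intro conjI allI impI)
    show "config k F P" using 2(1) FP by simp
    fix F' P' assume c: "config k F' P'"
    show "card F \<le> card F'" using 1(2)[of "(F', P')"] c 2(1) FP by simp
    assume "card F' = card F"
    then show "excess d P \<le> excess d P'" using 2(2)[of "(F', P')"] c 2(1) FP by simp
  qed
  then show ?thesis by blast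
qed

lemma optimal_config: "optimal k d F P \<Longrightarrow> config k F P"
  by (simp add: optimal_def)

text \<open>Here minimality of the number of edges of the forest enters: an edge contained in no
  tight set could be recoloured blue.\<close>

lemma optimal_edge_in_tight:
  assumes opt: "optimal k d F P" and e: "e \<in> F"
  shows "\<exists>S. tight k (edges G - F) S \<and> ends G e \<subseteq> S"
proof (rule ccontr)
  assume no: "\<not> ?thesis"
  have c: "fpart F P" "sparse k (edges G - F)" using optimal_config[OF opt] by (auto simp: config_def)
  have FE: "F \<subseteq> edges G" using c(1) fpart_sparse sparse_edges by blast
  have "sparse k (insert e (edges G - F))" by (rule sparse_insert[OF c(2)]) (use e FE no in auto)
  moreover have "insert e (edges G - F) = edges G - (F - {e})" using e FE by blast
  moreover obtain P' where "fpart (F - {e}) P'"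
    using fpart_exists[OF sparse_subset[OF fpart_sparse[OF c(1)], of "F - {e}"]] by blast
  ultimately have "config k (F - {e}) P'" by (simp add: config_def)
  then have "card F \<le> card (F - {e})" using opt by (auto simp: optimal_def)
  moreover have "card (F - {e}) < card F" using e finite_subset_edges[OF FE] by (rule card_Diff1_less[rotated])
  ultimately show False by simp
qed

end

text \<open>\<open>minimal\<close> is lexicographic minimality in the form that exchanges
  contradict: the components before position \<open>m\<close> are kept as sets, and only the size at
  position \<open>m\<close> is compared. It ranges over all optimal pairs, because an exchange
  changes the forest.\<close>

locale min_config = multigraph G for G :: "('v, 'e) mgraph" +
  fixes k d :: nat and F :: "'e set" and P :: "'v set set" and Ks :: "'v set list" and r :: 'v
  assumes opt: "optimal k d F P" and leg: "legal k d F P Ks"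
    and maximal: "\<And>K. \<not> legal k d F P (Ks @ [K])"
    and minimal: "\<And>F' P' K' m. optimal k d F' P' \<Longrightarrow> m < length Ks \<Longrightarrow>
      legal k d F' P' (take m Ks @ [K']) \<Longrightarrow> card (Ks ! m) \<le> card K'"
    and Ks_nonempty: "Ks \<noteq> []" and root: "r \<in> Ks ! 0"

lemma (in multigraph) min_config_exists:
  assumes opt0: "optimal k d F0 P0" and ex: "excess d P0 \<noteq> 0"
  shows "\<exists>F P Ks r. min_config G k d F P Ks r"
proof -
  define ach where "ach s \<longleftrightarrow> (\<exists>F P Ks. optimal k d F P \<and> legal k d F P Ks \<and> map card Ks = s)" for s
  \<comment> \<open>Explorations of different forests are compared through their size sequences
    alone. In a good sequence each entry is the least one possible after its prefix; whenever a good
    sequence has a continuation, the least continuation is good again, so a longest good sequence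
    has none.\<close>
  define good where "good s \<longleftrightarrow> ach s \<and> (\<forall>m<length s. \<forall>a. ach (take m s @ [a]) \<longrightarrow> s ! m \<le> a)" for s
  have "ach []" unfolding ach_def using opt0 by (auto simp: legal_def)
  then have g0: "good []" by (simp add: good_def)
  have "length s < Suc (card (Pow (verts G)))" if g: "good s" for s
  proof -
    obtain F P Ks where *: "optimal k d F P" "legal k d F P Ks" "map card Ks = s"
      using g by (auto simp: good_def ach_def)
    have "set Ks \<subseteq> Pow (verts G)"
      using * fpart_tight tight_verts unfolding legal_def optimal_def config_def by blast
    then have "card (set Ks) \<le> card (Pow (verts G))" by (intro card_mono) (auto simp: finite_verts)
    then show ?thesis using * by (auto simp: legal_def distinct_card)
  qed
  then obtain s where s: "good s" "\<And>s'. good s' \<Longrightarrow> length s' \<le> length s"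
    using ex_has_greatest_nat[of good "[]" length "Suc (card (Pow (verts G)))"] g0
    by (metis le_simps(2))
  have no: "\<not> ach (s @ [a])" for a
  proof
    assume "ach (s @ [a])"
    then have l: "ach (s @ [LEAST a. ach (s @ [a])])" by (rule LeastI)
    have "good (s @ [LEAST a. ach (s @ [a])])"
      unfolding good_def
    proof (intro conjI allI impI l)
      fix m a assume m: "m < length (s @ [LEAST a. ach (s @ [a])])"
        and a: "ach (take m (s @ [LEAST a. ach (s @ [a])]) @ [a])"
      show "(s @ [LEAST a. ach (s @ [a])]) ! m \<le> a"
      proof (cases "m < length s")
        case True
        then show ?thesis using s(1) a by (simp add: good_def nth_append)
      next
        case False
        then have "m = length s" using m by simp
        then show ?thesis using a by (simp add: Least_le)
      qed
    qed
    from s(2)[OF this] show False by simp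
  qed
  obtain F P Ks where *: "optimal k d F P" "legal k d F P Ks" "map card Ks = s"
    using s(1) by (auto simp: good_def ach_def)
  have ne: "Ks \<noteq> []"
  proof
    assume "Ks = []"
    then have "s = []" using * by simp
    obtain W where "W \<in> P0" "card W - 1 - d \<noteq> 0" using ex unfolding excess_def by (meson sum.neutral)
    then have "legal k d F0 P0 [W]" by (auto simp: legal_def)
    then have "ach [card W]" using opt0 unfolding ach_def by (metis list.simps(8,9))
    then show False using no[of "card W"] \<open>s = []\<close> by simp
  qed
  have "Ks ! 0 \<in> P" using * ne by (auto simp: legal_def)
  then have "Ks ! 0 \<noteq> {}" using * fpart_tight tight_nonempty unfolding optimal_def config_def by blast
  then obtain r where r: "r \<in> Ks ! 0" by blast
  have "min_config G k d F P Ks r"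
  proof unfold_locales
    show "\<not> legal k d F P (Ks @ [K])" for K
      using no[of "card K"] *(1,3) unfolding ach_def by (metis list.simps(8,9) map_append)
    show "card (Ks ! m) \<le> card K'"
      if "optimal k d F' P'" "m < length Ks" "legal k d F' P' (take m Ks @ [K'])" for F' P' K' m
    proof -
      have "map card (take m Ks @ [K']) = take m s @ [card K']" using *(3) by (auto simp: take_map)
      then have "ach (take m s @ [card K'])" using that unfolding ach_def by blast
      then have "s ! m \<le> card K'" using s(1) that(2) *(3) by (auto simp: good_def)
      then show ?thesis using that(2) *(3) by auto
    qed
  qed (use * ne r in auto)
  then show ?thesis by blast
qed

section \<open>Tight hulls along an exploration\<close>

context min_config
begin

abbreviation B where "B \<equiv> edges G - F"

lemma P: "fpart F P" and B: "sparse k B"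
  using optimal_config[OF opt] by (auto simp: config_def)

lemma FE: "F \<subseteq> edges G"
  using fpart_sparse[OF P] sparse_edges by blast

lemma Ks_in_P: "i < length Ks \<Longrightarrow> Ks ! i \<in> P"
  using leg by (auto simp: legal_def)

lemma Ks_tight: "i < length Ks \<Longrightarrow> tight 1 F (Ks ! i)"
  using fpart_tight[OF P] Ks_in_P by blast

lemma Ks_disjoint: "i < length Ks \<Longrightarrow> j < length Ks \<Longrightarrow> i \<noteq> j \<Longrightarrow> Ks ! i \<inter> Ks ! j = {}"
  using fpart_disjoint[OF P] Ks_in_P leg by (metis legal_def nth_eq_iff_index_eq)

lemma card_Ks_0: "d + 1 < card (Ks ! 0)"
  using leg Ks_nonempty by (simp add: legal_def hd_conv_nth)

text \<open>At 0 the hull formula would intersect all tight sets, including disjoint singletons;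
  \<open>{r}\<close> is instead a tight starting set that meets \<open>Ks ! 0\<close>.\<close>

definition U :: "nat \<Rightarrow> 'v set" where
  "U i = (if i = 0 then {r} else \<Inter>{S. tight k B S \<and> \<Union>(set (take i Ks)) \<subseteq> S})"

definition H :: "'v set" where "H = U (length Ks)"

lemma take_Suc_Union: "i < length Ks \<Longrightarrow> \<Union>(set (take (Suc i) Ks)) = \<Union>(set (take i Ks)) \<union> Ks ! i"
  by (auto simp: take_Suc_conv_app_nth)

text \<open>The hull exists because optimality puts every edge of \<open>Ks ! i\<close> into a tight
  set, \<open>tree_in_tight\<close> collects these into one, and legality makes that one meet the
  previous hull.\<close>

lemma U_tight_and_covers:
  "i \<le> length Ks \<Longrightarrow> tight k B (U i) \<and> \<Union>(set (take i Ks)) \<subseteq> U i"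
proof (induction i)
  case 0
  have "r \<in> verts G" using root tight_verts[OF Ks_tight[of 0]] Ks_nonempty by auto
  then show ?case using tight_singleton[of B r k] by (simp add: U_def)
next
  case (Suc i)
  then have i: "i < length Ks" and IH: "tight k B (U i)" "\<Union>(set (take i Ks)) \<subseteq> U i" by auto
  obtain S where S: "tight k B S" "Ks ! i \<subseteq> S"
    using tree_in_tight[OF fpart_sparse[OF P] Ks_tight[OF i] B] optimal_edge_in_tight[OF opt] inside_subset
    by blast
  have "U i \<inter> Ks ! i \<noteq> {}"
  proof (cases "i = 0")
    case True
    then show ?thesis using root by (simp add: U_def)
  next
    case False
    then show ?thesis using leg i IH unfolding legal_def by blast
  qed
  then have "U i \<inter> S \<noteq> {}" using S by blast
  then have t: "tight k B (U i \<union> S)" by (rule tight_Un[OF B IH(1) S(1)])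
  have sub: "\<Union>(set (take (Suc i) Ks)) \<subseteq> U i \<union> S" using take_Suc_Union[OF i] IH S by blast
  have "\<Union>(set (take (Suc i) Ks)) \<noteq> {}" using take_Suc_Union[OF i] tight_nonempty[OF Ks_tight[OF i]] by blast
  then have "tight k B (U (Suc i))" unfolding U_def using tight_closure[OF B _ t sub] by simp
  moreover have "\<Union>(set (take (Suc i) Ks)) \<subseteq> U (Suc i)"
    unfolding U_def by (simp only: nat.simps if_False) blast
  ultimately show ?case by blast
qed

lemma U_tight: "i \<le> length Ks \<Longrightarrow> tight k B (U i)"
  and U_covers: "i \<le> length Ks \<Longrightarrow> \<Union>(set (take i Ks)) \<subseteq> U i"
  using U_tight_and_covers by blast+

lemma U_least: "0 < i \<Longrightarrow> tight k B S \<Longrightarrow> \<Union>(set (take i Ks)) \<subseteq> S \<Longrightarrow> U i \<subseteq> S"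
  by (auto simp: U_def)

lemma Ks_subset_U: "i < j \<Longrightarrow> j \<le> length Ks \<Longrightarrow> Ks ! i \<subseteq> U j"
proof -
  assume *: "i < j" "j \<le> length Ks"
  then have "Ks ! i \<in> set (take j Ks)" by (auto simp: in_set_conv_nth intro!: exI[of _ i])
  then show ?thesis using U_covers[OF *(2)] by blast
qed

lemma U_meets: "i < length Ks \<Longrightarrow> U i \<inter> Ks ! i \<noteq> {}"
proof (cases "i = 0")
  case True
  then show ?thesis using root by (simp add: U_def)
next
  case False
  assume "i < length Ks"
  then show ?thesis using leg False U_tight[of i] U_covers[of i] unfolding legal_def by auto
qed

lemma U_Suc_least: "i < length Ks \<Longrightarrow> tight k B S \<Longrightarrow> U i \<union> Ks ! i \<subseteq> S \<Longrightarrow> U (Suc i) \<subseteq> S"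
  by (rule U_least) (use take_Suc_Union[of i] U_covers[of i] in auto)

lemma U_mono: "i \<le> j \<Longrightarrow> j \<le> length Ks \<Longrightarrow> U i \<subseteq> U j"
proof (cases "i = 0")
  case True
  assume j: "i \<le> j" "j \<le> length Ks"
  show ?thesis
  proof (cases "j = 0")
    case False
    then show ?thesis using True root Ks_subset_U[of 0 j] j by (auto simp: U_def)
  qed (use True in simp)
next
  case False
  assume j: "i \<le> j" "j \<le> length Ks"
  show ?thesis
  proof (rule U_least)
    show "\<Union>(set (take i Ks)) \<subseteq> U j"
      using U_covers[OF j(2)] set_take_subset_set_take[OF j(1), of Ks] by blast
  qed (use False U_tight j in auto)
qed

lemma root_in_U: "i \<le> length Ks \<Longrightarrow> r \<in> U i"
  using U_mono[of 0 i] by (simp add: U_def)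

lemma U_subset_H: "i \<le> length Ks \<Longrightarrow> U i \<subseteq> H"
  unfolding H_def by (rule U_mono) auto

lemma H_tight: "tight k B H"
  unfolding H_def by (rule U_tight) simp

text \<open>A component that meets the final hull without having been chosen would be a legal
  continuation, against \<open>maximal\<close>.\<close>

lemma H_eq: "H = \<Union>(set Ks)"
proof
  show "\<Union>(set Ks) \<subseteq> H" using U_covers[of "length Ks"] by (simp add: H_def)
  show "H \<subseteq> \<Union>(set Ks)"
  proof
    fix v assume v: "v \<in> H"
    then obtain W where W: "W \<in> P" "v \<in> W"
      using fpart_cover[OF P] tight_verts[OF H_tight] by blast
    have "W \<in> set Ks"
    proof (rule ccontr)
      assume nW: "W \<notin> set Ks"
      have "legal k d F P (Ks @ [W])"
        unfolding legal_def
      proof (intro conjI allI impI)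
        show "distinct (Ks @ [W])" "set (Ks @ [W]) \<subseteq> P" "d + 1 < card (hd (Ks @ [W]))"
          using leg nW W Ks_nonempty by (auto simp: legal_def)
        fix i S assume i: "i < length (Ks @ [W])" "0 < i"
          and S: "tight k B S \<and> \<Union>(set (take i (Ks @ [W]))) \<subseteq> S"
        show "S \<inter> (Ks @ [W]) ! i \<noteq> {}"
        proof (cases "i < length Ks")
          case True
          then show ?thesis using leg i S by (auto simp: legal_def nth_append)
        next
          case False
          then have "i = length Ks" using i by simp
          then show ?thesis using U_least[of i S] i S v W(2) by (auto simp: H_def)
        qed
      qed
      then show False using maximal by blast
    qed
    then show "v \<in> \<Union>(set Ks)" using W by blast
  qed
qed

text \<open>The list of what an exchange must achieve for a contradiction. The hull
  \<open>U q\<close> keeps its blue edges, so sets that are tight afterwards restrict to sets that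
  were tight before, and the prefix stays legal; then \<open>K'\<close> improves position
  \<open>q\<close>. For \<open>q = 0\<close> the smaller \<open>K'\<close> may have too few edges to
  start an exploration, hence the demand that the excess drop.\<close>

lemma no_better_prefix:
  assumes q: "q < length Ks" and c: "fpart F' P'" "sparse k (edges G - F')" and "card F' = card F"
    and ex: "excess d P' \<le> excess d P" "q = 0 \<Longrightarrow> excess d P' < excess d P"
    and pre: "\<And>i. i < q \<Longrightarrow> Ks ! i \<in> P'"
    and K': "K' \<in> P'" "w \<in> K'" "w \<in> U q" "w \<in> Ks ! q" "card K' < card (Ks ! q)"
    and keep: "inside B (U q) \<subseteq> edges G - F'"
  shows False
proof -
  have c': "config k F' P'" using c by (simp add: config_def)
  then have "excess d P \<le> excess d P'" using opt \<open>card F' = card F\<close> by (auto simp: optimal_def)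
  then have q0: "q > 0" and eq: "excess d P' = excess d P" using ex by (auto intro: gr0I)
  have opt': "optimal k d F' P'" using opt c' eq \<open>card F' = card F\<close> by (auto simp: optimal_def)
  let ?B = "edges G - F'"
  have qle: "q \<le> length Ks" using q by simp
  have tU: "tight k ?B (U q)" by (rule tight_superset[OF U_tight[OF qle] c(2) keep])
  have "inside B (U q) = inside ?B (U q)"
  proof (rule card_subset_eq)
    show "finite (inside ?B (U q))" by (rule finite_inside) blast
    show "inside B (U q) \<subseteq> inside ?B (U q)" using keep by (auto simp: inside_def)
    show "card (inside B (U q)) = card (inside ?B (U q))"
      using tight_card[OF tU] tight_card[OF U_tight[OF qle]] by simp
  qed
  then have same: "inside B S = inside ?B S" if "S \<subseteq> U q" for S
    using that by (auto simp: inside_def)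
  have restrict: "tight k B (S \<inter> U q)" if "tight k ?B S" "S \<inter> U q \<noteq> {}" for S
    using tight_Int[OF c(2) that(1) tU that(2)] same[of "S \<inter> U q"] by (simp add: tight_def)
  have len: "length (take q Ks) = q" using q by simp
  have cov: "\<Union>(set (take i Ks)) \<subseteq> U q" if "i \<le> q" for i
    using U_covers[OF qle] set_take_subset_set_take[OF that, of Ks] by blast
  have ne: "\<Union>(set (take i Ks)) \<noteq> {}" if "0 < i" "i \<le> q" for i
  proof -
    have "Ks ! 0 \<in> set (take i Ks)" using that q by (auto simp: in_set_conv_nth intro!: exI[of _ 0])
    then show ?thesis using root by blast
  qed
  have "legal k d F' P' (take q Ks @ [K'])"
    unfolding legal_def
  proof (intro conjI allI impI)
    have "K' \<notin> set (take q Ks)"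
    proof
      assume "K' \<in> set (take q Ks)"
      then obtain i where "i < q" "K' = Ks ! i" using q by (auto simp: in_set_conv_nth)
      then show False using Ks_disjoint[of i q] q K' by auto
    qed
    then show "distinct (take q Ks @ [K'])" using leg by (auto simp: legal_def)
    show "set (take q Ks @ [K']) \<subseteq> P'" using pre K'(1) q by (auto simp: in_set_conv_nth)
    show "d + 1 < card (hd (take q Ks @ [K']))"
      using card_Ks_0 q0 q Ks_nonempty by (simp add: hd_append hd_conv_nth)
    fix i S assume i: "i < length (take q Ks @ [K'])" "0 < i"
      and S: "tight k ?B S \<and> \<Union>(set (take i (take q Ks @ [K']))) \<subseteq> S"
    have iq: "i \<le> q" using i len by simp
    then have tk: "take i (take q Ks @ [K']) = take i Ks" using len by (simp add: min_def)
    have sub: "\<Union>(set (take i Ks)) \<subseteq> S \<inter> U q" using S cov[OF iq] unfolding tk by blast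
    then have t: "tight k B (S \<inter> U q)" using restrict[of S] S ne[OF i(2) iq] by blast
    show "S \<inter> (take q Ks @ [K']) ! i \<noteq> {}"
    proof (cases "i < q")
      case True
      then have "S \<inter> U q \<inter> Ks ! i \<noteq> {}" using leg t sub i q unfolding legal_def by (meson less_trans)
      then show ?thesis using True len by (auto simp: nth_append)
    next
      case False
      then have "i = q" using iq by simp
      then have "U q \<subseteq> S" using U_least[OF q0 t] sub by blast
      then show ?thesis using K' \<open>i = q\<close> len by (auto simp: nth_append)
    qed
  qed
  from minimal[OF opt' q this] K'(5) show False by simp
qed

end

section \<open>Exchanges along rooted blue trees\<close>

text \<open>All \<open>k\<close> trees are rooted at the same \<open>r\<close>. As a result the
  tight sets through \<open>r\<close> inside \<open>H\<close> are the sets closed under all parent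
  maps, by \<open>parent_in_tight\<close> and \<open>tight_if_closed\<close>.\<close>

locale rooted_config = min_config G k d F P Ks r
  for G :: "('v, 'e) mgraph" and k d F P Ks r +
  fixes T :: "nat \<Rightarrow> 'e set" and par :: "nat \<Rightarrow> 'v \<Rightarrow> 'v" and pe :: "nat \<Rightarrow> 'v \<Rightarrow> 'e"
  assumes T_decomposition: "forest_decomposition k (inside B H) T"
    and parent: "b < k \<Longrightarrow> v \<in> H - {r} \<Longrightarrow> par b v \<in> H \<and> ends G (pe b v) = {v, par b v}"
    and T_eq: "b < k \<Longrightarrow> T b = pe b ` (H - {r})"
    and ancestor_labels: "b < k \<Longrightarrow> \<exists>\<pi>. (\<forall>x\<in>insert r X. \<pi> x = x) \<and> (\<forall>v\<in>H. \<pi> v \<in> insert r X) \<and>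
       (\<forall>v\<in>H - insert r X. \<pi> v = \<pi> (par b v))"

lemma (in min_config) rooted_config_exists: "\<exists>T par pe. rooted_config G k d F P Ks r T par pe"
proof -
  have "sparse k (inside B H)" by (rule sparse_subset[OF B inside_subset])
  then obtain T where T: "forest_decomposition k (inside B H) T" using nash_williams by blast
  have dj: "disjoint_family_on T {..<k}" and T1: "\<And>i. i < k \<Longrightarrow> sparse 1 (T i)"
    and un: "(\<Union>i<k. T i) = inside B H"
    using T by (auto simp: forest_decomposition_def)
  have "tight k (\<Union>i<k. T i) H" using H_tight unfolding un tight_def inside_inside by simp
  then have tH: "tight 1 (T b) H" if "b < k" for b using tight_UN_D[OF dj T1 _ that] by blast
  have rH: "r \<in> H" using root_in_U[of "length Ks"] by (simp add: H_def)
  let ?Q = "\<lambda>b par pe. (\<forall>v\<in>H - {r}. par v \<in> H \<and> ends G (pe v) = {v, par v}) \<and>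
    inside (T b) H = pe ` (H - {r}) \<and>
    (\<forall>X. \<exists>\<pi>. (\<forall>x\<in>insert r X. \<pi> x = x) \<and> (\<forall>v\<in>H. \<pi> v \<in> insert r X) \<and>
       (\<forall>v\<in>H - insert r X. \<pi> v = \<pi> (par v)))"
  have "\<forall>b. \<exists>pp. b < k \<longrightarrow> ?Q b (fst pp) (snd pp)"
  proof
    fix b
    show "\<exists>pp. b < k \<longrightarrow> ?Q b (fst pp) (snd pp)"
    proof (cases "b < k")
      case True
      obtain par pe where 1: "\<forall>v\<in>H - {r}. par v \<in> H \<and> ends G (pe v) = {v, par v}"
        "inside (T b) H = pe ` (H - {r})"
        "\<forall>X. \<exists>\<pi>. (\<forall>x\<in>insert r X. \<pi> x = x) \<and> (\<forall>v\<in>H. \<pi> v \<in> insert r X) \<and>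
           (\<forall>v\<in>H - insert r X. \<pi> v = \<pi> (par v))"
        by (rule rooted_tree[OF T1[OF True] tH[OF True] rH])
      from 1 have "?Q b par pe" by (intro conjI)
      then have "?Q b (fst (par, pe)) (snd (par, pe))" by (unfold fst_conv snd_conv)
      then show ?thesis by (intro exI[of _ "(par, pe)"] impI)
    qed simp
  qed
  from choice[OF this] obtain pp where pp0: "\<forall>b. b < k \<longrightarrow> ?Q b (fst (pp b)) (snd (pp b))" by (elim exE)
  have pp: "?Q b (fst (pp b)) (snd (pp b))" if "b < k" for b
    by (rule pp0[THEN spec, THEN mp, OF that])
  have ins: "inside (T b) H = T b" if "b < k" for b
    using un that by (auto simp: inside_def)
  have "rooted_config G k d F P Ks r T (\<lambda>b. fst (pp b)) (\<lambda>b. snd (pp b))"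
  proof unfold_locales
    fix b X assume b: "b < k"
    show "\<exists>\<pi>. (\<forall>x\<in>insert r X. \<pi> x = x) \<and> (\<forall>v\<in>H. \<pi> v \<in> insert r X) \<and>
       (\<forall>v\<in>H - insert r X. \<pi> v = \<pi> (fst (pp b) v))"
      using pp[OF b, THEN conjunct2, THEN conjunct2] by (rule spec)
    show "T b = snd (pp b) ` (H - {r})"
      using pp[OF b, THEN conjunct2, THEN conjunct1] ins[OF b] by simp
    show "fst (pp b) v \<in> H \<and> ends G (snd (pp b) v) = {v, fst (pp b) v}" if "v \<in> H - {r}" for v
      using pp[OF b, THEN conjunct1] that by blast
  qed (fact T)
  then show ?thesis by blast
qed

context rooted_config
begin

section \<open>Tight sets as parent-closed sets\<close>

lemma root_in_H: "r \<in> H"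
  using root_in_U[of "length Ks"] by (simp add: H_def)

lemma H_verts: "H \<subseteq> verts G"
  by (rule tight_verts[OF H_tight])

lemma finite_H: "finite H"
  by (rule finite_subset_verts[OF H_verts])

lemma T_disjoint: "disjoint_family_on T {..<k}"
  and T_sparse: "b < k \<Longrightarrow> sparse 1 (T b)"
  and T_union: "(\<Union>b<k. T b) = inside B H"
  using T_decomposition by (auto simp: forest_decomposition_def)

lemma T_subset: "b < k \<Longrightarrow> T b \<subseteq> inside B H"
  using T_union by blast

lemma tight_T: assumes "b < k" "tight k B S" "S \<subseteq> H" shows "tight 1 (T b) S"
proof (rule tight_UN_D[OF T_disjoint T_sparse _ assms(1)])
  have "H \<inter> S = S" using assms(3) by blast
  then show "tight k (\<Union>b<k. T b) S" using assms(2) unfolding T_union tight_def inside_inside by simp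
qed

lemma inj_pe: assumes "b < k" shows "inj_on (pe b) (H - {r})"
proof (rule eq_card_imp_inj_on)
  have "inside (T b) H = T b" using T_subset[OF assms] by (auto simp: inside_def)
  then have "card (T b) = card H - 1"
    using tight_card[OF tight_T[OF assms H_tight]] by simp
  then show "card (pe b ` (H - {r})) = card (H - {r})"
    using T_eq[OF assms] root_in_H by (simp add: card_Diff_singleton_if)
qed (use finite_H in simp)

text \<open>A tree edge inside \<open>S\<close> is the parent edge of a vertex of
  \<open>S - {r}\<close> whose parent is in \<open>S\<close>; if there are \<open>card S - 1\<close>
  such edges, every vertex of \<open>S - {r}\<close> is used. The hypothesis counts edges of one
  tree only, because it is also applied to sets that are tight merely after an exchange.\<close>

lemma parent_closed:
  assumes b: "b < k" and S: "S \<subseteq> H" "r \<in> S" and card: "card S - 1 \<le> card (inside (T b) S)"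
    and v: "v \<in> S" "v \<noteq> r"
  shows "par b v \<in> S"
proof -
  let ?S = "{v \<in> S - {r}. par b v \<in> S}"
  have fS: "finite S" using S finite_H finite_subset by blast
  have "inside (T b) S \<subseteq> pe b ` ?S"
  proof
    fix g assume g: "g \<in> inside (T b) S"
    then have "g \<in> pe b ` (H - {r})" using T_eq[OF b] by (simp add: inside_def)
    then obtain u where u: "u \<in> H - {r}" "g = pe b u" by blast
    then have "{u, par b u} \<subseteq> S" using parent[OF b u(1)] g by (simp add: inside_def)
    then show "g \<in> pe b ` ?S" using u by blast
  qed
  then have "card (inside (T b) S) \<le> card (pe b ` ?S)" by (rule card_mono[rotated]) (use fS in simp)
  also have "\<dots> \<le> card ?S" by (rule card_image_le) (use fS in simp)
  finally have "card (S - {r}) \<le> card ?S" using card S(2) fS by (simp add: card_Diff_singleton_if)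
  then have "?S = S - {r}" by (intro card_seteq) (use fS in auto)
  then show ?thesis using v by blast
qed

lemma parent_in_tight:
  assumes "b < k" "tight k B S" "S \<subseteq> H" "r \<in> S" "v \<in> S" "v \<noteq> r"
  shows "par b v \<in> S"
  by (rule parent_closed) (use assms tight_card[OF tight_T[OF assms(1-3)]] in auto)

lemma tight_if_closed:
  assumes S: "S \<subseteq> H" "r \<in> S" and cl: "\<And>b v. b < k \<Longrightarrow> v \<in> S \<Longrightarrow> v \<noteq> r \<Longrightarrow> par b v \<in> S"
  shows "tight k B S"
proof (rule tightI[OF B])
  show "S \<subseteq> verts G" "S \<noteq> {}" using S H_verts by auto
  have fS: "finite S" using S finite_H finite_subset by blast
  have "card S - 1 \<le> card (inside (T b) S)" if b: "b < k" for b
  proof -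
    have sub: "S - {r} \<subseteq> H - {r}" using S by blast
    have "pe b ` (S - {r}) \<subseteq> inside (T b) S"
    proof
      fix g assume "g \<in> pe b ` (S - {r})"
      then obtain u where u: "u \<in> S - {r}" "g = pe b u" by blast
      then have "ends G g = {u, par b u}" "g \<in> T b" using parent[OF b, of u] T_eq[OF b] sub by auto
      then show "g \<in> inside (T b) S" using u cl[OF b, of u] by (simp add: inside_def)
    qed
    then have "card (pe b ` (S - {r})) \<le> card (inside (T b) S)"
      by (rule card_mono[OF finite_inside[OF sparse_edges[OF T_sparse[OF b]]]])
    moreover have "card (pe b ` (S - {r})) = card (S - {r})"
      by (rule card_image[OF inj_on_subset[OF inj_pe[OF b] sub]])
    ultimately show ?thesis using S(2) fS by (simp add: card_Diff_singleton_if)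
  qed
  then have "(\<Sum>b<k. card S - 1) \<le> (\<Sum>b<k. card (inside (T b) S))" by (intro sum_mono) auto
  also have "\<dots> = card (inside (\<Union>b<k. T b) S)"
    by (rule card_inside_disjoint_union[symmetric])
       (use T_disjoint sparse_edges[OF T_sparse] in auto)
  also have "inside (\<Union>b<k. T b) S = inside B S"
    unfolding T_union using S by (auto simp: inside_def)
  finally show "k * (card S - 1) \<le> card (inside B S)" by simp
qed

definition ancestor_label :: "nat \<Rightarrow> 'v set \<Rightarrow> ('v \<Rightarrow> 'v) \<Rightarrow> bool" where
  "ancestor_label b X \<pi> \<longleftrightarrow> (\<forall>x\<in>insert r X. \<pi> x = x) \<and> (\<forall>v\<in>H. \<pi> v \<in> insert r X) \<and>
     (\<forall>v\<in>H - insert r X. \<pi> v = \<pi> (par b v))"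

lemma ancestor_label_exists: "b < k \<Longrightarrow> \<exists>\<pi>. ancestor_label b X \<pi>"
  unfolding ancestor_label_def by (rule ancestor_labels)

lemma ancestor_label_fix: "ancestor_label b X \<pi> \<Longrightarrow> x \<in> insert r X \<Longrightarrow> \<pi> x = x"
  and ancestor_label_range: "ancestor_label b X \<pi> \<Longrightarrow> v \<in> H \<Longrightarrow> \<pi> v \<in> insert r X"
  and ancestor_label_parent:
    "ancestor_label b X \<pi> \<Longrightarrow> v \<in> H \<Longrightarrow> v \<noteq> r \<Longrightarrow> v \<notin> X \<Longrightarrow> \<pi> v = \<pi> (par b v)"
  unfolding ancestor_label_def by blast+

text \<open>Labels change only across the parent edges of \<open>X\<close>, so the labels that occur
  in \<open>S\<close> bound from below the number of pieces into which \<open>S\<close>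
  falls.\<close>

lemma ancestor_label_card:
  assumes b: "b < k" and X: "X \<subseteq> H - {r}" and \<pi>: "ancestor_label b X \<pi>" and S: "S \<subseteq> H"
  shows "card (inside (T b - pe b ` X) S) + card (\<pi> ` S) \<le> card S"
proof (rule card_labels)
  let ?A = "T b - pe b ` X"
  show "sparse 1 ?A" by (rule sparse_subset[OF T_sparse[OF b]]) blast
  show "S \<subseteq> verts G" using S H_verts by blast
  fix g a c assume "g \<in> inside ?A S" and ac: "a \<in> ends G g" "c \<in> ends G g"
  then have g: "g \<in> ?A" using inside_subset by blast
  then obtain u where u: "u \<in> H - {r}" "g = pe b u" using T_eq[OF b] by blast
  then have "\<pi> u = \<pi> (par b u)" using ancestor_label_parent[OF \<pi>, of u] g by blast
  moreover have "ends G g = {u, par b u}" using parent[OF b u(1)] u(2) by simp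
  ultimately show "\<pi> a = \<pi> c" using ac by auto
qed

lemma pe_tail: "b < k \<Longrightarrow> x \<in> H - {r} \<Longrightarrow> x \<in> ends G (pe b x)"
  using parent by simp

text \<open>\<open>S\<close> induces a subtree of \<open>T b\<close> through the root, and avoiding
  \<open>X\<close> it contains no cut edge, so it stays in the root piece.\<close>

lemma ancestor_label_tight:
  assumes b: "b < k" and X: "X \<subseteq> H - {r}" and \<pi>: "ancestor_label b X \<pi>"
    and S: "tight k B S" "S \<subseteq> H" "r \<in> S" "S \<inter> X = {}" and v: "v \<in> S"
  shows "\<pi> v = r"
proof -
  let ?A = "T b - pe b ` X"
  have "g \<notin> pe b ` X" if "g \<in> inside (T b) S" for g
  proof
    assume "g \<in> pe b ` X"
    then obtain x where x: "x \<in> X" "g = pe b x" by blast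
    then have "x \<in> ends G g" using pe_tail[OF b] X by blast
    then show False using that x S(4) by (auto simp: inside_def)
  qed
  then have "inside (T b) S \<subseteq> inside ?A S" by (auto simp: inside_def)
  then have "card (inside (T b) S) \<le> card (inside ?A S)"
    by (rule card_mono[rotated]) (rule finite_inside, use sparse_edges[OF T_sparse[OF b]] in blast)
  moreover have "card (inside (T b) S) = card S - 1" using tight_card[OF tight_T[OF b S(1,2)]] by simp
  ultimately have "card (\<pi> ` S) \<le> Suc 0"
    using ancestor_label_card[OF b X \<pi> S(2)] tight_card_pos[OF S(1)] by linarith
  moreover have "finite (\<pi> ` S)" using tight_finite[OF S(1)] by simp
  ultimately have "\<forall>a\<in>\<pi> ` S. \<forall>c\<in>\<pi> ` S. a = c" using card_le_Suc0_iff_eq by blast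
  then have "\<pi> v = \<pi> r" using v S(3) by blast
  then show ?thesis using ancestor_label_fix[OF \<pi>, of r] by simp
qed

section \<open>Simultaneous exchanges in one blue tree\<close>

lemma blue_exchange:
  assumes b: "b < k" and E': "E' \<subseteq> inside F H" and X: "X \<subseteq> H - {r}"
    and s: "sparse 1 (T b - pe b ` X \<union> E')"
  defines "T' \<equiv> T(b := T b - pe b ` X \<union> E')"
  shows "disjoint_family_on T' {..<k}" and "\<And>c. c < k \<Longrightarrow> sparse 1 (T' c)"
    and "(\<Union>c<k. T' c) = inside B H - pe b ` X \<union> E'"
    and "sparse k (\<Union>c<k. T' c)"
proof -
  have bX: "pe b ` X \<subseteq> T b" using T_eq[OF b] X by blast
  have E'F: "E' \<inter> inside B H = {}" using E' by (auto simp: inside_def)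
  have "T' a \<inter> T' c = {}" if "a < k" "c < k" "a \<noteq> c" for a c
  proof -
    have "T a \<inter> T c = {}" using T_disjoint that by (auto simp: disjoint_family_on_def)
    then show ?thesis
      using E'F T_subset[OF that(1)] T_subset[OF that(2)] that(3) by (auto simp: T'_def)
  qed
  then show dj: "disjoint_family_on T' {..<k}" by (auto simp: disjoint_family_on_def)
  show sp: "sparse 1 (T' c)" if "c < k" for c using s T_sparse[OF that] by (simp add: T'_def)
  have "T c \<inter> pe b ` X = {}" if "c < k" "c \<noteq> b" for c
    using T_disjoint b that bX by (fastforce simp: disjoint_family_on_def)
  then have "(\<Union>c<k. T' c) = (\<Union>c<k. T c) - pe b ` X \<union> E'"
    using b unfolding T'_def by (auto split: if_splits)
  then show "(\<Union>c<k. T' c) = inside B H - pe b ` X \<union> E'" unfolding T_union .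
  show "sparse k (\<Union>c<k. T' c)" by (rule sparse_UN[OF dj sp])
qed

text \<open>The edges \<open>pe b x\<close> are to become red and to attach \<open>C x\<close> to
  the part of \<open>K\<close> around \<open>x\<close>. The bound on \<open>card (C x)\<close> means
  that these components have no excess before the exchange; staying off \<open>U q\<close> protects
  the hull and the components before position \<open>q\<close>.\<close>

definition tails :: "nat \<Rightarrow> nat \<Rightarrow> 'v set \<Rightarrow> ('v \<Rightarrow> 'v set) \<Rightarrow> 'v set \<Rightarrow> bool" where
  "tails b q K C X \<longleftrightarrow> X \<noteq> {} \<and> X \<subseteq> K \<and> inj_on C X \<and>
     (\<forall>x\<in>X. x \<notin> U q \<and> C x \<in> P \<and> par b x \<in> C x \<and> C x \<noteq> K \<and> C x \<inter> U q = {} \<and> card (C x) \<le> d + 1)"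

text \<open>\<open>K\<close> meets the hull \<open>U q\<close> in a vertex that lies in the root
  piece. Together with it the tails carry |X| + 1 different labels, so \<open>K\<close> gives up |X|
  red edges, as many as it receives. The part around that vertex is smaller than \<open>K\<close>
  and would take position \<open>q\<close>; hence the exchange must raise the excess, or for
  \<open>q = 0\<close> at least not lower it. The numbers \<open>w\<close> and \<open>a x\<close>
  are the sizes of the parts.\<close>

lemma exchange_same_component:
  assumes b: "b < k" and q: "q < length Ks" and X: "tails b q (Ks ! q) C X"
  obtains w a where "1 \<le> w" "\<And>x. x \<in> X \<Longrightarrow> 1 \<le> a x" "w + (\<Sum>x\<in>X. a x) = card (Ks ! q)"
    "card (Ks ! q) - 1 - d \<le> (w - 1 - d) + (\<Sum>x\<in>X. a x + card (C x) - 1 - d)"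
    "q > 0 \<Longrightarrow> card (Ks ! q) - 1 - d < (w - 1 - d) + (\<Sum>x\<in>X. a x + card (C x) - 1 - d)"
proof -
  let ?K = "Ks ! q"
  have qle: "q \<le> length Ks" using q by simp
  have KH: "?K \<subseteq> H" using H_eq q by auto
  have tK: "tight 1 F ?K" by (rule Ks_tight[OF q])
  have rU: "r \<in> U q" by (rule root_in_U[OF qle])
  have XK: "X \<subseteq> ?K" and Xne: "X \<noteq> {}" and injC: "inj_on C X"
    and Xx: "\<And>x. x \<in> X \<Longrightarrow> x \<notin> U q \<and> C x \<in> P \<and> par b x \<in> C x \<and> C x \<noteq> ?K \<and> C x \<inter> U q = {} \<and> card (C x) \<le> d + 1"
    using X by (auto simp: tails_def)
  have XH: "X \<subseteq> H - {r}" using XK KH Xx rU by blast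
  have fX: "finite X" using XH finite_H finite_subset by blast
  obtain w where w: "w \<in> U q" "w \<in> ?K" using U_meets[OF q] by blast
  have wX: "w \<notin> X" using w Xx by blast
  obtain \<pi> where al: "ancestor_label b X \<pi>" using ancestor_label_exists[OF b] by blast
  have \<pi>1: "\<pi> r = r" and \<pi>2: "\<And>x. x \<in> X \<Longrightarrow> \<pi> x = x" using ancestor_label_fix[OF al] by blast+
  have \<pi>w: "\<pi> w = r"
    by (rule ancestor_label_tight[OF b XH al U_tight[OF qle] U_subset_H[OF qle] rU _ w(1)]) (use Xx in blast)
  define Y where "Y = insert w X"
  have injY: "inj_on \<pi> Y"
  proof (rule inj_onI)
    fix y y' assume "y \<in> Y" "y' \<in> Y" "\<pi> y = \<pi> y'"
    then show "y = y'" using \<pi>w \<pi>2 XH unfolding Y_def by (metis Diff_iff insert_iff subsetD)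
  qed
  have Y: "Y \<subseteq> ?K" "Y \<noteq> {}" using w XK by (auto simp: Y_def)
  obtain E' \<kappa> where E': "E' \<subseteq> inside F ?K" "card E' + 1 = card Y"
    "\<And>S. finite S \<Longrightarrow> S \<noteq> {} \<Longrightarrow> card (inside E' S) + 1 \<le> card (\<pi> ` S)"
    "\<kappa> ` ?K = Y" "\<And>y. y \<in> Y \<Longrightarrow> \<kappa> y = y"
    "\<And>e a b. e \<in> inside F ?K - E' \<Longrightarrow> a \<in> ends G e \<Longrightarrow> b \<in> ends G e \<Longrightarrow> \<kappa> a = \<kappa> b"
    by (rule tree_split[OF fpart_sparse[OF P] tK Y injY]) blast
  have E'H: "E' \<subseteq> inside F H" using E'(1) KH by (auto simp: inside_def)
  have E'F: "E' \<subseteq> F" using E'(1) inside_subset by blast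
  let ?A = "T b - pe b ` X"
  have sA: "sparse 1 (?A \<union> E')"
  proof (rule sparse_local)
    show "?A \<union> E' \<subseteq> inside (edges G) H" using T_subset[OF b] E'H FE by (auto simp: inside_def)
    fix S assume S: "S \<subseteq> H" "S \<noteq> {}"
    have "card (inside (?A \<union> E') S) \<le> card (inside ?A S) + card (inside E' S)"
      unfolding inside_Un by (rule card_Un_le)
    moreover have "finite S" using S finite_H finite_subset by blast
    ultimately show "card (inside (?A \<union> E') S) \<le> 1 * (card S - 1)"
      using ancestor_label_card[OF b XH al S(1)] E'(3)[of S] S(2) by linarith
  qed
  note bl = blue_exchange[OF b E'H XH sA]
  let ?c = "\<lambda>y. {z \<in> ?K. \<kappa> z = y}"
  have peB: "pe b x \<in> inside B H" if "x \<in> X" for x using T_subset[OF b] T_eq[OF b] XH that by blast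
  have pe_ends: "ends G (pe b x) = {x, par b x}" if "x \<in> X" for x using parent[OF b, of x] XH that by blast
  obtain P1 where P1: "fpart (F - E' \<union> pe b ` X) P1"
    "\<And>W. W \<in> P \<Longrightarrow> W \<noteq> ?K \<Longrightarrow> W \<notin> C ` X \<Longrightarrow> W \<in> P1"
    "\<And>y. y \<in> Y - X \<Longrightarrow> ?c y \<in> P1"
    "excess d P1 + (card ?K - 1 - d) + (\<Sum>x\<in>X. card (C x) - 1 - d) =
     excess d P + (\<Sum>y\<in>Y. card (?c y) + (if y \<in> X then card (C y) else 0) - 1 - d)"
  proof (rule exchange_partition[OF P Ks_in_P[OF q] E'(1) E'(6) E'(2) E'(4), where X = X and Cf = C and f = "pe b"])
    show "X \<subseteq> Y" by (auto simp: Y_def)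
    show "inj_on C X" by (rule injC)
    show "C x \<in> P - {?K}" if "x \<in> X" for x using Xx[OF that] by blast
    show "pe b x \<in> edges G \<and> (\<exists>a\<in>?c x. \<exists>c\<in>C x. ends G (pe b x) = {a, c})" if "x \<in> X" for x
    proof
      show "pe b x \<in> edges G" using peB[OF that] by (auto simp: inside_def)
      have "x \<in> ?c x" using that XK E'(5)[of x] by (auto simp: Y_def)
      then show "\<exists>a\<in>?c x. \<exists>c\<in>C x. ends G (pe b x) = {a, c}" using pe_ends[OF that] Xx[OF that] by blast
    qed
  qed blast+
  have C0: "(\<Sum>x\<in>X. card (C x) - 1 - d) = 0" using Xx by (intro sum.neutral) fastforce
  have sumY: "(\<Sum>y\<in>Y. card (?c y) + (if y \<in> X then card (C y) else 0) - 1 - d)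
      = (card (?c w) - 1 - d) + (\<Sum>x\<in>X. card (?c x) + card (C x) - 1 - d)"
    unfolding Y_def using fX wX by simp
  have fK: "finite ?K" by (rule tight_finite[OF tK])
  have cpos: "1 \<le> card (?c y)" if "y \<in> Y" for y
  proof -
    have "y \<in> ?c y" using that Y(1) E'(5) by blast
    then have "card (?c y) \<noteq> 0" using fK by auto
    then show ?thesis by simp
  qed
  have sumK: "card (?c w) + (\<Sum>x\<in>X. card (?c x)) = card ?K"
  proof -
    have "?K = (\<Union>y\<in>Y. ?c y)" using E'(4) by auto
    moreover have "card (\<Union>y\<in>Y. ?c y) = (\<Sum>y\<in>Y. card (?c y))"
      by (rule card_UN_disjoint) (use fX fK in \<open>auto simp: Y_def\<close>)
    ultimately have "card ?K = (\<Sum>y\<in>Y. card (?c y))" by simp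
    then show ?thesis unfolding Y_def using fX wX by simp
  qed
  let ?F = "F - E' \<union> pe b ` X"
  have no: "\<not> (excess d P1 \<le> excess d P \<and> (q = 0 \<longrightarrow> excess d P1 < excess d P))"
  proof
    assume ex: "excess d P1 \<le> excess d P \<and> (q = 0 \<longrightarrow> excess d P1 < excess d P)"
    have cX: "card (pe b ` X) = card X" by (rule card_image[OF inj_on_subset[OF inj_pe[OF b] XH]])
    have fF: "finite F" by (rule finite_subset_edges[OF FE])
    show False
    proof (rule no_better_prefix[OF q P1(1)])
      have "edges G - ?F = B - inside B H \<union> (inside B H - pe b ` X \<union> E')"
        using E'F FE peB inside_subset[of B H] by blast
      moreover have "sparse k (B - inside B H \<union> (inside B H - pe b ` X \<union> E'))"
        using bl(4) unfolding bl(3)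
        by (rule sparse_replace[OF B H_tight, rotated]) (use E'H FE in \<open>auto simp: inside_def\<close>)
      ultimately show "sparse k (edges G - ?F)" by simp
      have "card ?F = card (F - E') + card (pe b ` X)"
        by (rule card_Un_disjoint) (use fF fX peB in \<open>auto simp: inside_def\<close>)
      moreover have "card (F - E') = card F - card E'"
        by (rule card_Diff_subset[OF finite_subset[OF E'F fF] E'F])
      moreover have "card E' = card X" using E'(2) fX wX by (simp add: Y_def)
      ultimately show "card ?F = card F" using cX card_mono[OF fF E'F] by simp
      show "excess d P1 \<le> excess d P" "q = 0 \<Longrightarrow> excess d P1 < excess d P" using ex by auto
      show "Ks ! i \<in> P1" if i: "i < q" for i
      proof (rule P1(2))
        have iq: "i < length Ks" using i q by simp
        show "Ks ! i \<in> P" by (rule Ks_in_P[OF iq])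
        show "Ks ! i \<noteq> ?K" using Ks_disjoint[OF iq q] i tight_nonempty[OF tK] by auto
        show "Ks ! i \<notin> C ` X"
          using Xx Ks_subset_U[OF i qle] tight_nonempty[OF Ks_tight[OF iq]] by blast
      qed
      show "?c w \<in> P1" by (rule P1(3)) (use wX in \<open>simp add: Y_def\<close>)
      show "w \<in> ?c w" using w E'(5)[of w] by (simp add: Y_def)
      show "w \<in> U q" "w \<in> Ks ! q" by (fact w)+
      obtain x where x: "x \<in> X" using Xne by blast
      have "x \<notin> ?c w" using x wX E'(5)[of x] by (auto simp: Y_def)
      then have "?c w \<subset> ?K" using x XK by blast
      then show "card (?c w) < card ?K" by (rule psubset_card_mono[OF fK])
      show "inside B (U q) \<subseteq> edges G - ?F"
      proof
        fix g assume g: "g \<in> inside B (U q)"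
        have "g \<notin> pe b ` X"
        proof
          assume "g \<in> pe b ` X"
          then obtain x where x: "x \<in> X" "g = pe b x" by blast
          then have "x \<in> U q" using g pe_ends[OF x(1)] by (simp add: inside_def)
          then show False using Xx[OF x(1)] by blast
        qed
        then show "g \<in> edges G - ?F" using g by (simp add: inside_def)
      qed
    qed
  qed
  have P14: "excess d P1 + (card ?K - 1 - d) =
      excess d P + ((card (?c w) - 1 - d) + (\<Sum>x\<in>X. card (?c x) + card (C x) - 1 - d))"
    using P1(4) unfolding C0 sumY by simp
  show ?thesis
  proof (rule that[of "card (?c w)" "\<lambda>x. card (?c x)"])
    show "1 \<le> card (?c w)" "\<And>x. x \<in> X \<Longrightarrow> 1 \<le> card (?c x)" using cpos by (simp_all add: Y_def)
    show "card ?K - 1 - d \<le> (card (?c w) - 1 - d) + (\<Sum>x\<in>X. card (?c x) + card (C x) - 1 - d)"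
      using no P14 by linarith
    show "card ?K - 1 - d < (card (?c w) - 1 - d) + (\<Sum>x\<in>X. card (?c x) + card (C x) - 1 - d)" if "q > 0"
      using no P14 that by linarith
  qed (fact sumK)
qed

text \<open>\<open>K\<close> need not meet \<open>U q\<close>, so only the tails are separated and
  \<open>K\<close> gives up one edge fewer than it receives. A red edge of \<open>Ks ! q\<close>
  becomes blue in exchange. Cutting it shrinks the component at position \<open>q\<close>, and for
  \<open>q = 0\<close> it lowers the excess by itself, so the inequality is strict in all
  cases.\<close>

lemma exchange_later_component:
  assumes b: "b < k" and j: "q < j" "j < length Ks" and X: "tails b q (Ks ! j) C X"
    and x0: "x0 \<in> X" "x0 \<in> U (Suc q)"
  obtains a where "\<And>x. x \<in> X \<Longrightarrow> 1 \<le> a x" "(\<Sum>x\<in>X. a x) = card (Ks ! j)"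
    "card (Ks ! j) - 1 - d < (\<Sum>x\<in>X. a x + card (C x) - 1 - d)"
proof -
  let ?K = "Ks ! j"
  have q: "q < length Ks" and qle: "q \<le> length Ks" and Sq: "Suc q \<le> length Ks" using j by simp_all
  have KH: "?K \<subseteq> H" using H_eq j by auto
  have KqH: "Ks ! q \<subseteq> H" using H_eq q by auto
  have tK: "tight 1 F ?K" by (rule Ks_tight[OF j(2)])
  have rU: "r \<in> U q" by (rule root_in_U[OF qle])
  have XK: "X \<subseteq> ?K" and Xne: "X \<noteq> {}" and injC: "inj_on C X"
    and Xx: "\<And>x. x \<in> X \<Longrightarrow> x \<notin> U q \<and> C x \<in> P \<and> par b x \<in> C x \<and> C x \<noteq> ?K \<and> C x \<inter> U q = {} \<and> card (C x) \<le> d + 1"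
    using X by (auto simp: tails_def)
  have XH: "X \<subseteq> H - {r}" using XK KH Xx rU by blast
  have fX: "finite X" using XH finite_H finite_subset by blast
  obtain \<pi> where al: "ancestor_label b X \<pi>" using ancestor_label_exists[OF b] by blast
  have \<pi>1: "\<pi> r = r" and \<pi>2: "\<And>x. x \<in> X \<Longrightarrow> \<pi> x = x" using ancestor_label_fix[OF al] by blast+
  text \<open>
    Walking along parent edges from \<open>U q \<union> Ks ! q\<close> one must eventually hit a vertex below some
    tail; \<open>s\<close> is the tail below which this happens first.
  \<close>
  define grow where "grow S \<longleftrightarrow> U q \<union> Ks ! q \<subseteq> S \<and> S \<subseteq> H \<and>
    (\<forall>v\<in>S. \<pi> v = r \<longrightarrow> v \<noteq> r \<longrightarrow> (\<forall>c<k. par c v \<in> S))" for S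
  define R where "R = \<Inter>{S. grow S}"
  have "grow H"
    unfolding grow_def using U_subset_H[OF qle] KqH parent by blast
  then have gR: "grow R" unfolding R_def grow_def by blast
  \<comment> \<open>If the closure stayed in the root piece, it would be closed under all parents,
    hence tight, and would contain \<open>U (Suc q)\<close> with the tail \<open>x0\<close>.\<close>
  have "\<exists>v\<in>R. \<pi> v \<noteq> r"
  proof (rule ccontr)
    assume *: "\<not> ?thesis"
    have "tight k B R"
      by (rule tight_if_closed) (use gR * rU in \<open>auto simp: grow_def\<close>)
    then have "U (Suc q) \<subseteq> R" using U_Suc_least[OF q] gR by (simp add: grow_def)
    then have "\<pi> x0 = r" using * x0 by blast
    then show False using \<pi>2[OF x0(1)] XH x0(1) by auto
  qed
  then obtain v0 where v0: "v0 \<in> R" "\<pi> v0 \<noteq> r" by blast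
  define s where "s = \<pi> v0"
  have sX: "s \<in> X" using ancestor_label_range[OF al, of v0] v0 gR by (auto simp: s_def grow_def)
  \<comment> \<open>With the labels \<open>s\<close> and \<open>r\<close> identified,
    \<open>E'\<close> leaves room in the new tree for one more edge between the pieces of
    \<open>r\<close> and \<open>s\<close>. \<open>cntA\<close> records this: a set that meets both
    pieces misses at least one edge there.\<close>
  define \<mu> where "\<mu> v = (if \<pi> v = s then r else \<pi> v)" for v
  have injX: "inj_on \<mu> X"
  proof (rule inj_onI)
    fix y y' assume "y \<in> X" "y' \<in> X" "\<mu> y = \<mu> y'"
    then show "y = y'" using \<pi>2 XH by (auto simp: \<mu>_def split: if_splits)
  qed
  obtain E' \<kappa> where E': "E' \<subseteq> inside F ?K" "card E' + 1 = card X"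
    "\<And>S. finite S \<Longrightarrow> S \<noteq> {} \<Longrightarrow> card (inside E' S) + 1 \<le> card (\<mu> ` S)"
    "\<kappa> ` ?K = X" "\<And>y. y \<in> X \<Longrightarrow> \<kappa> y = y"
    "\<And>e a b. e \<in> inside F ?K - E' \<Longrightarrow> a \<in> ends G e \<Longrightarrow> b \<in> ends G e \<Longrightarrow> \<kappa> a = \<kappa> b"
    by (rule tree_split[OF fpart_sparse[OF P] tK XK Xne injX]) blast
  have E'H: "E' \<subseteq> inside F H" using E'(1) KH by (auto simp: inside_def)
  have E'F: "E' \<subseteq> F" using E'(1) inside_subset by blast
  let ?A = "T b - pe b ` X"
  have cntA: "card (inside (?A \<union> E') S) + (if r \<in> \<pi> ` S \<and> s \<in> \<pi> ` S then 1 else 0) \<le> card S - 1"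
    if S: "S \<subseteq> H" "S \<noteq> {}" for S
  proof -
    have fS: "finite S" using S finite_H finite_subset by blast
    have "card (\<mu> ` S) + (if r \<in> \<pi> ` S \<and> s \<in> \<pi> ` S then 1 else 0) \<le> card (\<pi> ` S)"
    proof (cases "r \<in> \<pi> ` S \<and> s \<in> \<pi> ` S")
      case True
      have "\<mu> ` S \<subseteq> \<pi> ` S - {s}" using True sX XH by (auto simp: \<mu>_def)
      then have "card (\<mu> ` S) \<le> card (\<pi> ` S - {s})" using fS by (intro card_mono) auto
      moreover have "card (\<pi> ` S - {s}) < card (\<pi> ` S)" using fS True by (intro card_Diff1_less) auto
      ultimately show ?thesis using True by simp
    next
      case False
      have "\<mu> ` S = (\<lambda>l. if l = s then r else l) ` \<pi> ` S" by (auto simp: \<mu>_def)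
      then have "card (\<mu> ` S) \<le> card (\<pi> ` S)" using fS by (metis card_image_le finite_imageI)
      then show ?thesis unfolding if_not_P[OF False] by simp
    qed
    moreover have "card (inside (?A \<union> E') S) \<le> card (inside ?A S) + card (inside E' S)"
      unfolding inside_Un by (rule card_Un_le)
    ultimately show ?thesis using ancestor_label_card[OF b XH al S(1)] E'(3)[OF fS S(2)] by linarith
  qed
  have sA: "sparse 1 (?A \<union> E')"
  proof (rule sparse_local)
    show "?A \<union> E' \<subseteq> inside (edges G) H" using T_subset[OF b] E'H FE by (auto simp: inside_def)
    show "card (inside (?A \<union> E') S) \<le> 1 * (card S - 1)" if "S \<subseteq> H" "S \<noteq> {}" for S
      using cntA[OF that] by linarith
  qed
  note bl = blue_exchange[OF b E'H XH sA]
  let ?T = "T(b := ?A \<union> E')" let ?B = "\<Union>c<k. ?T c"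
  have peB: "pe b x \<in> inside B H" if "x \<in> X" for x using T_subset[OF b] T_eq[OF b] XH that by blast
  have pe_ends: "ends G (pe b x) = {x, par b x}" if "x \<in> X" for x using parent[OF b, of x] XH that by blast
  have noU: "g \<notin> pe b ` X" if "g \<in> inside B (U q)" for g
  proof
    assume "g \<in> pe b ` X"
    then obtain x where x: "x \<in> X" "g = pe b x" by blast
    then have "x \<in> U q" using that pe_ends[OF x(1)] by (simp add: inside_def)
    then show False using Xx[OF x(1)] by blast
  qed
  obtain w where w: "w \<in> U q" "w \<in> Ks ! q" using U_meets[OF q] by blast
  \<comment> \<open>Otherwise \<open>Ks ! q\<close> lies in a set that is tight after the exchange.
    Joined with \<open>U q\<close> it yields a tight \<open>S\<close> through \<open>r\<close>,
    which by \<open>cntA\<close> avoids the piece of \<open>s\<close>. But \<open>S\<close> has the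
    closure property defining \<open>R\<close>, so it contains \<open>v0\<close>, whose label is
    \<open>s\<close>.\<close>
  have "\<exists>e\<in>inside F (Ks ! q). \<forall>S. tight k ?B S \<longrightarrow> \<not> ends G e \<subseteq> S"
  proof (rule ccontr)
    assume "\<not> ?thesis"
    then have "\<And>e. e \<in> inside F (Ks ! q) \<Longrightarrow> \<exists>S. tight k ?B S \<and> ends G e \<subseteq> S" by blast
    then obtain S0 where S0: "tight k ?B S0" "Ks ! q \<subseteq> S0"
      using tree_in_tight[OF fpart_sparse[OF P] Ks_tight[OF q] bl(4)] by blast
    have UH: "U q \<subseteq> H" by (rule U_subset_H[OF qle])
    have tU: "tight k ?B (U q)"
    proof (rule tight_superset[OF U_tight[OF qle] bl(4)])
      show "inside B (U q) \<subseteq> ?B" unfolding bl(3) using noU UH by (auto simp: inside_def)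
    qed
    have tH: "tight k ?B (S0 \<inter> H)"
    proof -
      have BH: "inside ?B S0 = inside ?B (S0 \<inter> H)"
        unfolding bl(3) using E'H by (auto simp: inside_def)
      have S0v: "S0 \<inter> H \<subseteq> verts G" "S0 \<inter> H \<noteq> {}" using H_verts w S0 KqH by auto
      have "card (S0 \<inter> H) \<le> card S0" using tight_finite[OF S0(1)] by (simp add: card_mono)
      then have "k * (card (S0 \<inter> H) - 1) \<le> k * (card S0 - 1)" by (intro mult_le_mono2 diff_le_mono)
      then show ?thesis using tightI[OF bl(4) S0v] tight_card[OF S0(1)] BH by simp
    qed
    define S where "S = S0 \<inter> H \<union> U q"
    have tS: "tight k ?B S"
      unfolding S_def by (rule tight_Un[OF bl(4) tH tU]) (use w S0 KqH in auto)
    have SH: "S \<subseteq> H" and rS: "r \<in> S" and qS: "U q \<union> Ks ! q \<subseteq> S"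
      using UH rU S0 KqH by (auto simp: S_def)
    have t1: "card (inside (?T c) S) = card S - 1" if "c < k" for c
      using tight_card[OF tight_UN_D[OF bl(1) bl(2) tS that]] by simp
    have "S \<noteq> {}" using rS by blast
    have "card (inside (?A \<union> E') S) = card S - 1" using t1[OF b] by simp
    then have "\<not> (r \<in> \<pi> ` S \<and> s \<in> \<pi> ` S)" using cntA[OF SH \<open>S \<noteq> {}\<close>] by (auto split: if_splits)
    then have sS: "s \<notin> \<pi> ` S" using rS \<pi>1 by (metis image_eqI)
    have "grow S"
      unfolding grow_def
    proof (intro conjI ballI impI allI qS SH)
      fix v c assume v: "v \<in> S" "\<pi> v = r" "v \<noteq> r" and c: "c < k"
      show "par c v \<in> S"
      proof (cases "c = b")
        case False
        then show ?thesis using parent_closed[OF c SH rS _ v(1,3)] t1[OF c] by simp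
      next
        case True
        \<comment> \<open>The tree \<open>T b\<close> itself has changed. However, the root piece
          \<open>?Z\<close> is already spanned by its old parent edges, so no edge of
          \<open>E'\<close> lies inside it, and the tree induced by \<open>S \<inter> ?Z\<close>
          after the exchange consists of edges of \<open>T b\<close>.\<close>
        let ?Z = "{v \<in> H. \<pi> v = r}"
        have ZH: "?Z \<subseteq> H" "r \<in> ?Z" using root_in_H \<pi>1 by auto
        have neZ: "?Z \<noteq> {}" using ZH(2) by blast
        have sub: "pe b ` (?Z - {r}) \<subseteq> inside (?A \<union> E') ?Z"
        proof
          fix g assume "g \<in> pe b ` (?Z - {r})"
          then obtain u where u: "u \<in> ?Z - {r}" "g = pe b u" by blast
          then have uX: "u \<notin> X" using \<pi>2 by auto
          have uH: "u \<in> H - {r}" using u by blast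
          have "\<pi> (par b u) = r" using ancestor_label_parent[OF al, of u] u uX by simp
          then have "ends G g \<subseteq> ?Z" using parent[OF b uH] u by auto
          moreover have "g \<in> ?A"
            using inj_pe[OF b] T_eq[OF b] u uH uX XH by (auto simp: inj_on_def)
          ultimately show "g \<in> inside (?A \<union> E') ?Z" by (simp add: inside_def)
        qed
        have "card (pe b ` (?Z - {r})) = card ?Z - 1"
        proof -
          have "card (pe b ` (?Z - {r})) = card (?Z - {r})"
            by (rule card_image[OF inj_on_subset[OF inj_pe[OF b]]]) blast
          then show ?thesis using card_Diff_singleton[OF ZH(2)] by simp
        qed
        moreover have finZ: "finite (inside (?A \<union> E') ?Z)" by (rule finite_inside[OF sparse_edges[OF sA]])
        moreover have "card (inside (?A \<union> E') ?Z) \<le> card ?Z - 1" using cntA[OF ZH(1) neZ] by linarith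
        ultimately have eqZ: "pe b ` (?Z - {r}) = inside (?A \<union> E') ?Z"
          using sub by (intro card_seteq) simp_all
        have tb: "tight 1 (?A \<union> E') S" using t1[OF b] SH H_verts rS by (auto simp: tight_def)
        have "tight 1 (?A \<union> E') ?Z"
          using \<open>card (pe b ` (?Z - {r})) = card ?Z - 1\<close> unfolding eqZ tight_def
          using ZH H_verts neZ by auto
        then have "tight 1 (?A \<union> E') (S \<inter> ?Z)" using tight_Int[OF sA tb] rS ZH(2) by blast
        then have "card (S \<inter> ?Z) - 1 = card (inside (?A \<union> E') (S \<inter> ?Z))" by (simp add: tight_def)
        also have "\<dots> \<le> card (inside (T b) (S \<inter> ?Z))"
        proof (rule card_mono)
          show "finite (inside (T b) (S \<inter> ?Z))" by (rule finite_inside[OF sparse_edges[OF T_sparse[OF b]]])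
          have "inside (?A \<union> E') (S \<inter> ?Z) \<subseteq> inside (?A \<union> E') ?Z" by (auto simp: inside_def)
          also have "\<dots> \<subseteq> T b" unfolding eqZ[symmetric] using T_eq[OF b] by blast
          finally show "inside (?A \<union> E') (S \<inter> ?Z) \<subseteq> inside (T b) (S \<inter> ?Z)" by (auto simp: inside_def)
        qed
        finally have "par b v \<in> S \<inter> ?Z"
          by (intro parent_closed[OF b]) (use v SH rS ZH in auto)
        then show ?thesis using True by blast
      qed
    qed
    then have "v0 \<in> S" using v0 unfolding R_def by blast
    then show False using sS by (auto simp: s_def)
  qed
  then obtain e where e: "e \<in> inside F (Ks ! q)" "\<And>S. tight k ?B S \<Longrightarrow> \<not> ends G e \<subseteq> S" by blast
  have eF: "e \<in> F" "ends G e \<subseteq> Ks ! q" using e by (auto simp: inside_def)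
  have eE: "e \<in> edges G" using eF FE by blast
  have qj: "Ks ! q \<noteq> ?K" "Ks ! q \<inter> ?K = {}"
    using Ks_disjoint[OF q j(2)] j(1) tight_nonempty[OF tK] by auto
  have eK: "e \<notin> E'"
  proof
    assume "e \<in> E'"
    then have "ends G e \<subseteq> ?K" using E'(1) by (auto simp: inside_def)
    then show False using eF qj ends_nonempty[OF eE] by blast
  qed
  let ?c = "\<lambda>y. {z \<in> ?K. \<kappa> z = y}"
  obtain P1 where P1: "fpart (F - E' \<union> pe b ` X) P1"
    "\<And>W. W \<in> P \<Longrightarrow> W \<noteq> ?K \<Longrightarrow> W \<notin> C ` X \<Longrightarrow> W \<in> P1"
    "excess d P1 + (card ?K - 1 - d) + (\<Sum>x\<in>X. card (C x) - 1 - d) =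
     excess d P + (\<Sum>y\<in>X. card (?c y) + (if y \<in> X then card (C y) else 0) - 1 - d)"
  proof (rule exchange_partition[OF P Ks_in_P[OF j(2)] E'(1) E'(6) E'(2) E'(4), where X = X and Cf = C and f = "pe b"])
    show "inj_on C X" by (rule injC)
    show "C x \<in> P - {?K}" if "x \<in> X" for x using Xx[OF that] by blast
    show "pe b x \<in> edges G \<and> (\<exists>a\<in>?c x. \<exists>c\<in>C x. ends G (pe b x) = {a, c})" if "x \<in> X" for x
    proof
      show "pe b x \<in> edges G" using peB[OF that] by (auto simp: inside_def)
      have "x \<in> ?c x" using that XK E'(5)[of x] by auto
      then show "\<exists>a\<in>?c x. \<exists>c\<in>C x. ends G (pe b x) = {a, c}" using pe_ends[OF that] Xx[OF that] by blast
    qed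
  qed blast+
  have CU: "Ks ! i \<notin> C ` X" if i: "i \<le> q" for i
  proof
    assume "Ks ! i \<in> C ` X"
    then have dis: "Ks ! i \<inter> U q = {}" using Xx by blast
    show False
    proof (cases "i = q")
      case True
      then show False using dis w by blast
    next
      case False
      then have "Ks ! i \<subseteq> U q" using Ks_subset_U[of i q] i qle by simp
      then show False using dis tight_nonempty[OF Ks_tight[of i]] i q by auto
    qed
  qed
  have KiP1: "Ks ! i \<in> P1" if i: "i \<le> q" for i
  proof (rule P1(2)[OF Ks_in_P _ CU[OF i]])
    show "i < length Ks" using i q by simp
    then show "Ks ! i \<noteq> ?K" using Ks_disjoint[of i j] i j tight_nonempty[OF tK] by auto
  qed
  let ?F1 = "F - E' \<union> pe b ` X"
  have "e \<in> inside ?F1 (Ks ! q)" using eF eK by (simp add: inside_def)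
  then obtain P2 K' where P2: "fpart (?F1 - {e}) P2" "\<And>W. W \<in> P1 \<Longrightarrow> W \<noteq> Ks ! q \<Longrightarrow> W \<in> P2"
    "K' \<in> P2" "w \<in> K'" "card K' < card (Ks ! q)" "excess d P2 \<le> excess d P1"
    "d + 1 < card (Ks ! q) \<Longrightarrow> excess d P2 < excess d P1"
    using split_partition[OF P1(1) KiP1[OF order_refl] _ w(2)] by blast
  let ?F = "?F1 - {e}"
  have C0: "(\<Sum>x\<in>X. card (C x) - 1 - d) = 0" using Xx by (intro sum.neutral) fastforce
  have sumX: "(\<Sum>y\<in>X. card (?c y) + (if y \<in> X then card (C y) else 0) - 1 - d)
      = (\<Sum>x\<in>X. card (?c x) + card (C x) - 1 - d)"
    by (rule sum.cong) simp_all
  have fK: "finite ?K" by (rule tight_finite[OF tK])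
  have cpos: "1 \<le> card (?c y)" if "y \<in> X" for y
  proof -
    have "y \<in> ?c y" using that XK E'(5) by blast
    then have "card (?c y) \<noteq> 0" using fK by auto
    then show ?thesis by simp
  qed
  have sumK: "(\<Sum>x\<in>X. card (?c x)) = card ?K"
  proof -
    have "?K = (\<Union>y\<in>X. ?c y)" using E'(4) by auto
    moreover have "card (\<Union>y\<in>X. ?c y) = (\<Sum>y\<in>X. card (?c y))"
      by (rule card_UN_disjoint) (use fX fK in auto)
    ultimately show ?thesis by simp
  qed
  have no: "\<not> excess d P1 \<le> excess d P"
  proof
    assume ex: "excess d P1 \<le> excess d P"
    have cX: "card (pe b ` X) = card X" by (rule card_image[OF inj_on_subset[OF inj_pe[OF b] XH]])
    have fF: "finite F" by (rule finite_subset_edges[OF FE])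
    show False
    proof (rule no_better_prefix[OF q P2(1)])
      have eH: "e \<in> inside (edges G) H" using eF eE KqH by (auto simp: inside_def)
      have "edges G - ?F = B - inside B H \<union> insert e (inside B H - pe b ` X \<union> E')"
        using E'F FE peB inside_subset[of B H] eE eF by blast
      moreover have "sparse k (insert e ?B)" by (rule sparse_insert[OF bl(4) eE]) (rule e(2))
      then have "sparse k (B - inside B H \<union> insert e (inside B H - pe b ` X \<union> E'))"
        unfolding bl(3)
        by (rule sparse_replace[OF B H_tight, rotated]) (use E'H FE eH in \<open>auto simp: inside_def\<close>)
      ultimately show "sparse k (edges G - ?F)" by simp
      have "card ?F1 = card (F - E') + card (pe b ` X)"
        by (rule card_Un_disjoint) (use fF fX peB in \<open>auto simp: inside_def\<close>)
      moreover have "card (F - E') = card F - card E'"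
        by (rule card_Diff_subset[OF finite_subset[OF E'F fF] E'F])
      moreover have "e \<in> ?F1" "finite ?F1" using eF eK fF fX by auto
      then have "card ?F + 1 = card ?F1" by (metis Suc_eq_plus1 card_Suc_Diff1)
      ultimately show "card ?F = card F" using cX card_mono[OF fF E'F] E'(2) by linarith
      show "excess d P2 \<le> excess d P" using ex P2(6) by simp
      show "excess d P2 < excess d P" if "q = 0" using ex P2(7) card_Ks_0 that by simp
      show "Ks ! i \<in> P2" if i: "i < q" for i
      proof (rule P2(2)[OF KiP1])
        show "i \<le> q" using i by simp
        show "Ks ! i \<noteq> Ks ! q"
          using Ks_disjoint[of i q] i q tight_nonempty[OF Ks_tight[OF q]] by auto
      qed
      show "K' \<in> P2" "w \<in> K'" "w \<in> U q" "w \<in> Ks ! q" "card K' < card (Ks ! q)" by (fact P2 w)+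
      show "inside B (U q) \<subseteq> edges G - ?F" using noU by (auto simp: inside_def)
    qed
  qed
  show ?thesis
  proof (rule that[of "\<lambda>x. card (?c x)"])
    show "card ?K - 1 - d < (\<Sum>x\<in>X. card (?c x) + card (C x) - 1 - d)"
      using no P1(3) unfolding C0 sumX by linarith
  qed (fact cpos sumK)+
qed

end

section \<open>Small components and their owners\<close>

context rooted_config
begin

text \<open>Let \<open>U (Suc q)\<close> be the first hull that meets \<open>W\<close>. If no parent
  edge led from \<open>U (Suc q) - W\<close> into \<open>W\<close>, this difference would be closed
  under parents and thus a smaller tight set than the hull. The tail lies outside
  \<open>U q\<close>, which is closed under parents and misses \<open>W\<close>; so its component
  has index at least \<open>q\<close>.\<close>

lemma parent_into_component:
  assumes W: "W \<in> set Ks" "W \<noteq> Ks ! 0"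
  shows "\<exists>q j b x. b < k \<and> q \<le> j \<and> j < length Ks \<and> x \<in> Ks ! j \<and> x \<in> U (Suc q) \<and> x \<notin> U q \<and>
    par b x \<in> W \<and> W \<inter> U q = {} \<and> W \<noteq> Ks ! j"
proof -
  obtain l where l: "l < length Ks" "W = Ks ! l" using W(1) by (auto simp: in_set_conv_nth)
  have WP: "W \<in> P" using Ks_in_P l by blast
  have Wne: "W \<noteq> {}" using fpart_tight[OF P WP] tight_nonempty by blast
  have "W \<inter> U (length Ks) \<noteq> {}" using Ks_subset_U[of l "length Ks"] l Wne by auto
  then have ex: "\<exists>i. W \<inter> U i \<noteq> {}" by blast
  define i where "i = (LEAST i. W \<inter> U i \<noteq> {})"
  have i: "W \<inter> U i \<noteq> {}" unfolding i_def using ex by (rule LeastI_ex)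
  have i_min: "W \<inter> U m = {}" if "m < i" for m using not_less_Least[of m] that unfolding i_def by blast
  have il: "i \<le> length Ks"
    unfolding i_def by (rule Least_le) (fact \<open>W \<inter> U (length Ks) \<noteq> {}\<close>)
  have "l \<noteq> 0" using l W(2) by metis
  then have "W \<inter> Ks ! 0 = {}" using Ks_disjoint[of l 0] l Ks_nonempty by simp
  then have "W \<inter> U 0 = {}" using root by (auto simp: U_def)
  then obtain q where q: "i = Suc q" using i by (cases i) auto
  have ql: "q < length Ks" using q il by simp
  have Wq: "W \<inter> U q = {}" using i_min q by simp
  have W_ne_q: "W \<noteq> Ks ! q" using U_meets[OF ql] Wq by auto
  have WKq: "W \<inter> Ks ! q = {}" using fpart_disjoint[OF P WP Ks_in_P[OF ql] W_ne_q] .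
  let ?S = "U (Suc q) - W"
  have UH: "U (Suc q) \<subseteq> H" using U_subset_H il q by blast
  have sub: "U q \<union> Ks ! q \<subseteq> ?S"
    using U_mono[of q "Suc q"] Ks_subset_U[of q "Suc q"] il q Wq WKq by auto
  have rS: "r \<in> ?S" using root_in_U[of q] ql sub by auto
  have "\<exists>b x. b < k \<and> x \<in> ?S \<and> x \<noteq> r \<and> par b x \<notin> ?S"
  proof (rule ccontr)
    assume *: "\<not> ?thesis"
    have "tight k B ?S"
    proof (rule tight_if_closed)
      show "?S \<subseteq> H" using UH by blast
      show "par b v \<in> ?S" if "b < k" "v \<in> ?S" "v \<noteq> r" for b v using * that by blast
    qed (fact rS)
    then have "U (Suc q) \<subseteq> ?S" using U_Suc_least[OF ql] sub by blast
    then show False using i q by blast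
  qed
  then obtain b x where bx: "b < k" "x \<in> ?S" "x \<noteq> r" "par b x \<notin> ?S" by blast
  have "par b x \<in> U (Suc q)"
    by (rule parent_in_tight[OF bx(1) U_tight UH]) (use il q bx rS in auto)
  then have pW: "par b x \<in> W" using bx by blast
  have xU: "x \<notin> U q"
  proof
    assume "x \<in> U q"
    then have "par b x \<in> U q"
      by (intro parent_in_tight[OF bx(1) U_tight U_subset_H root_in_U]) (use ql bx in auto)
    then show False using pW Wq by blast
  qed
  have "x \<in> H" using bx UH by blast
  then obtain j where j: "j < length Ks" "x \<in> Ks ! j" unfolding H_eq by (auto simp: in_set_conv_nth)
  have "q \<le> j"
  proof (rule ccontr)
    assume "\<not> q \<le> j"
    then have "Ks ! j \<subseteq> U q" using Ks_subset_U[of j q] ql by simp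
    then show False using xU j by blast
  qed
  moreover have "W \<noteq> Ks ! j" "x \<in> U (Suc q)" using bx j by auto
  ultimately show ?thesis using bx(1) j xU pW Wq by (intro exI[of _ q] exI[of _ j] exI[of _ b] exI[of _ x] conjI)
qed

text \<open>The members of \<open>\<W>\<close> may have been reached at different levels
  \<open>lv W\<close>; hulls increase, so the lowest level \<open>q\<close> serves all of them, and
  its own tail supplies the vertex of \<open>U (Suc q)\<close> needed by a later component. In that
  case \<open>w = 0\<close> says that every part receives a small component. The weak inequality
  arises only when the owner is \<open>Ks ! 0\<close>.\<close>

lemma children_bound:
  assumes b: "b < k" and j: "j < length Ks" and \<W>: "\<W> \<noteq> {}" "finite \<W>"
    and W: "\<And>W. W \<in> \<W> \<Longrightarrow> W \<in> P \<and> card W \<le> d + 1 \<and> lv W \<le> j \<and> tail W \<in> Ks ! j \<and> tail W \<in> U (Suc (lv W)) \<and>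
      tail W \<notin> U (lv W) \<and> par b (tail W) \<in> W \<and> W \<inter> U (lv W) = {} \<and> W \<noteq> Ks ! j"
  shows "\<exists>w a. (\<forall>W\<in>\<W>. 1 \<le> a W) \<and> w + (\<Sum>W\<in>\<W>. a W) = card (Ks ! j) \<and>
    (card (Ks ! j) - 1 - d < (w - 1 - d) + (\<Sum>W\<in>\<W>. a W + card W - 1 - d) \<or>
     d + 1 < card (Ks ! j) \<and> 1 \<le> w \<and> card (Ks ! j) - 1 - d \<le> (w - 1 - d) + (\<Sum>W\<in>\<W>. a W + card W - 1 - d))"
proof -
  define q where "q = Min (lv ` \<W>)"
  have q: "q \<le> lv W" if "W \<in> \<W>" for W using that \<W> by (simp add: q_def)
  have "q \<in> lv ` \<W>" unfolding q_def using \<W> by (intro Min_in) auto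
  then obtain W0 where W0: "W0 \<in> \<W>" "lv W0 = q" by blast
  have lvl: "lv W \<le> length Ks" if "W \<in> \<W>" for W using W[OF that] j by simp
  have inj: "inj_on tail \<W>"
  proof (rule inj_onI)
    fix W1 W2 assume *: "W1 \<in> \<W>" "W2 \<in> \<W>" "tail W1 = tail W2"
    have "par b (tail W1) \<in> W1" "par b (tail W1) \<in> W2" "W1 \<in> P" "W2 \<in> P"
      using W[OF *(1)] W[OF *(2)] *(3) by simp_all
    then show "W1 = W2" using fpart_disjoint[OF P] by blast
  qed
  define C where "C = the_inv_into \<W> tail"
  have Ctail: "C (tail W) = W" if "W \<in> \<W>" for W unfolding C_def by (rule the_inv_into_f_f[OF inj that])
  have tails: "tails b q (Ks ! j) C (tail ` \<W>)"
    unfolding tails_def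
  proof (intro conjI ballI)
    show "tail ` \<W> \<noteq> {}" using \<W> by blast
    show "tail ` \<W> \<subseteq> Ks ! j" using W by blast
    show "inj_on C (tail ` \<W>)" unfolding C_def by (rule inj_on_the_inv_into[OF inj])
    fix x assume "x \<in> tail ` \<W>"
    then obtain W' where W': "W' \<in> \<W>" "x = tail W'" by blast
    have sub: "U q \<subseteq> U (lv W')" by (rule U_mono[OF q[OF W'(1)] lvl[OF W'(1)]])
    have C: "C x = W'" using Ctail W' by simp
    show "x \<notin> U q" using W[OF W'(1)] sub W'(2) by blast
    show "C x \<in> P" "par b x \<in> C x" "C x \<noteq> Ks ! j" "card (C x) \<le> d + 1"
      unfolding C using W[OF W'(1)] W'(2) by simp_all
    show "C x \<inter> U q = {}" unfolding C using W[OF W'(1)] sub by blast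
  qed
  have re: "(\<Sum>x\<in>tail ` \<W>. f x (C x)) = (\<Sum>W\<in>\<W>. f (tail W) W)" for f :: "'v \<Rightarrow> 'v set \<Rightarrow> nat"
    unfolding sum.reindex[OF inj] o_def by (rule sum.cong) (simp_all add: Ctail)
  have re1: "(\<Sum>x\<in>tail ` \<W>. a x) = (\<Sum>W\<in>\<W>. a (tail W))" for a :: "'v \<Rightarrow> nat"
    by (rule re[of "\<lambda>x W. a x"])
  have re2: "(\<Sum>x\<in>tail ` \<W>. a x + card (C x) - 1 - d) = (\<Sum>W\<in>\<W>. a (tail W) + card W - 1 - d)" for a
    by (rule re)
  show ?thesis
  proof (cases "q = j")
    case True
    have ql: "q < length Ks" using True j by simp
    obtain w a where wa: "1 \<le> w" "\<And>x. x \<in> tail ` \<W> \<Longrightarrow> 1 \<le> a x" "w + (\<Sum>x\<in>tail ` \<W>. a x) = card (Ks ! q)"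
      "card (Ks ! q) - 1 - d \<le> (w - 1 - d) + (\<Sum>x\<in>tail ` \<W>. a x + card (C x) - 1 - d)"
      "q > 0 \<Longrightarrow> card (Ks ! q) - 1 - d < (w - 1 - d) + (\<Sum>x\<in>tail ` \<W>. a x + card (C x) - 1 - d)"
      by (rule exchange_same_component[OF b ql, of C "tail ` \<W>"]) (use tails True in simp, blast)
    have "\<forall>W\<in>\<W>. 1 \<le> a (tail W)" using wa(2) by blast
    moreover have "w + (\<Sum>W\<in>\<W>. a (tail W)) = card (Ks ! j)" using wa(3) True by (simp add: re1)
    moreover have "card (Ks ! j) - 1 - d < (w - 1 - d) + (\<Sum>W\<in>\<W>. a (tail W) + card W - 1 - d) \<or>
        d + 1 < card (Ks ! j) \<and> 1 \<le> w \<and> card (Ks ! j) - 1 - d \<le> (w - 1 - d) + (\<Sum>W\<in>\<W>. a (tail W) + card W - 1 - d)"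
    proof (cases "j = 0")
      case j0: True
      then show ?thesis using wa(1,4) True card_Ks_0 unfolding re2 by blast
    next
      case False
      then show ?thesis using wa(5) True unfolding re2 by blast
    qed
    ultimately show ?thesis by (intro exI[of _ w] exI[of _ "\<lambda>W. a (tail W)"] conjI)
  next
    case False
    have qj: "q < j" using W[OF W0(1)] W0(2) False by simp
    have W0t: "tail W0 \<in> tail ` \<W>" "tail W0 \<in> U (Suc q)" using W0 W[OF W0(1)] by auto
    obtain a where a: "\<And>x. x \<in> tail ` \<W> \<Longrightarrow> 1 \<le> a x" "(\<Sum>x\<in>tail ` \<W>. a x) = card (Ks ! j)"
      "card (Ks ! j) - 1 - d < (\<Sum>x\<in>tail ` \<W>. a x + card (C x) - 1 - d)"
      by (rule exchange_later_component[OF b qj j tails W0t]) blast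
    have "\<forall>W\<in>\<W>. 1 \<le> a (tail W)" using a(1) by blast
    moreover have "0 + (\<Sum>W\<in>\<W>. a (tail W)) = card (Ks ! j)" using a(2) by (simp add: re1)
    moreover have "card (Ks ! j) - 1 - d < (0 - 1 - d) + (\<Sum>W\<in>\<W>. a (tail W) + card W - 1 - d) \<or>
        d + 1 < card (Ks ! j) \<and> 1 \<le> (0::nat) \<and> card (Ks ! j) - 1 - d \<le> (0 - 1 - d) + (\<Sum>W\<in>\<W>. a (tail W) + card W - 1 - d)"
      using a(3) unfolding re2 by simp
    ultimately show ?thesis by (intro exI[of _ 0] exI[of _ "\<lambda>W. a (tail W)"] conjI)
  qed
qed

text \<open>Each part of the owner has its own allowance of \<open>d\<close> edges. Two isolated
  vertices bring at most one additional edge but a second allowance, so the excess can rise only if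
  d = 0. Three components with at most one edge bring at most four additional edges against two
  further allowances, so it can rise only if d \<le> 1.\<close>

lemma small_components_assignment:
  obtains own :: "'v set \<Rightarrow> 'v set" and col :: "'v set \<Rightarrow> nat" where
    "\<And>W. W \<in> set Ks \<Longrightarrow> card W \<le> d + 1 \<Longrightarrow> own W \<in> set Ks \<and> col W < k"
    "\<And>W. W \<in> set Ks \<Longrightarrow> card W \<le> d + 1 \<Longrightarrow> d + 2 \<le> card (own W) + card W"
    "\<And>W1 W2. W1 \<in> set Ks \<Longrightarrow> W2 \<in> set Ks \<Longrightarrow> W1 \<noteq> W2 \<Longrightarrow> own W1 = own W2 \<Longrightarrow> col W1 = col W2 \<Longrightarrow>
       card W1 = 1 \<Longrightarrow> card W2 = 1 \<Longrightarrow> d = 0"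
    "\<And>W1 W2 W3. W1 \<in> set Ks \<Longrightarrow> W2 \<in> set Ks \<Longrightarrow> W3 \<in> set Ks \<Longrightarrow> W1 \<noteq> W2 \<Longrightarrow> W1 \<noteq> W3 \<Longrightarrow> W2 \<noteq> W3 \<Longrightarrow>
       own W1 = own W2 \<Longrightarrow> own W1 = own W3 \<Longrightarrow> col W1 = col W2 \<Longrightarrow> col W1 = col W3 \<Longrightarrow>
       card W1 \<le> 2 \<Longrightarrow> card W2 \<le> 2 \<Longrightarrow> card W3 \<le> 2 \<Longrightarrow> d \<le> 1"
proof -
  let ?R = "\<lambda>W q j b x. b < k \<and> q \<le> j \<and> j < length Ks \<and> x \<in> Ks ! j \<and> x \<in> U (Suc q) \<and> x \<notin> U q \<and>
    par b x \<in> W \<and> W \<inter> U q = {} \<and> W \<noteq> Ks ! j"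
  have "\<forall>W. \<exists>q j b x. W \<in> set Ks \<and> card W \<le> d + 1 \<longrightarrow> ?R W q j b x"
  proof
    fix W
    show "\<exists>q j b x. W \<in> set Ks \<and> card W \<le> d + 1 \<longrightarrow> ?R W q j b x"
    proof (cases "W \<in> set Ks \<and> card W \<le> d + 1")
      case True
      then have "W \<noteq> Ks ! 0" using card_Ks_0 by auto
      with True have "\<exists>q j b x. ?R W q j b x" by (intro parent_into_component) simp_all
      then show ?thesis by (elim exE) (intro exI impI)
    qed blast
  qed
  from this[THEN choice] obtain lv where "\<forall>W. \<exists>j b x. W \<in> set Ks \<and> card W \<le> d + 1 \<longrightarrow> ?R W (lv W) j b x"
    by (elim exE)
  from this[THEN choice] obtain j where "\<forall>W. \<exists>b x. W \<in> set Ks \<and> card W \<le> d + 1 \<longrightarrow> ?R W (lv W) (j W) b x"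
    by (elim exE)
  from this[THEN choice] obtain col where "\<forall>W. \<exists>x. W \<in> set Ks \<and> card W \<le> d + 1 \<longrightarrow> ?R W (lv W) (j W) (col W) x"
    by (elim exE)
  from this[THEN choice] obtain tail
    where t: "\<forall>W. W \<in> set Ks \<and> card W \<le> d + 1 \<longrightarrow> ?R W (lv W) (j W) (col W) (tail W)"
    by (elim exE)
  have R: "?R W (lv W) (j W) (col W) (tail W)" if "W \<in> set Ks" "card W \<le> d + 1" for W
    by (rule t[THEN spec, THEN mp]) (intro conjI that)
  define own where "own W = Ks ! j W" for W
  have KP: "W \<in> P" if "W \<in> set Ks" for W using that leg by (auto simp: legal_def)
  have jeq: "j W = j W'" if "W \<in> set Ks" "card W \<le> d + 1" "W' \<in> set Ks" "card W' \<le> d + 1" "own W = own W'" for W W'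
    using R[OF that(1,2)] R[OF that(3,4)] that(5) leg by (simp add: own_def legal_def nth_eq_iff_index_eq)
  let ?bound = "\<lambda>\<W> V. \<exists>w a. (\<forall>W\<in>\<W>. 1 \<le> a W) \<and> w + (\<Sum>W\<in>\<W>. a W) = card (own V) \<and>
    (card (own V) - 1 - d < (w - 1 - d) + (\<Sum>W\<in>\<W>. a W + card W - 1 - d) \<or>
     d + 1 < card (own V) \<and> 1 \<le> w \<and> card (own V) - 1 - d \<le> (w - 1 - d) + (\<Sum>W\<in>\<W>. a W + card W - 1 - d))"
  have bound: "?bound \<W> V"
    if V: "V \<in> \<W>" and fin: "finite \<W>"
      and \<W>: "\<And>W. W \<in> \<W> \<Longrightarrow> W \<in> set Ks \<and> card W \<le> d + 1 \<and> own W = own V \<and> col W = col V" for V \<W>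
  proof -
    have jV: "j W = j V" if "W \<in> \<W>" for W using jeq[of W V] \<W>[OF that] \<W>[OF V] by simp
    have RV: "col V < k" "j V < length Ks" using R[of V] \<W>[OF V] by simp_all
    show ?thesis
      unfolding own_def
    proof (rule children_bound[OF RV _ fin, where lv = lv and tail = tail])
      show "\<W> \<noteq> {}" using V by blast
      fix W assume W: "W \<in> \<W>"
      show "W \<in> P \<and> card W \<le> d + 1 \<and> lv W \<le> j V \<and> tail W \<in> Ks ! j V \<and> tail W \<in> U (Suc (lv W)) \<and>
        tail W \<notin> U (lv W) \<and> par (col V) (tail W) \<in> W \<and> W \<inter> U (lv W) = {} \<and> W \<noteq> Ks ! j V"
        using R[of W] \<W>[OF W] KP[of W] jV[OF W] by simp
    qed
  qed
  show ?thesis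
  proof (rule that[of own col])
    fix W assume W: "W \<in> set Ks" "card W \<le> d + 1"
    show "own W \<in> set Ks \<and> col W < k" using R[OF W] by (simp add: own_def)
    have "?bound {W} W"
      by (rule bound) (use W in auto)
    then obtain w a where "1 \<le> a W" "w + a W = card (own W)"
      "card (own W) - 1 - d < (w - 1 - d) + (a W + card W - 1 - d) \<or> d + 1 < card (own W)"
      by auto
    then show "d + 2 \<le> card (own W) + card W" by linarith
  next
    fix W1 W2
    assume *: "W1 \<in> set Ks" "W2 \<in> set Ks" "W1 \<noteq> W2" "own W1 = own W2" "col W1 = col W2"
      "card W1 = 1" "card W2 = 1"
    let ?\<W> = "{W1, W2}"
    have "?bound ?\<W> W1"
      by (rule bound) (use * in auto)
    then obtain w a where wa: "1 \<le> a W1" "1 \<le> a W2" "w + (a W1 + a W2) = card (own W1)"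
      "card (own W1) - 1 - d < (w - 1 - d) + ((a W1 - d) + (a W2 - d)) \<or>
       d + 1 < card (own W1) \<and> 1 \<le> w \<and> card (own W1) - 1 - d \<le> (w - 1 - d) + ((a W1 - d) + (a W2 - d))"
      using *(3,6,7) by auto
    then show "d = 0" by linarith
  next
    fix W1 W2 W3
    assume *: "W1 \<in> set Ks" "W2 \<in> set Ks" "W3 \<in> set Ks" "W1 \<noteq> W2" "W1 \<noteq> W3" "W2 \<noteq> W3"
      "own W1 = own W2" "own W1 = own W3" "col W1 = col W2" "col W1 = col W3"
      "card W1 \<le> 2" "card W2 \<le> 2" "card W3 \<le> 2"
    show "d \<le> 1"
    proof (rule ccontr)
      assume d: "\<not> d \<le> 1"
      then have c: "card W1 \<le> d + 1" "card W2 \<le> d + 1" "card W3 \<le> d + 1" using * by auto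
      let ?\<W> = "{W1, W2, W3}"
      have "?bound ?\<W> W1"
        by (rule bound) (use * c in auto)
      then obtain w a where a: "\<forall>W\<in>?\<W>. 1 \<le> a W" "w + (\<Sum>W\<in>?\<W>. a W) = card (own W1)"
        "card (own W1) - 1 - d < (w - 1 - d) + (\<Sum>W\<in>?\<W>. a W + card W - 1 - d) \<or>
         d + 1 < card (own W1) \<and> 1 \<le> w \<and> card (own W1) - 1 - d \<le> (w - 1 - d) + (\<Sum>W\<in>?\<W>. a W + card W - 1 - d)"
        by (elim exE conjE)
      have sum3: "(\<Sum>W\<in>?\<W>. f W) = f W1 + f W2 + f W3" for f :: "'v set \<Rightarrow> nat" using *(4-6) by simp
      have a1: "1 \<le> a W1" "1 \<le> a W2" "1 \<le> a W3" using a(1) by simp_all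
      show False using a(2,3) a1 *(11-13) d unfolding sum3 by linarith
    qed
  qed
qed

lemma card_inside_H: "card (inside (edges G) H) = k * (card H - 1) + (\<Sum>W\<in>set Ks. card W - 1)"
  and card_H: "card H = (\<Sum>W\<in>set Ks. card W)"
proof -
  have KP: "set Ks \<subseteq> P" using leg by (simp add: legal_def)
  have dj: "W \<inter> W' = {}" if "W \<in> set Ks" "W' \<in> set Ks" "W \<noteq> W'" for W W'
    using that KP fpart_disjoint[OF P] by blast
  have tW: "tight 1 F W" if "W \<in> set Ks" for W using that KP fpart_tight[OF P] by blast
  show "card H = (\<Sum>W\<in>set Ks. card W)"
    unfolding H_eq
  proof (rule card_Union_disjoint)
    show "pairwise disjnt (set Ks)" using dj by (auto simp: pairwise_def disjnt_def)
    show "finite W" if "W \<in> set Ks" for W using tight_finite[OF tW[OF that]] .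
  qed
  have "inside F H = (\<Union>W\<in>set Ks. inside F W)"
  proof
    show "inside F H \<subseteq> (\<Union>W\<in>set Ks. inside F W)"
    proof
      fix e assume e: "e \<in> inside F H"
      then have eF: "e \<in> F" "ends G e \<subseteq> H" by (auto simp: inside_def)
      obtain a where a: "a \<in> ends G e" using ends_nonempty eF FE by blast
      obtain W where W: "W \<in> P" "ends G e \<subseteq> W" using fpart_edge[OF P eF(1)] by blast
      obtain W' where W': "W' \<in> set Ks" "a \<in> W'" using a eF H_eq by blast
      have "W = W'" using fpart_disjoint[OF P W(1), of W'] W W' KP a by blast
      then show "e \<in> (\<Union>W\<in>set Ks. inside F W)" using W W' eF by (auto simp: inside_def)
    qed
    show "(\<Union>W\<in>set Ks. inside F W) \<subseteq> inside F H" unfolding H_eq by (auto simp: inside_def)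
  qed
  moreover have "card (\<Union>W\<in>set Ks. inside F W) = (\<Sum>W\<in>set Ks. card (inside F W))"
  proof (rule card_UN_disjoint)
    show "\<forall>W\<in>set Ks. finite (inside F W)" using finite_inside[OF FE] by blast
    show "\<forall>W\<in>set Ks. \<forall>W'\<in>set Ks. W \<noteq> W' \<longrightarrow> inside F W \<inter> inside F W' = {}"
    proof (intro ballI impI)
      fix W W' assume "W \<in> set Ks" "W' \<in> set Ks" "W \<noteq> W'"
      then have dis: "W \<inter> W' = {}" by (rule dj)
      have False if "e \<in> inside F W" "e \<in> inside F W'" for e
      proof -
        have "ends G e \<subseteq> W \<inter> W'" "e \<in> edges G" using that FE by (auto simp: inside_def)
        then show False using dis ends_nonempty by blast
      qed
      then show "inside F W \<inter> inside F W' = {}" by blast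
    qed
  qed simp
  moreover have "(\<Sum>W\<in>set Ks. card (inside F W)) = (\<Sum>W\<in>set Ks. card W - 1)"
    by (rule sum.cong[OF refl]) (simp add: tight_card[OF tW])
  moreover have BF: "inside (edges G) H = inside B H \<union> inside F H" "inside B H \<inter> inside F H = {}"
    using FE by (auto simp: inside_def)
  have "card (inside (edges G) H) = card (inside B H) + card (inside F H)"
    unfolding BF(1) by (rule card_Un_disjoint[OF _ finite_inside[OF FE] BF(2)]) (rule finite_inside, blast)
  ultimately show "card (inside (edges G) H) = k * (card H - 1) + (\<Sum>W\<in>set Ks. card W - 1)"
    using tight_card[OF H_tight] by simp
qed

end

text \<open>Discharging: an owner divides its weight equally among the \<open>k\<close> trees and
  pays in each for the small components entered through it. The bound is multiplied by
  \<open>k\<close> to stay within the integers.\<close>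

lemma sum_by_owner_nonneg:
  fixes \<psi> :: "'a \<Rightarrow> int" and own :: "'a \<Rightarrow> 'a" and col :: "'a \<Rightarrow> nat"
  assumes fin: "finite \<K>" and small: "\<S> \<subseteq> \<K>"
    and own: "\<And>W. W \<in> \<S> \<Longrightarrow> own W \<in> \<K> - \<S> \<and> col W < k"
    and nonneg: "\<And>K. K \<in> \<K> - \<S> \<Longrightarrow> 0 \<le> \<psi> K"
    and bound: "\<And>K b. K \<in> \<K> - \<S> \<Longrightarrow> b < k \<Longrightarrow>
      - (int k * (\<Sum>W | W \<in> \<S> \<and> own W = K \<and> col W = b. \<psi> W)) \<le> \<psi> K"
  shows "0 \<le> (\<Sum>W\<in>\<K>. \<psi> W)"
proof -
  have fS: "finite \<S>" using small fin finite_subset by blast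
  have split: "(\<Sum>W\<in>\<K>. \<psi> W) = (\<Sum>W\<in>\<S>. \<psi> W) + (\<Sum>K\<in>\<K> - \<S>. \<psi> K)"
    using sum.subset_diff[OF small fin, of \<psi>] by simp
  have nn: "0 \<le> (\<Sum>K\<in>\<K> - \<S>. \<psi> K)" by (rule sum_nonneg) (rule nonneg)
  show ?thesis
  proof (cases "k = 0")
    case True
    then have "\<S> = {}" using own by blast
    then show ?thesis using split nn by simp
  next
    case False
    let ?T = "(\<K> - \<S>) \<times> {..<k}"
    have "(\<Sum>W\<in>\<S>. \<psi> W) = (\<Sum>y\<in>?T. \<Sum>W\<in>{W \<in> \<S>. (own W, col W) = y}. \<psi> W)"
      by (rule sum.group[symmetric]) (use fin fS own in auto)
    also have "\<dots> = (\<Sum>K\<in>\<K> - \<S>. \<Sum>b<k. \<Sum>W | W \<in> \<S> \<and> own W = K \<and> col W = b. \<psi> W)"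
      unfolding sum.cartesian_product by (rule sum.cong) auto
    finally have eq: "(\<Sum>W\<in>\<S>. \<psi> W) = (\<Sum>K\<in>\<K> - \<S>. \<Sum>b<k. \<Sum>W | W \<in> \<S> \<and> own W = K \<and> col W = b. \<psi> W)" .
    have "- (int k * (\<Sum>W\<in>\<S>. \<psi> W))
        = (\<Sum>K\<in>\<K> - \<S>. \<Sum>b<k. - (int k * (\<Sum>W | W \<in> \<S> \<and> own W = K \<and> col W = b. \<psi> W)))"
      unfolding eq by (simp add: sum_distrib_left sum_negf)
    also have "\<dots> \<le> (\<Sum>K\<in>\<K> - \<S>. \<Sum>b<k. \<psi> K)"
      by (intro sum_mono bound) auto
    also have "\<dots> = int k * (\<Sum>K\<in>\<K> - \<S>. \<psi> K)" by (simp add: sum_distrib_left)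
    finally have "0 \<le> int k * (\<Sum>W\<in>\<K>. \<psi> W)" unfolding split by (simp add: distrib_left)
    then show ?thesis using False by (simp add: zero_le_mult_iff)
  qed
qed

section \<open>Counting\<close>

context rooted_config
begin

lemma card_component_pos: "W \<in> set Ks \<Longrightarrow> 1 \<le> card W"
  using leg fpart_tight[OF P] tight_card_pos by (fastforce simp: legal_def Suc_le_eq)

text \<open>One edge already gives weight k + 1 - d \<ge> 0, so only isolated vertices are in debt.
  An owner has at least \<open>d\<close> edges and weight at least (k + 1) d - d = k d, which covers
  one isolated vertex per tree.\<close>

lemma weight_nonneg_small_d:
  assumes d: "1 \<le> d" "d \<le> k + 1"
  shows "0 \<le> (\<Sum>W\<in>set Ks. int (k + 1) * (int (card W) - 1) - int d)"
proof -
  obtain own col where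
    own: "\<And>W. W \<in> set Ks \<Longrightarrow> card W \<le> d + 1 \<Longrightarrow> own W \<in> set Ks \<and> col W < k" and
    big: "\<And>W. W \<in> set Ks \<Longrightarrow> card W \<le> d + 1 \<Longrightarrow> d + 2 \<le> card (own W) + card W" and
    two: "\<And>W1 W2. W1 \<in> set Ks \<Longrightarrow> W2 \<in> set Ks \<Longrightarrow> W1 \<noteq> W2 \<Longrightarrow> own W1 = own W2 \<Longrightarrow> col W1 = col W2 \<Longrightarrow>
       card W1 = 1 \<Longrightarrow> card W2 = 1 \<Longrightarrow> d = 0"
    by (rule small_components_assignment) blast
  let ?\<S> = "{W \<in> set Ks. card W = 1}"
  have S: "W \<in> set Ks" "card W = 1" "card W \<le> d + 1" if "W \<in> ?\<S>" for W using that by auto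
  show ?thesis
  proof (rule sum_by_owner_nonneg[where \<S> = ?\<S> and own = own and col = col and k = k])
    show "finite (set Ks)" "?\<S> \<subseteq> set Ks" by auto
    show "own W \<in> set Ks - ?\<S> \<and> col W < k" if "W \<in> ?\<S>" for W
      using own[OF S(1,3)[OF that]] big[OF S(1,3)[OF that]] S(2)[OF that] d by auto
    fix K assume K: "K \<in> set Ks - ?\<S>"
    have "2 \<le> card K" using K card_component_pos[of K] by force
    then have "int (k + 1) * 1 \<le> int (k + 1) * (int (card K) - 1)" by (intro mult_left_mono) auto
    moreover have "int d \<le> int (k + 1)" using d(2) by (simp only: of_nat_le_iff)
    ultimately have "int d \<le> int (k + 1) * (int (card K) - 1)" unfolding mult_1_right by (rule order_trans[rotated])
    then show nn: "0 \<le> int (k + 1) * (int (card K) - 1) - int d" by (simp only: diff_ge_0_iff_ge)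
    fix b assume "b < k"
    let ?G = "{W. W \<in> ?\<S> \<and> own W = K \<and> col W = b}"
    show "- (int k * (\<Sum>W\<in>?G. int (k + 1) * (int (card W) - 1) - int d)) \<le> int (k + 1) * (int (card K) - 1) - int d"
    proof (cases "?G = {}")
      case True
      then show ?thesis using nn by (simp only: sum.empty mult_zero_right minus_zero)
    next
      case False
      then obtain W where W: "W \<in> ?G" by blast
      have "W' = W" if "W' \<in> ?G" for W' using two[of W W'] W that d by auto
      then have G: "?G = {W}" using W by blast
      have "d + 1 \<le> card K" using big[of W] W by auto
      then have "int (k + 1) * int d \<le> int (k + 1) * (int (card K) - 1)" by (intro mult_left_mono) auto
      moreover have "card W = 1" using W by simp
      ultimately show ?thesis unfolding G by (simp add: algebra_simps)
    qed
  qed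
qed

text \<open>Two edges suffice for nonnegative weight, so the debtors are isolated vertices and
  single edges. An owner meets at most two of them per tree. If one is an isolated vertex, the owner
  has at least \<open>d\<close> edges; if all are single edges, it may have only d - 1, but the debt
  is smaller as well.\<close>

lemma weight_nonneg_large_d:
  assumes d: "k + 1 < d" "d < 3 * (k + 1)"
  shows "0 \<le> (\<Sum>W\<in>set Ks. int (2 * k + 1) * (int (card W) - 1) - int (d + k))"
proof -
  obtain own col where
    own: "\<And>W. W \<in> set Ks \<Longrightarrow> card W \<le> d + 1 \<Longrightarrow> own W \<in> set Ks \<and> col W < k" and
    big: "\<And>W. W \<in> set Ks \<Longrightarrow> card W \<le> d + 1 \<Longrightarrow> d + 2 \<le> card (own W) + card W" and
    two: "\<And>W1 W2. W1 \<in> set Ks \<Longrightarrow> W2 \<in> set Ks \<Longrightarrow> W1 \<noteq> W2 \<Longrightarrow> own W1 = own W2 \<Longrightarrow> col W1 = col W2 \<Longrightarrow>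
       card W1 = 1 \<Longrightarrow> card W2 = 1 \<Longrightarrow> d = 0" and
    three: "\<And>W1 W2 W3. W1 \<in> set Ks \<Longrightarrow> W2 \<in> set Ks \<Longrightarrow> W3 \<in> set Ks \<Longrightarrow> W1 \<noteq> W2 \<Longrightarrow> W1 \<noteq> W3 \<Longrightarrow> W2 \<noteq> W3 \<Longrightarrow>
       own W1 = own W2 \<Longrightarrow> own W1 = own W3 \<Longrightarrow> col W1 = col W2 \<Longrightarrow> col W1 = col W3 \<Longrightarrow>
       card W1 \<le> 2 \<Longrightarrow> card W2 \<le> 2 \<Longrightarrow> card W3 \<le> 2 \<Longrightarrow> d \<le> 1"
    by (rule small_components_assignment) blast
  let ?\<S> = "{W \<in> set Ks. card W \<le> 2}"
  let ?\<psi> = "\<lambda>W. int (2 * k + 1) * (int (card W) - 1) - int (d + k)"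
  have S: "W \<in> set Ks" "card W \<le> 2" "card W \<le> d + 1" "card W = 1 \<or> card W = 2" if "W \<in> ?\<S>" for W
    using that d card_component_pos[of W] by auto
  have \<psi>1: "?\<psi> W = - int (d + k)" if "card W = 1" for W using that by simp
  have \<psi>2: "?\<psi> W = int k + 1 - int d" if "card W = 2" for W using that by simp
  show ?thesis
  proof (rule sum_by_owner_nonneg[where \<S> = ?\<S> and own = own and col = col and k = k])
    show "finite (set Ks)" "?\<S> \<subseteq> set Ks" by auto
    show "own W \<in> set Ks - ?\<S> \<and> col W < k" if "W \<in> ?\<S>" for W
      using own[OF S(1,3)[OF that]] big[OF S(1,3)[OF that]] S(2)[OF that] d by auto
    fix K assume K: "K \<in> set Ks - ?\<S>"
    then have "3 \<le> card K" by auto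
    then have "int (2 * k + 1) * 2 \<le> int (2 * k + 1) * (int (card K) - 1)" by (intro mult_left_mono) auto
    then show nn: "0 \<le> ?\<psi> K" using d by simp
    fix b assume b: "b < k"
    define \<G> where "\<G> = {W. W \<in> ?\<S> \<and> own W = K \<and> col W = b}"
    have \<G>: "W \<in> set Ks" "card W \<le> 2" "own W = K" "col W = b" if "W \<in> \<G>" for W
      using that by (auto simp: \<G>_def)
    have c12: "card W = 1 \<or> card W = 2" if "W \<in> \<G>" for W
      using \<G>(2)[OF that] card_component_pos[OF \<G>(1)[OF that]] by linarith
    \<comment> \<open>From d \<ge> k + 2 and k \<ge> 1 come bounds for the products k d and k k,
      after which the cases below are linear.\<close>
    have kd: "int k * (int k + 2) \<le> int k * int d" using d by (intro mult_left_mono) auto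
    obtain m where m: "int k * int k = m" by simp
    have "1 * int k \<le> int k * int k" using b by (intro mult_right_mono) auto
    then have k1: "int k * int k = m" "int k \<le> m" unfolding m by simp_all
    have k2: "int k * (int k * 2) = 2 * m" using k1(1) by simp
    have "- (int k * (\<Sum>W\<in>\<G>. ?\<psi> W)) \<le> ?\<psi> K"
    proof (cases "\<G> = {}")
      case True
      then show ?thesis using nn by (simp only: sum.empty mult_zero_right minus_zero)
    next
      case False
      then obtain W1 where W1: "W1 \<in> \<G>" by blast
      have K1: "d + 2 \<le> card K + card W" if "W \<in> \<G>" for W
        using big[OF \<G>(1)[OF that]] \<G>(2,3)[OF that] d by simp
      have "int d - 1 \<le> int (card K) - 1" using K1[OF W1] \<G>(2)[OF W1] by linarith
      then have Kd: "int (2 * k + 1) * (int d - 1) \<le> int (2 * k + 1) * (int (card K) - 1)"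
        by (rule mult_left_mono) simp
      have Kd1: "int (2 * k + 1) * int d \<le> int (2 * k + 1) * (int (card K) - 1)" if "W \<in> \<G>" "card W = 1" for W
        using K1[OF that(1)] that(2) by (intro mult_left_mono) auto
      show ?thesis
      proof (cases "\<G> = {W1}")
        case True
        then have sum: "(\<Sum>W\<in>\<G>. ?\<psi> W) = ?\<psi> W1" by simp
        consider "card W1 = 1" | "card W1 = 2" using c12[OF W1] by blast
        then show ?thesis
        proof cases
          case 1
          show ?thesis unfolding sum \<psi>1[OF 1] using Kd1[OF W1 1] kd k1 by (simp add: algebra_simps)
        next
          case 2
          show ?thesis unfolding sum \<psi>2[OF 2] using Kd kd k1 b by (simp add: algebra_simps)
        qed
      next
        case False
        then obtain W2 where W2: "W2 \<in> \<G>" "W1 \<noteq> W2" using W1 by blast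
        have "W = W1 \<or> W = W2" if W: "W \<in> \<G>" for W
        proof (rule ccontr)
          assume "\<not> ?thesis"
          then have "W1 \<noteq> W" "W2 \<noteq> W" by auto
          then have "d \<le> 1"
            using three[of W1 W2 W] \<G>[OF W1] \<G>[OF W2(1)] \<G>[OF W] W2(2) by simp
          then show False using d b by linarith
        qed
        then have "\<G> = {W1, W2}" using W1 W2 by blast
        then have sum: "(\<Sum>W\<in>\<G>. ?\<psi> W) = ?\<psi> W1 + ?\<psi> W2" using W2(2) by simp
        have nt: "\<not> (card W1 = 1 \<and> card W2 = 1)"
          using two[of W1 W2] \<G>[OF W1] \<G>[OF W2(1)] W2(2) d by auto
        consider "card W1 = 1" "card W2 = 2" | "card W1 = 2" "card W2 = 1" | "card W1 = 2" "card W2 = 2"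
          using c12[OF W1] c12[OF W2(1)] nt by blast
        then show ?thesis
        proof cases
          case 1
          show ?thesis
            unfolding sum \<psi>1[OF 1(1)] \<psi>2[OF 1(2)] using Kd1[OF W1 1(1)] by (simp add: algebra_simps)
        next
          case 2
          show ?thesis
            unfolding sum \<psi>2[OF 2(1)] \<psi>1[OF 2(2)] using Kd1[OF W2(1) 2(2)] by (simp add: algebra_simps)
        next
          \<comment> \<open>The owner may have only d - 1 edges; the slack is then (2 k + 1) (k -
            1), nonnegative because \<open>b < k\<close> gives k \<ge> 1.\<close>
          case 3
          show ?thesis
            unfolding sum \<psi>2[OF 3(1)] \<psi>2[OF 3(2)] using Kd kd k1 b by (simp add: algebra_simps k2)
        qed
      qed
    qed
    then show "- (int k * (\<Sum>W | W \<in> ?\<S> \<and> own W = K \<and> col W = b. ?\<psi> W)) \<le> ?\<psi> K"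
      unfolding \<G>_def .
  qed
qed

text \<open>In both ranges \<chi> has the form N / (M + N). With e red edges and t components in
  \<open>H\<close> the density bound becomes e (M + N) \<le> N (e + t - 1), that is e M \<le> N (t -
  1). The summand - 1, from the denominator of the fractional arboricity, makes the inequality
  strict.\<close>

lemma weight_negative:
  fixes M N :: nat
  assumes N: "0 < N"
    and dens: "real (card (inside (edges G) H)) \<le> (real k + real N / real (M + N)) * (real (card H) - 1)"
  shows "(\<Sum>W\<in>set Ks. int M * (int (card W) - 1) - int N) < 0"
proof -
  define e where "e = (\<Sum>W\<in>set Ks. card W - 1)"
  define t where "t = card (set Ks)"
  have "(\<Sum>W\<in>set Ks. card W) = (\<Sum>W\<in>set Ks. (card W - 1) + 1)"
    by (rule sum.cong[OF refl]) (simp add: card_component_pos del: One_nat_def)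
  also have "\<dots> = e + t" unfolding e_def t_def by (simp only: sum.distrib) simp
  finally have n: "card H = e + t" unfolding card_H .
  have t: "1 \<le> t" using Ks_nonempty by (cases Ks) (auto simp: t_def card_gt_0_iff Suc_le_eq)
  have "real (k * (e + t - 1) + e) \<le> (real k + real N / real (M + N)) * (real (e + t) - 1)"
    using dens unfolding card_inside_H n e_def[symmetric] .
  moreover have "real (e + t - 1) = real (e + t) - 1" using t by simp
  ultimately have "real e \<le> real N / real (M + N) * (real (e + t) - 1)"
    by (simp add: distrib_right)
  then have "real e * real (M + N) \<le> real N * (real (e + t) - 1)"
    using N by (simp add: field_simps)
  then have "real (e * M) < real (N * t)"
    using N by (simp add: algebra_simps)
  then have lt: "e * M < N * t" by (simp only: of_nat_less_iff)
  have "(\<Sum>W\<in>set Ks. int M * (int (card W) - 1) - int N) = (\<Sum>W\<in>set Ks. int M * int (card W - 1) - int N)"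
    by (rule sum.cong) (use card_component_pos in \<open>auto simp: of_nat_diff\<close>)
  also have "\<dots> = int M * int e - int N * int t"
    unfolding e_def t_def by (simp add: sum_subtractf sum_distrib_left)
  also have "\<dots> < 0" using lt by (metis diff_less_0_iff_less mult.commute of_nat_less_iff of_nat_mult)
  finally show ?thesis .
qed

end

section \<open>From fractional arboricity to forests\<close>

context multigraph
begin

lemma card_inside_le_arboricity:
  assumes S: "S \<subseteq> verts G" "2 \<le> card S" and q: "fractional_arboricity G \<le> q"
  shows "real (card (inside (edges G) S)) \<le> q * (real (card S) - 1)"
proof -
  let ?H = "\<lparr>verts = S, edges = inside (edges G) S, ends = ends G\<rparr>"
  have "multigraph ?H"
    by unfold_locales
      (use S finite_subset_verts finite_inside[of "edges G" S] no_loops in \<open>auto simp: inside_def\<close>)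
  then have "subgraph ?H G" using S by (auto simp: subgraph_def inside_def)
  then have "real (card (inside (edges G) S)) / (real (card S) - 1) \<in> density_values G"
    using S unfolding density_values_def by (intro CollectI exI[of _ ?H]) simp
  then have "real (card (inside (edges G) S)) / (real (card S) - 1) \<le> fractional_arboricity G"
    using finite_density_values[OF multigraph_axioms] unfolding fractional_arboricity_def by auto
  then have "real (card (inside (edges G) S)) / (real (card S) - 1) \<le> q" using q by simp
  then show ?thesis using S(2) by (simp add: field_simps)
qed

lemma sparse_if_density:
  assumes dens: "\<And>S. S \<subseteq> verts G \<Longrightarrow> 2 \<le> card S \<Longrightarrow> real (card (inside (edges G) S)) \<le> q * (real (card S) - 1)"
    and q: "q \<le> real m"
  shows "sparse m (edges G)"
  unfolding sparse_def
proof (intro conjI allI impI)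
  fix S assume S: "S \<subseteq> verts G" "S \<noteq> {}"
  have c0: "card S \<noteq> 0" using S finite_subset_verts by auto
  show "card (inside (edges G) S) \<le> m * (card S - 1)"
  proof (cases "card S = 1")
    case True
    then obtain v where "S = {v}" by (auto simp: card_1_singleton_iff)
    then show ?thesis using inside_singleton[of "edges G" v] by simp
  next
    case False
    then have two: "2 \<le> card S" using c0 by simp
    have "real (card (inside (edges G) S)) \<le> q * (real (card S) - 1)" by (rule dens[OF S(1) two])
    also have "\<dots> \<le> real m * (real (card S) - 1)" using q two by (intro mult_right_mono) auto
    also have "\<dots> = real (m * (card S - 1))" using two by (simp add: of_nat_diff)
    finally show ?thesis by (simp only: of_nat_le_iff)
  qed
qed simp

lemma chi_le_1: "chi d k \<le> 1"
  by (auto simp: chi_def divide_simps)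

lemma bounded_config_exists:
  assumes d: "d < 3 * (k + 1)" and dens: "fractional_arboricity G \<le> real k + chi d k"
  shows "\<exists>F P. config k F P \<and> excess d P = 0"
proof (cases "d = 0")
  \<comment> \<open>For d = 0 the weight N = d would give no strict inequality. But then \<chi>
    vanishes, all edges can be blue, and the empty forest serves.\<close>
  case True
  have "sparse k (edges G)"
    by (rule sparse_if_density[of "real k + chi d k"])
       (use card_inside_le_arboricity[OF _ _ dens] True in \<open>auto simp: chi_def\<close>)
  moreover have "sparse 1 {}" by (simp add: sparse_def inside_def)
  then obtain P where P: "fpart {} P" using fpart_exists by blast
  moreover have "excess d P = 0"
    unfolding excess_def
  proof (rule sum.neutral, rule ballI)
    fix W assume "W \<in> P"
    then have "card (inside {} W) = card W - 1" using tight_card[OF fpart_tight[OF P]] by simp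
    then show "card W - 1 - d = 0" by (simp add: inside_def)
  qed
  ultimately have "config k {} P \<and> excess d P = 0" by (simp add: config_def)
  then show ?thesis by blast
next
  case False
  have "sparse (k + 1) (edges G)"
    by (rule sparse_if_density[of "real k + chi d k"])
       (use card_inside_le_arboricity[OF _ _ dens] chi_le_1[of d k] in auto)
  then obtain F0 P0 where opt: "optimal k d F0 P0" using optimal_exists by blast
  have "excess d P0 = 0"
  proof (rule ccontr)
    assume "excess d P0 \<noteq> 0"
    then obtain F P Ks r where "min_config G k d F P Ks r" using min_config_exists[OF opt] by blast
    then interpret min_config G k d F P Ks r .
    obtain T par pe where "rooted_config G k d F P Ks r T par pe" using rooted_config_exists by blast
    then interpret rooted_config G k d F P Ks r T par pe .
    have "Ks ! 0 \<subseteq> H" using H_eq Ks_nonempty by auto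
    then have "2 \<le> card H" using card_Ks_0 card_mono[OF finite_H, of "Ks ! 0"] by linarith
    note H = card_inside_le_arboricity[OF H_verts this dens]
    show False
    proof (cases "d \<le> k + 1")
      case True
      have "(\<Sum>W\<in>set Ks. int (k + 1) * (int (card W) - 1) - int d) < 0"
        by (rule weight_negative) (use H True False in \<open>simp_all add: chi_def algebra_simps\<close>)
      then show False using weight_nonneg_small_d True False by simp
    next
      case dk: False
      have "(\<Sum>W\<in>set Ks. int (2 * k + 1) * (int (card W) - 1) - int (d + k)) < 0"
        by (rule weight_negative) (use H dk in \<open>simp_all add: chi_def algebra_simps\<close>)
      then show False using weight_nonneg_large_d d dk by simp
    qed
  qed
  then show ?thesis using opt optimal_config by blast
qed

text \<open>A cycle would place as many edges inside its vertex set as there are vertices.\<close>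

lemma sparse_forest:
  assumes "sparse 1 A" shows "forest (spanning_subgraph G A)"
  unfolding forest_def
proof
  show "multigraph (spanning_subgraph G A)"
    by unfold_locales
      (use sparse_edges[OF assms] finite_verts finite_subset_edges ends_in_verts no_loops in
        \<open>auto simp: spanning_subgraph_def\<close>)
  show "\<nexists>vs es. is_cycle (spanning_subgraph G A) vs es"
  proof
    assume "\<exists>vs es. is_cycle (spanning_subgraph G A) vs es"
    then obtain vs es where c: "length vs = length es" "2 \<le> length es" "distinct vs" "distinct es"
      "set vs \<subseteq> verts G" "set es \<subseteq> A"
      "\<And>i. i < length es \<Longrightarrow> ends G (es ! i) = {vs ! i, vs ! (Suc i mod length vs)}"
      by (auto simp: is_cycle_def spanning_subgraph_def)
    have "ends G e \<subseteq> set vs" if e: "e \<in> set es" for e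
    proof -
      obtain i where i: "i < length es" "e = es ! i" using e by (auto simp: in_set_conv_nth)
      have "Suc i mod length vs < length vs" by (rule mod_less_divisor) (use c(1,2) in linarith)
      then show ?thesis using c(1,7) i by auto
    qed
    then have "set es \<subseteq> inside A (set vs)" using c(6) by (auto simp: inside_def)
    then have "card (set es) \<le> card (inside A (set vs))"
      by (rule card_mono[OF finite_inside[OF sparse_edges[OF assms]]])
    also have "\<dots> \<le> 1 * (card (set vs) - 1)"
      by (rule sparse_card[OF assms c(5)]) (use c(1,2) in auto)
    finally show False using c(1-4) by (simp add: distinct_card)
  qed
qed

lemma component_in_block:
  assumes P: "fpart F P" and C: "component C (spanning_subgraph G F)"
  shows "\<exists>W\<in>P. edges C \<subseteq> inside F W"
proof -
  have sub: "subgraph C (spanning_subgraph G F)" and con: "connected_graph C"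
    using C by (auto simp: component_def)
  have C': "multigraph C" "verts C \<subseteq> verts G" "edges C \<subseteq> F" "ends C = ends G"
    using sub by (auto simp: subgraph_def spanning_subgraph_def)
  obtain u where u: "u \<in> verts C" using con by (auto simp: connected_graph_def)
  then obtain W where W: "W \<in> P" "u \<in> W" using fpart_cover[OF P] C' by blast
  have "v \<in> W" if "v \<in> verts C" for v
  proof -
    have "(u, v) \<in> (adj C)\<^sup>*" using con u that by (auto simp: connected_graph_def)
    then show ?thesis
    proof (induction rule: rtrancl_induct)
      case (step a c)
      then obtain e where e: "e \<in> F" "ends G e = {a, c}" using C' by (auto simp: adj_def)
      then obtain W' where "W' \<in> P" "{a, c} \<subseteq> W'" using fpart_edge[OF P e(1)] by auto
      then show ?case using fpart_disjoint[OF P _ W(1)] step(3) by blast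
    qed (rule W(2))
  qed
  then have "ends G e \<subseteq> W" if "e \<in> edges C" for e
    using multigraph.ends_in_verts[OF C'(1) that] C'(4) by auto
  then show ?thesis using W C'(3) by (auto simp: inside_def)
qed

end

theorem theorem2p1:
  fixes G :: "('v, 'e) mgraph" and d k :: nat
  assumes "multigraph G"
    and "d < 3 * (k + 1)"
    and "fractional_arboricity G \<le> real k + chi d k"
  shows "\<exists>F :: nat \<Rightarrow> 'e set.
    disjoint_family_on F {..<k + 1} \<and> (\<Union>i<k + 1. F i) = edges G \<and>
    (\<forall>i<k + 1. forest (spanning_subgraph G (F i))) \<and>
    (\<exists>j<k + 1. \<forall>C. component C (spanning_subgraph G (F j)) \<longrightarrow> card (edges C) \<le> d)"
proof -
  interpret multigraph G by (rule assms(1))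
  obtain R P where RP: "config k R P" and ex: "excess d P = 0"
    using bounded_config_exists[OF assms(2,3)] by blast
  have P: "fpart R P" and B: "sparse k (edges G - R)" using RP by (auto simp: config_def)
  have R: "sparse 1 R" by (rule fpart_sparse[OF P])
  obtain T where T: "forest_decomposition k (edges G - R) T" using nash_williams[OF B] .
  define F where "F i = (if i < k then T i else R)" for i
  have TR: "T i \<inter> R = {}" if "i < k" for i using T that by (auto simp: forest_decomposition_def)
  have "F a \<inter> F b = {}" if "a < k + 1" "b < k + 1" "a \<noteq> b" for a b
    using that T TR[of a] TR[of b] by (auto simp: F_def forest_decomposition_def disjoint_family_on_def)
  then have "disjoint_family_on F {..<k + 1}" by (auto simp: disjoint_family_on_def)
  moreover have "(\<Union>i<k + 1. F i) = edges G"
  proof -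
    have "(\<Union>i<k + 1. F i) = (\<Union>i<k. T i) \<union> R" by (auto simp: F_def lessThan_Suc split: if_splits)
    then show ?thesis using T sparse_edges[OF R] by (auto simp: forest_decomposition_def)
  qed
  moreover have "forest (spanning_subgraph G (F i))" if "i < k + 1" for i
    by (rule sparse_forest) (use T R in \<open>simp add: F_def forest_decomposition_def\<close>)
  moreover have "card (edges C) \<le> d" if C: "component C (spanning_subgraph G (F k))" for C
  proof -
    have Fk: "F k = R" by (simp add: F_def)
    obtain W where W: "W \<in> P" "edges C \<subseteq> inside R W"
      using component_in_block[OF P] C unfolding Fk by blast
    have "card (edges C) \<le> card (inside R W)"
      using W(2) by (rule card_mono[OF finite_inside[OF sparse_edges[OF R]]])
    also have "\<dots> = card W - 1" using tight_card[OF fpart_tight[OF P W(1)]] by simp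
    also have "\<dots> \<le> d"
    proof -
      have "\<forall>W\<in>P. card W - 1 - d = 0"
        using ex fpart_finite[OF P] unfolding excess_def by (simp only: sum_eq_0_iff)
      then have "card W - 1 - d = 0" using W(1) by blast
      then show ?thesis by linarith
    qed
    finally show ?thesis .
  qed
  ultimately show ?thesis by (intro exI[of _ F] conjI allI impI exI[of _ k]) auto
qed

end
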